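(* For any closed set $N\subset H$, $$\inf_{x\in N}V(x)\le\liminf_{\mu\downarrow0}\ \inf_{x\in N}V_\mu(x).$$
   Context: Spaces. Let $d\ge 1$, let $D\subset\mathbb R^d$ be a bounded regular open domain, $H=L^2(D)$, and let $A$ be the realization in $H$ of the Laplacian with Dirichlet boundary conditions. Let $\{e_k\}$ be a complete orthonormal basis of $H$ with $Ae_k=-\alpha_ke_k$, $0<\alpha_1\le\alpha_k\le\alpha_{k+1}$; $D$ is regular enough that $\alpha_k\sim k^{2/d}$. For $\delta\in\mathbb R$, $H^\delta$ is the Hilbert space obtained by completing $\mathrm{span}\{e_k\}$ in the norm $|x|_{H^\delta}^2=\sum_k\alpha_k^\delta\langle x,e_k\rangle_H^2$ (so $H^0=H$). Set $\mathcal H_\delta=H^\delta\times H^{\delta-1}$ with the product norm and $\mathcal H=\mathcal H_0$. Assumptions. $Q$ is a bounded linear operator on $H$ with $Qe_k=\lambda_ke_k$ and $\frac1c\alpha_k^{-\beta}\le\lambda_k\le c\,\alpha_k^{-\beta}$ for all $k$, for some $c>0$ and $\beta>(d-2)/4$. For every $\delta\in[0,1+2\beta]$ the map $B:H^\delta\to H^\delta$ is Lipschitz with Lipschitz constant $\gamma_\delta<\alpha_1$; $B(0)=0$; $B$ is differentiable in $H^{2\beta}$ with $\sup_{x\in H^{2\beta}}\|DB(x)\|_{\mathcal L(H^{2\beta})}=\gamma_{2\beta}$. Operators. For $\mu>0$, $S_\mu(t)$, $t\ge0$, is the semigroup on $\mathcal H_\delta$ generated by $A_\mu(u,v)=\left(v,\frac1\mu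 Au-\frac1\mu v\right)$, $D(A_\mu)=\mathcal H_{1+\delta}$. Put $B_\mu(u,v)=\frac1\mu(0,B(u))$ and $Q_\mu u=\frac1\mu(0,Qu)$. Quasi-potentials ($\inf\emptyset=+\infty$). For $T>0$ and $z\in C([0,T];\mathcal H)$, $I^\mu_{0,T}(z)=\frac12\inf|\psi|^2_{L^2((0,T);H)}$ over all $\psi\in L^2((0,T);H)$ with $z(t)=S_\mu(t)z(0)+\int_0^tS_\mu(t-s)B_\mu(z(s))ds+\int_0^tS_\mu(t-s)Q_\mu\psi(s)ds$ on $[0,T]$. For $\varphi\in C([0,T];H)$, $I_{0,T}(\varphi)=\frac12\inf|\psi|^2_{L^2((0,T);H)}$ over all $\psi\in L^2((0,T);H)$ with $\varphi(t)=e^{tA}\varphi(0)+\int_0^te^{(t-s)A}B(\varphi(s))ds+\int_0^te^{(t-s)A}Q\psi(s)ds$ on $[0,T]$. Then $V^\mu(x,y)=\inf\{I^\mu_{0,T}(z): T>0,\ z\in C([0,T];\mathcal H),\ z(0)=0,\ z(T)=(x,y)\}$ for $(x,y)\in\mathcal H$; $V_\mu(x)=\inf_{y\in H^{-1}}V^\mu(x,y)$ for $x\in H$; and $V(x)=\inf\{I_{0,T}(\varphi): T\ge0,\ \varphi\in C([0,T];H),\ \varphi(0)=0,\ \varphi(T)=x\}$ for $x\in H$. *)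

theory Defs
  imports "HOL-Analysis.Analysis" "HOL-Library.Landau_Symbols"
begin

section \<open>The Dirichlet Laplacian in \<open>L\<^sup>2(D)\<close>\<close>

definition L2 :: "(real ^ 'd) set \<Rightarrow> (real ^ 'd \<Rightarrow> real) set" where
  "L2 D = {f. f \<in> borel_measurable (lebesgue_on D) \<and> integrable (lebesgue_on D) (\<lambda>x. (f x)\<^sup>2)}"

text \<open>
  There is no type of \<open>L\<^sup>2\<close> classes on a variable domain. A Hilbert space type \<open>'h\<close> is therefore
  identified with \<open>L\<^sup>2(D)\<close> by a map \<open>rep\<close> that picks a representative function of each class:
  a linear isometry (up to null sets) that hits every class.
\<close>

definition is_L2_space :: "(real ^ 'd) set \<Rightarrow> ('h::real_inner \<Rightarrow> real ^ 'd \<Rightarrow> real) \<Rightarrow> bool" where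
  "is_L2_space D rep \<longleftrightarrow>
     (\<forall>u. rep u \<in> L2 D) \<and>
     (\<forall>u v. AE x in lebesgue_on D. rep (u + v) x = rep u x + rep v x) \<and>
     (\<forall>a u. AE x in lebesgue_on D. rep (a *\<^sub>R u) x = a * rep u x) \<and>
     (\<forall>u v. u \<bullet> v = (LINT x|lebesgue_on D. rep u x * rep v x)) \<and>
     (\<forall>f\<in>L2 D. \<exists>u. AE x in lebesgue_on D. rep u x = f x)"

fun partials :: "'d list \<Rightarrow> (real ^ 'd \<Rightarrow> real) \<Rightarrow> real ^ 'd \<Rightarrow> real" where
  "partials [] f = f"
| "partials (i # js) f = (\<lambda>x. frechet_derivative (partials js f) (at x) (axis i 1))"

definition laplacian :: "(real ^ 'd \<Rightarrow> real) \<Rightarrow> real ^ 'd \<Rightarrow> real" where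
  "laplacian f x = (\<Sum>i\<in>UNIV. partials [i, i] f x)"

definition test_functions :: "(real ^ 'd) set \<Rightarrow> (real ^ 'd \<Rightarrow> real) set" where
  "test_functions D = {\<phi>. (\<forall>js x. partials js \<phi> differentiable at x) \<and>
     (\<exists>K. compact K \<and> K \<subseteq> D \<and> (\<forall>x. x \<notin> K \<longrightarrow> \<phi> x = 0))}"

text \<open>
  The Sobolev space \<open>H\<^sup>1\<^sub>0(D)\<close>, the \<open>H\<^sup>1\<close>-closure of the test functions;
  \<open>g i\<close> is the \<open>i\<close>-th weak partial derivative of \<open>u\<close>.
\<close>

definition sobolev_H10 :: "(real ^ 'd) set \<Rightarrow> (real ^ 'd \<Rightarrow> real) set" where
  "sobolev_H10 D = {u \<in> L2 D. \<exists>\<phi> g.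
     (\<forall>n::nat. \<phi> n \<in> test_functions D) \<and> (\<forall>i. g i \<in> L2 D) \<and>
     (\<lambda>n. LINT x|lebesgue_on D. (\<phi> n x - u x)\<^sup>2) \<longlonglongrightarrow> 0 \<and>
     (\<forall>i. (\<lambda>n. LINT x|lebesgue_on D. (partials [i] (\<phi> n) x - g i x)\<^sup>2) \<longlonglongrightarrow> 0)}"

text \<open>
  Graph of the realization of the Laplacian in \<open>L\<^sup>2(D)\<close> with Dirichlet boundary conditions:
  \<open>u \<in> H\<^sup>1\<^sub>0(D)\<close> whose distributional Laplacian is \<open>w \<in> L\<^sup>2(D)\<close>.
\<close>

definition dirichlet_laplacian ::
    "(real ^ 'd) set \<Rightarrow> ('h::real_inner \<Rightarrow> real ^ 'd \<Rightarrow> real) \<Rightarrow> ('h \<times> 'h) set" where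
  "dirichlet_laplacian D rep = {(u, w). rep u \<in> sobolev_H10 D \<and>
     (\<forall>\<phi>\<in>test_functions D.
        (LINT x|lebesgue_on D. rep u x * laplacian \<phi> x) = (LINT x|lebesgue_on D. rep w x * \<phi> x))}"

section \<open>The scale \<open>H\<^sup>\<delta>\<close>\<close>

definition complete_orthonormal :: "(nat \<Rightarrow> 'h::real_inner) \<Rightarrow> bool" where
  "complete_orthonormal e \<longleftrightarrow>
     (\<forall>j k. e j \<bullet> e k = (if j = k then 1 else 0)) \<and> closure (span (range e)) = UNIV"

text \<open>
  For \<open>\<delta> \<ge> 0\<close> the completion of the span of the \<open>e k\<close> is a subspace of \<open>H\<close>.
\<close>

definition Hspace :: "(nat \<Rightarrow> 'h::real_inner) \<Rightarrow> (nat \<Rightarrow> real) \<Rightarrow> real \<Rightarrow> 'h set" where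
  "Hspace e \<alpha> \<delta> = {x. summable (\<lambda>k. \<alpha> k powr \<delta> * (x \<bullet> e k)\<^sup>2)}"

definition Hnorm :: "(nat \<Rightarrow> 'h::real_inner) \<Rightarrow> (nat \<Rightarrow> real) \<Rightarrow> real \<Rightarrow> 'h \<Rightarrow> real" where
  "Hnorm e \<alpha> \<delta> x = sqrt (\<Sum>k. \<alpha> k powr \<delta> * (x \<bullet> e k)\<^sup>2)"

text \<open>
  For \<open>\<delta> < 0\<close> the completion is larger than \<open>H\<close>. It is a complete type \<open>'v\<close> together with
  an embedding \<open>\<iota>\<close> of \<open>H\<close> that is isometric for the \<open>H\<^sup>\<delta>\<close> norm on \<open>H\<close> and maps the span of
  the \<open>e k\<close> to a dense set. Only \<open>H\<^sup>-\<^sup>1\<close> is used below.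
\<close>

definition is_negative_Hspace ::
    "(nat \<Rightarrow> 'h::real_inner) \<Rightarrow> (nat \<Rightarrow> real) \<Rightarrow> real \<Rightarrow> ('h \<Rightarrow> 'v::{real_inner,banach}) \<Rightarrow> bool" where
  "is_negative_Hspace e \<alpha> \<delta> \<iota> \<longleftrightarrow>
     linear \<iota> \<and> (\<forall>x. norm (\<iota> x) = Hnorm e \<alpha> \<delta> x) \<and> closure (\<iota> ` span (range e)) = UNIV"

definition Hlipschitz ::
    "(nat \<Rightarrow> 'h::real_inner) \<Rightarrow> (nat \<Rightarrow> real) \<Rightarrow> real \<Rightarrow> real \<Rightarrow> ('h \<Rightarrow> 'h) \<Rightarrow> bool" where
  "Hlipschitz e \<alpha> \<delta> L f \<longleftrightarrow> f ` Hspace e \<alpha> \<delta> \<subseteq> Hspace e \<alpha> \<delta> \<and>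
     (\<forall>x\<in>Hspace e \<alpha> \<delta>. \<forall>y\<in>Hspace e \<alpha> \<delta>. Hnorm e \<alpha> \<delta> (f x - f y) \<le> L * Hnorm e \<alpha> \<delta> (x - y))"

definition Hbounded_linear ::
    "(nat \<Rightarrow> 'h::real_inner) \<Rightarrow> (nat \<Rightarrow> real) \<Rightarrow> real \<Rightarrow> ('h \<Rightarrow> 'h) \<Rightarrow> bool" where
  "Hbounded_linear e \<alpha> \<delta> L \<longleftrightarrow> L ` Hspace e \<alpha> \<delta> \<subseteq> Hspace e \<alpha> \<delta> \<and>
     (\<forall>x\<in>Hspace e \<alpha> \<delta>. \<forall>y\<in>Hspace e \<alpha> \<delta>. L (x + y) = L x + L y) \<and>
     (\<forall>x\<in>Hspace e \<alpha> \<delta>. \<forall>a. L (a *\<^sub>R x) = a *\<^sub>R L x) \<and>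
     (\<exists>C. \<forall>x\<in>Hspace e \<alpha> \<delta>. Hnorm e \<alpha> \<delta> (L x) \<le> C * Hnorm e \<alpha> \<delta> x)"

definition Honorm ::
    "(nat \<Rightarrow> 'h::real_inner) \<Rightarrow> (nat \<Rightarrow> real) \<Rightarrow> real \<Rightarrow> ('h \<Rightarrow> 'h) \<Rightarrow> ereal" where
  "Honorm e \<alpha> \<delta> L = (SUP h\<in>Hspace e \<alpha> \<delta> - {0}. ereal (Hnorm e \<alpha> \<delta> (L h) / Hnorm e \<alpha> \<delta> h))"

text \<open>Frechet differentiability with respect to the \<open>H\<^sup>\<delta>\<close> norm.\<close>

definition Hhas_derivative ::
    "(nat \<Rightarrow> 'h::real_inner) \<Rightarrow> (nat \<Rightarrow> real) \<Rightarrow> real \<Rightarrow> ('h \<Rightarrow> 'h) \<Rightarrow> ('h \<Rightarrow> 'h) \<Rightarrow> 'h \<Rightarrow> bool" where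
  "Hhas_derivative e \<alpha> \<delta> f L x \<longleftrightarrow> Hbounded_linear e \<alpha> \<delta> L \<and>
     (\<forall>\<epsilon>>0. \<exists>r>0. \<forall>h\<in>Hspace e \<alpha> \<delta>. Hnorm e \<alpha> \<delta> h < r \<longrightarrow>
        Hnorm e \<alpha> \<delta> (f (x + h) - f x - L h) \<le> \<epsilon> * Hnorm e \<alpha> \<delta> h)"

section \<open>Semigroups\<close>

definition C0_semigroup :: "(real \<Rightarrow> 'x::real_normed_vector \<Rightarrow> 'x) \<Rightarrow> bool" where
  "C0_semigroup S \<longleftrightarrow> (\<forall>t\<ge>0. bounded_linear (S t)) \<and> S 0 = id \<and>
     (\<forall>s\<ge>0. \<forall>t\<ge>0. S (s + t) = S s \<circ> S t) \<and> (\<forall>x. ((\<lambda>t. S t x) \<longlongrightarrow> x) (at_right 0))"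

definition generator :: "(real \<Rightarrow> 'x::real_normed_vector \<Rightarrow> 'x) \<Rightarrow> ('x \<times> 'x) set" where
  "generator S = {(x, y). ((\<lambda>t. (S t x - x) /\<^sub>R t) \<longlongrightarrow> y) (at_right 0)}"

text \<open>\<open>A\<close> as an operator from \<open>H\<^sup>1\<close> to \<open>H\<^sup>-\<^sup>1\<close>, the continuous extension of \<open>A e\<^sub>k = -\<alpha>\<^sub>k e\<^sub>k\<close>.\<close>

definition A_ext ::
    "(nat \<Rightarrow> 'h::real_inner) \<Rightarrow> (nat \<Rightarrow> real) \<Rightarrow> ('h \<Rightarrow> 'v::{real_inner,banach}) \<Rightarrow> 'h \<Rightarrow> 'v" where
  "A_ext e \<alpha> \<iota> u = (\<Sum>k. (- \<alpha> k * (u \<bullet> e k)) *\<^sub>R \<iota> (e k))"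

text \<open>Graph of \<open>A\<^sub>\<mu>\<close> in \<open>H \<times> H\<^sup>-\<^sup>1\<close>, with domain \<open>H\<^sup>1 \<times> H\<close>.\<close>

definition A_mu ::
    "(nat \<Rightarrow> 'h::real_inner) \<Rightarrow> (nat \<Rightarrow> real) \<Rightarrow> ('h \<Rightarrow> 'v::{real_inner,banach}) \<Rightarrow> real
      \<Rightarrow> (('h \<times> 'v) \<times> ('h \<times> 'v)) set" where
  "A_mu e \<alpha> \<iota> \<mu> =
     {((u, \<iota> v), (v, (1/\<mu>) *\<^sub>R A_ext e \<alpha> \<iota> u - (1/\<mu>) *\<^sub>R \<iota> v)) | u v. u \<in> Hspace e \<alpha> 1}"

definition B_mu :: "('h \<Rightarrow> 'v::real_vector) \<Rightarrow> ('h \<Rightarrow> 'h) \<Rightarrow> real \<Rightarrow> 'h \<times> 'v \<Rightarrow> 'h::real_vector \<times> 'v" where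
  "B_mu \<iota> B \<mu> z = (1/\<mu>) *\<^sub>R (0, \<iota> (B (fst z)))"

definition Q_mu :: "('h \<Rightarrow> 'v::real_vector) \<Rightarrow> ('h \<Rightarrow> 'h) \<Rightarrow> real \<Rightarrow> 'h \<Rightarrow> 'h::real_vector \<times> 'v" where
  "Q_mu \<iota> Q \<mu> u = (1/\<mu>) *\<^sub>R (0, \<iota> (Q u))"

section \<open>Action functionals and quasi-potentials\<close>

definition L2_control :: "real \<Rightarrow> (real \<Rightarrow> 'h::{real_inner,banach,second_countable_topology}) \<Rightarrow> bool" where
  "L2_control T \<psi> \<longleftrightarrow> set_borel_measurable lborel {0<..<T} \<psi> \<and>
     set_integrable lborel {0<..<T} (\<lambda>s. (norm (\<psi> s))\<^sup>2)"

definition L2_energy :: "real \<Rightarrow> (real \<Rightarrow> 'h::{real_inner,banach,second_countable_topology}) \<Rightarrow> real" where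
  "L2_energy T \<psi> = (LINT s:{0<..<T}|lborel. (norm (\<psi> s))\<^sup>2)"

text \<open>
  The action shared by both equations: \<open>S\<close> is the semigroup, \<open>F\<close> the nonlinearity and \<open>G\<close> the
  operator acting on the control. For a \<open>C\<^sub>0\<close>-semigroup, continuous \<open>F\<close> and \<open>z\<close>,
  bounded linear \<open>G\<close> and \<open>\<psi>\<close> in \<open>L\<^sup>2\<close> both Bochner integrals exist.
\<close>

definition action ::
    "(real \<Rightarrow> 'x \<Rightarrow> 'x) \<Rightarrow> ('x \<Rightarrow> 'x) \<Rightarrow>
      ('h::{real_inner,banach,second_countable_topology} \<Rightarrow> 'x) \<Rightarrow> real \<Rightarrow> (real \<Rightarrow> 'x::{real_inner,banach,second_countable_topology}) \<Rightarrow> ereal" where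
  "action S F G T z = ereal (1/2) *
     Inf {ereal (L2_energy T \<psi>) | \<psi>.
       L2_control T \<psi> \<and>
       (\<forall>t\<in>{0..T}. z t = S t (z 0) + (LINT s:{0..t}|lborel. S (t - s) (F (z s)))
                          + (LINT s:{0..t}|lborel. S (t - s) (G (\<psi> s))))}"

text \<open>
  In \<open>V_pair\<close> and \<open>V_mu\<close> the family \<open>S \<mu>\<close> is the semigroup generated by \<open>A\<^sub>\<mu>\<close>;
  in \<open>V\<close>, \<open>E t\<close> is \<open>e\<^sup>t\<^sup>A\<close>.
\<close>

definition V_pair where
  "V_pair S \<iota> B Q \<mu> p =
     Inf {action (S \<mu>) (B_mu \<iota> B \<mu>) (Q_mu \<iota> Q \<mu>) T z | T z.
       T > 0 \<and> continuous_on {0..T} z \<and> z 0 = 0 \<and> z T = p}"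

definition V_mu where
  "V_mu S \<iota> B Q \<mu> x = (INF y. V_pair S \<iota> B Q \<mu> (x, y))"

definition V where
  "V E B Q x =
     Inf {action E B Q T \<phi> | T \<phi>. T \<ge> 0 \<and> continuous_on {0..T} \<phi> \<and> \<phi> 0 = 0 \<and> \<phi> T = x}"

end

theory Submission
  imports Defs
begin

text \<open>
  Projected on \<open>e\<^sub>k\<close>, a path of the wave equation satisfies \<open>\<mu> u'' + u' + \<alpha>\<^sub>k u = f\<close>, where \<open>f\<close> collects
  the control and the nonlinearity. Let \<open>y\<close> solve \<open>y' + \<alpha>\<^sub>k y = f\<close>. Energy identities give, uniformly
  in \<open>k\<close> and the time horizon, \<open>\<parallel>u - y\<parallel> \<le> \<mu> \<parallel>f\<parallel>\<close> in \<open>L\<^sup>2(0,T)\<close> and \<open>\<alpha>\<^sub>k \<parallel>u\<parallel>\<^sup>2 \<le> C \<parallel>f\<parallel>\<^sup>2\<close>. The first and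
  \<open>\<gamma> 0 < \<alpha> 0\<close> bound the path in \<open>L\<^sup>2(0,T;H)\<close> by the control; the second raises this step by step to a
  bound in \<open>L\<^sup>2(0,T;H\<^sup>1\<^sup>+\<^sup>2\<^sup>\<beta>)\<close> and a bound on the endpoint in \<open>H\<^sup>1\<^sup>+\<^sup>2\<^sup>\<beta>\<close>. Hence endpoints in \<open>N\<close> of wave
  paths of bounded action have a limit point \<open>x \<in> N\<close> as \<open>\<mu> \<rightarrow> 0\<close>.

  To reach \<open>x\<close> exactly with the heat equation, follow \<open>y\<close> in the modes \<open>k < K\<close>, drop the other modes, and
  add \<open>(t/T) e\<^sup>(\<^sup>T\<^sup>-\<^sup>t\<^sup>)\<^sup>A d\<close>, where \<open>d\<close> is the remaining gap at the endpoint. The control this requires differs in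
  energy from the given one by a term that tends to \<open>0\<close> when first \<open>\<mu> \<rightarrow> 0\<close> and then \<open>K \<rightarrow> \<infinity>\<close>. No
  weak compactness of the controls and no bound on the time horizon is needed.
\<close>

text \<open>The endpoint gap explains the truncation at \<open>K\<close>. Recovering a control means
  dividing by \<open>lam k\<close>, so shifting the endpoint by \<open>d\<close> costs the squared
  norm of \<open>d\<close> in H^(1+2\<beta>), which is just the regularity that endpoints have. But
  endpoints converge only in H, and at time T the squared distance of \<open>u\<close> to
  \<open>y\<close> in mode k is bounded by (\<alpha> k * \<mu>^2 + \<mu>) times the squared norm of
  the forcing, which is not uniform in k. On the modes k < K both errors vanish in the strong norm
  as \<mu> tends to 0; beyond K the gap is the tail of \<open>x\<close> itself, small for large K.
  Their factors grow with K, so \<mu> has to go to 0 first.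

  Since \<open>y\<close> is driven by the nonlinearity along the wave path, the new path also needs
  a control for the change of \<open>B\<close>. The change is measured in H^(2\<beta>) through the
  Lipschitz bound; in the dropped modes the extra regularity of the wave path yields a negative
  power of \<alpha> K.

  No formula for the wave semigroup enters. Testing mild solutions with coefficient functionals
  turns the equation into scalar integral equations that start from rest, and these carry all
  estimates.\<close>

section \<open>Strongly continuous semigroups\<close>

text \<open>A gliding hump argument, in place of the uniform boundedness principle.\<close>

lemma unbounded_orbit:
  fixes T :: "nat \<Rightarrow> 'a::banach \<Rightarrow> 'b::real_normed_vector"
  assumes bl: "\<And>n. bounded_linear (T n)" and big: "\<And>n. onorm (T n) > 4 ^ n"
  shows "\<exists>x. \<not> Bseq (\<lambda>n. T n x)"
proof -
  have step: "\<exists>x'. dist x' x \<le> (1/3)^n \<and> (2/3) * (1/3)^n * onorm (T n) \<le> norm (T n x')" for n x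
  proof -
    interpret bounded_linear "T n" by (rule bl)
    have "\<exists>y. (2/3) * onorm (T n) * norm y < norm (T n y)"
    proof (rule ccontr)
      assume "\<nexists>y. (2/3) * onorm (T n) * norm y < norm (T n y)"
      then have "onorm (T n) \<le> (2/3) * onorm (T n)"
        by (intro onorm_bound) (use big[of n] in \<open>auto simp: not_less intro: onorm_pos_le[OF bl]\<close>)
      with big[of n] zero_less_power[of "4::real" n] show False by linarith
    qed
    then obtain y where y: "(2/3) * onorm (T n) * norm y < norm (T n y)" by auto
    then have "y \<noteq> 0" by (auto simp: zero)
    define h where "h = ((1/3)^n / norm y) *\<^sub>R y"
    have nh: "norm h = (1/3)^n" using \<open>y \<noteq> 0\<close> by (simp add: h_def)
    have "norm (T n h) = (1/3)^n / norm y * norm (T n y)" by (simp add: h_def scaleR)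
    also have "\<dots> \<ge> (1/3)^n / norm y * ((2/3) * onorm (T n) * norm y)"
      by (intro mult_left_mono less_imp_le[OF y]) auto
    finally have Th: "norm (T n h) \<ge> (2/3) * (1/3)^n * onorm (T n)"
      using \<open>y \<noteq> 0\<close> by (simp add: field_simps)
    \<comment> \<open>The images of \<open>x + h\<close> and \<open>x - h\<close> differ by
      \<open>2 *\<^sub>R T n h\<close>, so one of them is at least as long as \<open>T n h\<close>,
      whatever \<open>x\<close> is.\<close>
    have "2 *\<^sub>R T n h = T n (x + h) - T n (x - h)"
      by (simp add: add diff scaleR_2)
    then have "2 * norm (T n h) \<le> norm (T n (x + h)) + norm (T n (x - h))"
      by (metis abs_numeral norm_scaleR norm_triangle_ineq4)
    then have "norm (T n h) \<le> norm (T n (x + h)) \<or> norm (T n h) \<le> norm (T n (x - h))"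
      by linarith
    then show ?thesis
    proof
      assume "norm (T n h) \<le> norm (T n (x + h))"
      then show ?thesis using Th nh by (intro exI[of _ "x + h"]) (auto simp: dist_norm)
    next
      assume "norm (T n h) \<le> norm (T n (x - h))"
      then show ?thesis using Th nh by (intro exI[of _ "x - h"]) (auto simp: dist_norm)
    qed
  qed
  define X where "X = rec_nat 0 (\<lambda>n x. SOME x'. dist x' x \<le> (1/3)^n \<and> (2/3) * (1/3)^n * onorm (T n) \<le> norm (T n x'))"
  have X: "dist (X (Suc n)) (X n) \<le> (1/3)^n" "(2/3) * (1/3)^n * onorm (T n) \<le> norm (T n (X (Suc n)))" for n
    using someI_ex[OF step[of "X n" n]] by (auto simp: X_def)
  have sm: "summable (\<lambda>n. norm (X (Suc n) - X n))"
    by (rule summable_comparison_test'[of "\<lambda>n. (1/3)^n" 0]) (use X in \<open>auto simp: dist_norm intro: summable_geometric\<close>)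
  define x where "x = (\<Sum>n. X (Suc n) - X n)"
  have tele: "(\<Sum>i<n. X (Suc i) - X i) = X n" for n
    by (simp add: sum_lessThan_telescope) (simp add: X_def)
  have sm': "summable (\<lambda>n. X (Suc n) - X n)" using sm by (rule summable_norm_cancel)
  \<comment> \<open>All later moves together shift the limit by at most half of the n-th move. Hence
    \<open>T n\<close> loses at most 1/2 of the gained 2/3, and 1/6 survives; against
    \<open>4^n\<close> this still grows like \<open>(4/3)^n\<close>.\<close>
  have close: "norm (x - X (Suc n)) \<le> (1/2) * (1/3)^n" for n
  proof -
    have smn: "summable (\<lambda>i. norm (X (Suc (i + Suc n)) - X (i + Suc n)))"
      using summable_ignore_initial_segment[OF sm, of "Suc n"] by simp
    have "x - X (Suc n) = (\<Sum>i. X (Suc (i + Suc n)) - X (i + Suc n))"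
      using suminf_minus_initial_segment[OF sm', of "Suc n"] by (simp add: x_def tele)
    also have "norm \<dots> \<le> (\<Sum>i. norm (X (Suc (i + Suc n)) - X (i + Suc n)))"
      by (rule summable_norm[OF smn])
    also have "\<dots> \<le> (\<Sum>i. (1/3)^(Suc n) * (1/3::real)^i)"
      using X(1) by (intro suminf_le smn summable_mult summable_geometric) (auto simp: dist_norm power_add[symmetric] algebra_simps simp flip: power_Suc)
    also have "\<dots> = (1/3)^(Suc n) * (1 / (1 - 1/3))"
      by (subst suminf_mult) (auto simp: summable_geometric suminf_geometric)
    finally show ?thesis by (simp add: field_simps)
  qed
  show ?thesis
  proof (intro exI notI)
    assume "Bseq (\<lambda>n. T n x)"
    then obtain K where K: "\<And>n. norm (T n x) \<le> K" by (auto simp: Bseq_def)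
    have bound: "(1/6) * (4/3)^n \<le> K" for n
    proof -
      interpret bounded_linear "T n" by (rule bl)
      have "norm (T n (X (Suc n))) \<le> norm (T n x) + norm (T n (x - X (Suc n)))"
        by (metis diff norm_minus_commute norm_triangle_sub)
      also have "norm (T n (x - X (Suc n))) \<le> onorm (T n) * ((1/2) * (1/3)^n)"
        by (rule order_trans[OF onorm[OF bl]]) (intro mult_left_mono close onorm_pos_le[OF bl])
      finally have "(1/6) * (1/3)^n * onorm (T n) \<le> norm (T n x)"
        using X(2)[of n] by (simp add: field_simps)
      then have *: "(1/6) * (1/3)^n * onorm (T n) \<le> K" using K[of n] by linarith
      have "(1/6) * (4/3)^n = (1/6) * (1/3)^n * (4::real)^n" by (simp add: power_divide)
      also have "\<dots> \<le> (1/6) * (1/3)^n * onorm (T n)"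
        by (intro mult_left_mono less_imp_le[OF big]) auto
      finally show ?thesis using * by linarith
    qed
    obtain n where "6 * K < (4/3)^n"
      using real_arch_pow[of "4/3" "6 * K"] by auto
    with bound[of n] show False by linarith
  qed
qed

locale C0_sg =
  fixes S :: "real \<Rightarrow> 'x::{banach,second_countable_topology} \<Rightarrow> 'x"
  assumes C0: "C0_semigroup S"
begin

lemma bl: "t \<ge> 0 \<Longrightarrow> bounded_linear (S t)"
  using C0 by (simp add: C0_semigroup_def)

lemma S_0 [simp]: "S 0 x = x"
  using C0 by (simp add: C0_semigroup_def)

lemma S_add: "s \<ge> 0 \<Longrightarrow> t \<ge> 0 \<Longrightarrow> S (s + t) x = S s (S t x)"
  using C0 by (simp add: C0_semigroup_def)

lemma S_zero [simp]: "t \<ge> 0 \<Longrightarrow> S t 0 = 0"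
  by (rule linear_0) (use bl in \<open>auto simp: bounded_linear.linear\<close>)

lemma S_scaleR: "t \<ge> 0 \<Longrightarrow> S t (a *\<^sub>R x) = a *\<^sub>R S t x"
  using bl by (simp add: linear_simps)

lemma S_plus: "t \<ge> 0 \<Longrightarrow> S t (x + y) = S t x + S t y"
  using bl by (simp add: linear_simps)

lemma S_diff: "t \<ge> 0 \<Longrightarrow> S t (x - y) = S t x - S t y"
  using bl by (simp add: linear_simps)

lemma tendsto_0: "((\<lambda>t. S t x) \<longlongrightarrow> x) (at_right 0)"
  using C0 by (simp add: C0_semigroup_def)

text \<open>Otherwise there are times \<open>t n\<close> tending to 0 with operator norm above
  \<open>4^n\<close>, and the gliding hump yields an \<open>x\<close> with \<open>S (t n) x\<close>
  unbounded, although strong continuity makes this sequence converge to \<open>x\<close>.\<close>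

lemma bounded_near_0: "\<exists>d>0. \<exists>M. \<forall>t\<in>{0..d}. onorm (S t) \<le> M"
proof (rule ccontr)
  assume neg: "\<not> ?thesis"
  have "\<exists>t\<in>{0..inverse (Suc n)}. onorm (S t) > 4 ^ n" for n
  proof (rule ccontr)
    assume "\<not> (\<exists>t\<in>{0..inverse (real (Suc n))}. onorm (S t) > 4 ^ n)"
    then have "\<forall>t\<in>{0..inverse (real (Suc n))}. onorm (S t) \<le> 4 ^ n" by (simp add: not_less)
    moreover have "inverse (real (Suc n)) > 0" by simp
    ultimately show False using neg by blast
  qed
  then obtain t where t: "\<And>n. t n \<in> {0..inverse (Suc n)}" "\<And>n. onorm (S (t n)) > 4 ^ n" by metis
  have "t \<longlonglongrightarrow> 0"
    by (rule tendsto_sandwich[OF _ _ tendsto_const LIMSEQ_inverse_real_of_nat]) (use t in auto)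
  have "\<exists>x. \<not> Bseq (\<lambda>n. S (t n) x)"
    by (rule unbounded_orbit) (use t bl in auto)
  then obtain x where x: "\<not> Bseq (\<lambda>n. S (t n) x)" by auto
  have "((\<lambda>s. S s x) \<longlongrightarrow> S 0 x) (at 0 within {0..})"
    using tendsto_0[of x] by (auto simp: at_within_Ici_at_right)
  then have "continuous (at 0 within {0..}) (\<lambda>s. S s x)" by (simp add: continuous_within)
  then have "((\<lambda>n. S (t n) x) \<longlonglongrightarrow> S 0 x)"
    by (rule continuous_within_tendsto_compose'[OF _ _ \<open>t \<longlonglongrightarrow> 0\<close>]) (use t in auto)
  then have "Bseq (\<lambda>n. S (t n) x)" by (rule convergent_imp_Bseq[OF convergentI])
  with x show False by simp
qed

text \<open>The bound on \<open>[0, d]\<close> is iterated: n steps of length \<open>d\<close> cover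
  \<open>[0, T]\<close> at the price of \<open>M ^ n\<close>.\<close>

lemma bounded_on: obtains M where "M \<ge> 1" "\<And>t x. 0 \<le> t \<Longrightarrow> t \<le> T \<Longrightarrow> norm (S t x) \<le> M * norm x"
proof -
  obtain d M0 where d: "d > 0" "\<And>t. t \<in> {0..d} \<Longrightarrow> onorm (S t) \<le> M0" using bounded_near_0 by metis
  define M where "M = max 1 M0"
  have M: "norm (S t x) \<le> M * norm x" if "t \<in> {0..d}" for t x
  proof -
    have "norm (S t x) \<le> onorm (S t) * norm x" using onorm[OF bl] that by auto
    also have "\<dots> \<le> M * norm x" using d(2)[OF that] by (intro mult_right_mono) (auto simp: M_def)
    finally show ?thesis .
  qed
  have *: "\<forall>t x. 0 \<le> t \<longrightarrow> t \<le> real n * d \<longrightarrow> norm (S t x) \<le> M ^ n * norm x" for n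
  proof (induction n)
    case (Suc n)
    show ?case
    proof (intro allI impI)
      fix t x assume t: "0 \<le> t" "t \<le> real (Suc n) * d"
      show "norm (S t x) \<le> M ^ Suc n * norm x"
      proof (cases "t \<le> d")
        case True
        have "M ^ 1 \<le> M ^ Suc n" by (rule power_increasing) (auto simp: M_def)
        then show ?thesis using M[of t x] True t
          by (smt (verit) atLeastAtMost_iff mult_right_mono norm_ge_zero power_one_right)
      next
        case False
        then have "S t x = S d (S (t - d) x)" using S_add[of d "t - d" x] d by simp
        then have "norm (S t x) \<le> M * norm (S (t - d) x)" using M[of d] d by simp
        also have "\<dots> \<le> M * (M ^ n * norm x)"
          by (intro mult_left_mono Suc.IH[rule_format]) (use False t d in \<open>auto simp: M_def algebra_simps\<close>)
        finally show ?thesis by simp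
      qed
    qed
  qed auto
  obtain n where n: "T \<le> real n * d" using d(1) ex_less_of_nat_mult less_imp_le by metis
  show ?thesis
    by (rule that[of "M ^ n"]) (use * n in \<open>auto simp: M_def one_le_power\<close>)
qed

text \<open>Continuity from the left and from the right come from one factorization,
  \<open>S b x - S a x = S a (S (b - a) x - x)\<close> for \<open>a \<le> b\<close>, with
  \<open>S a\<close> uniformly bounded up to time \<open>t + 1\<close>.\<close>

lemma continuous_orbit: "continuous_on {0..} (\<lambda>t. S t x)"
proof -
  have r: "\<exists>d>0. \<forall>h. 0 \<le> h \<longrightarrow> h < d \<longrightarrow> norm (S h x - x) < \<epsilon>" if "\<epsilon> > 0" for \<epsilon> x
  proof -
    from tendstoD[OF tendsto_0[of x] that]
    obtain d where "d > 0" "\<And>h. 0 < h \<Longrightarrow> h < d \<Longrightarrow> dist (S h x) x < \<epsilon>"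
      by (auto simp: eventually_at_right_field)
    then show ?thesis using that by (intro exI[of _ d]) (auto simp: dist_norm le_less)
  qed
  show ?thesis
    unfolding continuous_on_iff
  proof (intro ballI allI impI)
    fix t \<epsilon> :: real assume t: "t \<in> {0..}" and \<epsilon>: "\<epsilon> > 0"
    obtain M where M: "M \<ge> 1" "\<And>s x. 0 \<le> s \<Longrightarrow> s \<le> t + 1 \<Longrightarrow> norm (S s x) \<le> M * norm x"
      using bounded_on by blast
    obtain d where d: "d > 0" "\<And>h. 0 \<le> h \<Longrightarrow> h < d \<Longrightarrow> norm (S h x - x) < \<epsilon> / M"
      using r[of "\<epsilon> / M" x] M(1) \<epsilon> by auto
    have *: "norm (S b x - S a x) < \<epsilon>" if "0 \<le> a" "a \<le> b" "b - a < d" "b \<le> t + 1" for a b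
    proof -
      have "S b x - S a x = S a (S (b - a) x - x)" using that S_add[of a "b - a" x] by (simp add: S_diff)
      then have "norm (S b x - S a x) \<le> M * norm (S (b - a) x - x)" using M(2) that by simp
      also have "\<dots> < M * (\<epsilon> / M)" by (intro mult_strict_left_mono d) (use that M in auto)
      finally show ?thesis using M(1) by simp
    qed
    show "\<exists>d>0. \<forall>x'\<in>{0..}. dist x' t < d \<longrightarrow> dist (S x' x) (S t x) < \<epsilon>"
    proof (intro exI[of _ "min d 1"] conjI ballI impI)
      fix s assume s: "s \<in> {0..}" "dist s t < min d 1"
      show "dist (S s x) (S t x) < \<epsilon>"
        using *[of s t] *[of t s] s t by (cases "s \<le> t") (auto simp: dist_norm norm_minus_commute dist_real_def)
    qed (use d in auto)
  qed
qed

text \<open>Strong continuity together with local uniform boundedness. The joint form is what makes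
  integrands such as \<open>S (t - s) (F s)\<close> measurable and what gives the left derivative of
  orbits.\<close>

lemma continuous_joint: "continuous_on ({0..} \<times> UNIV) (\<lambda>(t, x). S t x)"
  unfolding continuous_on_def
proof (safe)
  fix t :: real and x :: 'x assume t: "0 \<le> t"
  obtain M where M: "M \<ge> 1" "\<And>s x. 0 \<le> s \<Longrightarrow> s \<le> t + 1 \<Longrightarrow> norm (S s x) \<le> M * norm x"
    using bounded_on by blast
  let ?F = "at (t, x) within {0..} \<times> UNIV"
  have fst: "(fst \<longlongrightarrow> t) ?F" and snd: "(snd \<longlongrightarrow> x) ?F"
    using tendsto_fst[OF tendsto_ident_at, of "(t,x)"] tendsto_snd[OF tendsto_ident_at, of "(t,x)"] by auto
  have dom: "eventually (\<lambda>p. fst p \<in> {0..}) ?F"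
    by (auto simp: eventually_at_filter intro!: always_eventually)
  have 1: "((\<lambda>p. S (fst p) x) \<longlongrightarrow> S t x) ?F"
    by (rule continuous_on_tendsto_compose[OF continuous_orbit fst]) (use t dom in auto)
  have "eventually (\<lambda>p. fst p < t + 1) ?F"
    using order_tendstoD(2)[OF fst, of "t + 1"] by simp
  with dom have "eventually (\<lambda>p. norm (S (fst p) (snd p) - S (fst p) x) \<le> norm (M * norm (snd p - x))) ?F"
  proof eventually_elim
    case (elim p)
    then show ?case using M(2)[of "fst p" "snd p - x"] M(1) by (simp add: S_diff[symmetric] abs_mult)
  qed
  moreover have "((\<lambda>p. M * norm (snd p - x)) \<longlongrightarrow> 0) ?F"
    by (auto intro!: tendsto_eq_intros snd)
  ultimately have 2: "((\<lambda>p. S (fst p) (snd p) - S (fst p) x) \<longlongrightarrow> 0) ?F"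
    by (intro Lim_null_comparison[OF _ \<open>((\<lambda>p. M * norm (snd p - x)) \<longlongrightarrow> 0) ?F\<close>]) (use M(1) in \<open>simp add: abs_mult\<close>)
  have "((\<lambda>p. (S (fst p) (snd p) - S (fst p) x) + S (fst p) x) \<longlongrightarrow> 0 + S t x) ?F"
    by (intro tendsto_add 1 2)
  then show "((\<lambda>(t, x). S t x) \<longlongrightarrow> S t x) ?F"
    by (simp only: split_def diff_add_cancel add_0)
qed

text \<open>Nothing is known about \<open>S\<close> at negative times, so the map is cut off there
  before measurability on the whole line is claimed.\<close>

lemma measurable_S [measurable]:
  assumes [measurable]: "g \<in> borel_measurable M" "f \<in> borel_measurable M"
  shows "(\<lambda>s. indicator {0..} (g s) *\<^sub>R S (g s) (f s)) \<in> borel_measurable M"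
proof -
  have "(\<lambda>p. indicator ({0..} \<times> UNIV) p *\<^sub>R (case p of (t, x) \<Rightarrow> S t x)) \<in> borel_measurable borel"
    by (rule borel_measurable_continuous_on_indicator[OF _ continuous_joint])
      (auto intro!: borel_closed closed_Times)
  then have m: "(\<lambda>p. indicator ({0..} \<times> UNIV) p *\<^sub>R (case p of (t, x) \<Rightarrow> S t x)) \<in> borel_measurable (borel \<Otimes>\<^sub>M borel)"
    by (simp add: borel_prod)
  have "(\<lambda>s. (g s, f s)) \<in> measurable M (borel \<Otimes>\<^sub>M borel)" by measurable
  from measurable_compose[OF this m] show ?thesis
    by (simp add: indicator_times)
qed

text \<open>The right derivative is the generator limit pushed through the bounded
  \<open>S t\<close>. On the left the operator \<open>S s\<close> moves together with the difference
  quotient, and joint continuity takes both limits at once.\<close>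

lemma has_vector_derivative_orbit:
  assumes xy: "(x, y) \<in> generator S" and t: "t \<ge> 0"
  shows "((\<lambda>t. S t x) has_vector_derivative S t y) (at t within {0..})"
proof -
  have gen: "((\<lambda>h. (S h x - x) /\<^sub>R h) \<longlongrightarrow> y) (at_right 0)" using xy by (simp add: generator_def)
  have shift: "((\<lambda>s. (S (r s) x - x) /\<^sub>R (r s)) \<longlongrightarrow> y) F"
    if "(r \<longlongrightarrow> 0) F" "eventually (\<lambda>s. r s > 0) F" for r :: "real \<Rightarrow> real" and F
    by (rule filterlim_compose[OF gen]) (use that in \<open>auto simp: filterlim_at elim: eventually_mono\<close>)
  have right: "((\<lambda>s. (S s x - S t x) /\<^sub>R (s - t)) \<longlongrightarrow> S t y) (at_right t)"
  proof -
    have "((\<lambda>s. S t ((S (s - t) x - x) /\<^sub>R (s - t))) \<longlongrightarrow> S t y) (at_right t)"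
      by (intro bounded_linear.tendsto[OF bl[OF t]] shift tendsto_eq_intros) (auto simp: eventually_at_right_less)
    moreover have "eventually (\<lambda>s. S t ((S (s - t) x - x) /\<^sub>R (s - t)) = (S s x - S t x) /\<^sub>R (s - t)) (at_right t)"
      using eventually_at_right_less[of t]
    proof eventually_elim
      case (elim s)
      then show ?case using S_add[of t "s - t" x] t by (simp add: S_scaleR S_diff)
    qed
    ultimately show ?thesis by (rule Lim_transform_eventually)
  qed
  have left: "((\<lambda>s. (S s x - S t x) /\<^sub>R (s - t)) \<longlongrightarrow> S t y) (at t within {0..<t})"
  proof (cases "t = 0")
    case False
    let ?F = "at t within {0..<t}"
    have ev: "eventually (\<lambda>s. s \<in> {0..<t}) ?F" by (simp add: eventually_at_filter)
    have 1: "((\<lambda>s. (S (t - s) x - x) /\<^sub>R (t - s)) \<longlongrightarrow> y) ?F"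
      by (rule shift) (auto intro!: tendsto_eq_intros eventually_mono[OF ev])
    have "((\<lambda>s. (\<lambda>(t, x). S t x) (s, (S (t - s) x - x) /\<^sub>R (t - s))) \<longlongrightarrow> (\<lambda>(t, x). S t x) (t, y)) ?F"
      by (rule continuous_on_tendsto_compose[OF continuous_joint])
        (use t in \<open>auto intro!: tendsto_Pair 1 tendsto_ident_at eventually_mono[OF ev]\<close>)
    then have "((\<lambda>s. S s ((S (t - s) x - x) /\<^sub>R (t - s))) \<longlongrightarrow> S t y) ?F" by simp
    moreover have "eventually (\<lambda>s. S s ((S (t - s) x - x) /\<^sub>R (t - s)) = (S s x - S t x) /\<^sub>R (s - t)) ?F"
      using ev
    proof eventually_elim
      case (elim s)
      have "S s ((S (t - s) x - x) /\<^sub>R (t - s)) = (S t x - S s x) /\<^sub>R (t - s)"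
        using elim S_add[of s "t - s" x] by (simp add: S_scaleR S_diff)
      also have "\<dots> = (S s x - S t x) /\<^sub>R (s - t)"
        by (metis (no_types, opaque_lifting) inverse_minus_eq minus_diff_eq scaleR_left.minus scaleR_right.minus minus_minus)
      finally show ?case .
    qed
    ultimately show ?thesis by (rule Lim_transform_eventually)
  qed auto
  have "((\<lambda>s. (S s x - S t x) /\<^sub>R (s - t)) \<longlongrightarrow> S t y) (at t within ({0..<t} \<union> {t<..}))"
    using left right by (simp add: Lim_within_Un)
  also have "at t within ({0..<t} \<union> {t<..}) = at t within {0..}"
    unfolding at_within_def by (rule arg_cong[where f="\<lambda>A. inf (nhds t) (principal A)"]) (use t in auto)
  finally have "((\<lambda>s. (S s x - S t x) /\<^sub>R (s - t) - S t y) \<longlongrightarrow> 0) (at t within {0..})"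
    by (rule LIM_zero)
  then have "((\<lambda>s. norm ((S s x - S t x) /\<^sub>R (s - t) - S t y)) \<longlongrightarrow> 0) (at t within {0..})"
    by (rule tendsto_norm_zero)
  moreover have "eventually (\<lambda>s. norm ((S s x - S t x) /\<^sub>R (s - t) - S t y) =
      norm (S s x - S t x - (s - t) *\<^sub>R S t y) / norm (s - t)) (at t within {0..})"
    unfolding eventually_at_filter
  proof (intro always_eventually allI impI)
    fix s assume "s \<noteq> t"
    then have "(S s x - S t x) /\<^sub>R (s - t) - S t y = (S s x - S t x - (s - t) *\<^sub>R S t y) /\<^sub>R (s - t)"
      by (simp add: scaleR_diff_right)
    then show "norm ((S s x - S t x) /\<^sub>R (s - t) - S t y) =
      norm (S s x - S t x - (s - t) *\<^sub>R S t y) / norm (s - t)"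
      by (simp add: divide_inverse mult.commute)
  qed
  ultimately have "((\<lambda>s. norm (S s x - S t x - (s - t) *\<^sub>R S t y) / norm (s - t)) \<longlongrightarrow> 0) (at t within {0..})"
    by (rule Lim_transform_eventually)
  then show ?thesis
    by (simp add: has_vector_derivative_def has_derivative_iff_norm bounded_linear_scaleR_left)
qed

text \<open>The relation \<open>rel\<close> says that \<eta> is the generator's adjoint applied to
  \<zeta>. Orbits that start in the domain stay in it (\<open>inv\<close>), so the fundamental
  theorem of calculus applies to \<zeta> along the orbit, with derivative \<eta>.\<close>

lemma weak_orbit:
  fixes \<zeta> \<eta> :: "'x \<Rightarrow> real"
  assumes \<zeta>: "bounded_linear \<zeta>" and \<eta>: "bounded_linear \<eta>"
    and rel: "\<And>a b. (a, b) \<in> generator S \<Longrightarrow> \<zeta> b = \<eta> a"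
    and x: "(x, y) \<in> generator S" and t: "t \<ge> 0"
  shows "\<zeta> (S t x) = \<zeta> x + (LINT s:{0..t}|lborel. \<eta> (S s x))"
proof -
  have inv: "(S s x, S s y) \<in> generator S" if s: "s \<ge> 0" for s
  proof -
    have "((\<lambda>h. S s ((S h x - x) /\<^sub>R h)) \<longlongrightarrow> S s y) (at_right 0)"
      using x by (intro bounded_linear.tendsto[OF bl[OF s]]) (simp add: generator_def)
    moreover have "eventually (\<lambda>h. S s ((S h x - x) /\<^sub>R h) = (S h (S s x) - S s x) /\<^sub>R h) (at_right 0)"
      using eventually_at_right_less[of 0]
    proof eventually_elim
      case (elim h)
      then show ?case using s S_add[of s h x] S_add[of h s x] by (simp add: S_scaleR S_diff add.commute)
    qed
    ultimately show ?thesis unfolding generator_def by (auto intro: Lim_transform_eventually)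
  qed
  have "(LINT s|lborel. indicator {0..t} s *\<^sub>R \<eta> (S s x)) = \<zeta> (S t x) - \<zeta> (S 0 x)"
  proof (rule integral_FTC_atLeastAtMost[OF t])
    fix s assume s: "0 \<le> s" "s \<le> t"
    have "((\<lambda>s. S s x) has_vector_derivative S s y) (at s within {0..t})"
      by (rule has_vector_derivative_within_subset[OF has_vector_derivative_orbit[OF x s(1)]]) auto
    from bounded_linear.has_vector_derivative[OF \<zeta> this]
    show "((\<lambda>s. \<zeta> (S s x)) has_vector_derivative \<eta> (S s x)) (at s within {0..t})"
      using rel[OF inv[OF s(1)]] by simp
  next
    show "continuous_on {0..t} (\<lambda>s. \<eta> (S s x))"
      by (intro bounded_linear.continuous_on[OF \<eta>] continuous_on_subset[OF continuous_orbit]) auto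
  qed
  then show ?thesis by (simp add: set_lebesgue_integral_def)
qed

end

section \<open>Duhamel integrals tested with functionals\<close>

lemma integrable_lborel_times:
  fixes f g :: "real \<Rightarrow> real"
  assumes f: "integrable lborel f" and g: "integrable lborel g"
  shows "integrable (lborel \<Otimes>\<^sub>M lborel) (\<lambda>(s, r). f s * g r)"
proof (rule lborel_pair.Fubini_integrable)
  have [measurable]: "f \<in> borel_measurable borel" "g \<in> borel_measurable borel" using f g by auto
  show "(\<lambda>(s, r). f s * g r) \<in> borel_measurable (lborel \<Otimes>\<^sub>M lborel)" by measurable
  have "integrable lborel (\<lambda>s. \<bar>f s\<bar> * (\<integral>r. \<bar>g r\<bar> \<partial>lborel))" using f by auto
  then show "integrable lborel (\<lambda>s. \<integral>r. norm (case (s, r) of (s, r) \<Rightarrow> f s * g r) \<partial>lborel)"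
    by (simp add: abs_mult)
qed (use g in auto)

context C0_sg
begin

lemma duhamel_measurable:
  assumes [measurable]: "F \<in> borel_measurable borel"
  shows "(\<lambda>s. indicator {0..t} s *\<^sub>R S (t - s) (F s)) \<in> borel_measurable borel"
proof -
  have "(\<lambda>s. indicator {0..t} s *\<^sub>R (indicator {0..} (t - s) *\<^sub>R S (t - s) (F s))) \<in> borel_measurable borel"
    by measurable
  also have "(\<lambda>s. indicator {0..t} s *\<^sub>R (indicator {0..} (t - s) *\<^sub>R S (t - s) (F s))) =
      (\<lambda>s. indicator {0..t} s *\<^sub>R S (t - s) (F s))"
    by (auto simp: indicator_def)
  finally show ?thesis .
qed

lemma duhamel_integrable:
  assumes F: "F \<in> borel_measurable borel" "set_integrable lborel {0..t} F"
  shows "set_integrable lborel {0..t} (\<lambda>s. S (t - s) (F s))"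
proof -
  obtain M where M: "M \<ge> 1" "\<And>s x. 0 \<le> s \<Longrightarrow> s \<le> t \<Longrightarrow> norm (S s x) \<le> M * norm x"
    using bounded_on by blast
  have "integrable lborel (\<lambda>s. M * norm (indicator {0..t} s *\<^sub>R F s))"
    by (intro integrable_mult_right integrable_norm F(2)[unfolded set_integrable_def])
  then show ?thesis unfolding set_integrable_def
    by (rule Bochner_Integration.integrable_bound)
      (use duhamel_measurable[OF F(1)] M in \<open>auto simp: indicator_def\<close>)
qed

text \<open>\<open>weak_orbit\<close> is applied to the orbit issued from each \<open>F s\<close>
  and integrated over the starting time \<open>s\<close>; Fubini then collects the orbits into
  \<open>Z\<close>. The condition \<open>dom\<close> suits the wave equation, whose forcing acts in
  the velocity component and lies pointwise in the domain of the generator.\<close>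

lemma weak_duhamel:
  fixes \<zeta> \<eta> :: "'x \<Rightarrow> real"
  assumes \<zeta>: "bounded_linear \<zeta>" and \<eta>: "bounded_linear \<eta>"
    and rel: "\<And>a b. (a, b) \<in> generator S \<Longrightarrow> \<zeta> b = \<eta> a"
    and F: "F \<in> borel_measurable borel" "set_integrable lborel {0..t} F"
    and dom: "\<And>s. \<exists>y. (F s, y) \<in> generator S"
  defines "Z \<equiv> \<lambda>t. LINT s:{0..t}|lborel. S (t - s) (F s)"
  shows "set_integrable lborel {0..t} (\<lambda>r. \<eta> (Z r))"
    and "\<zeta> (Z t) = (LINT s:{0..t}|lborel. \<zeta> (F s)) + (LINT r:{0..t}|lborel. \<eta> (Z r))"
proof -
  have [measurable]: "F \<in> borel_measurable borel" by (rule F)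
  have [measurable]: "\<eta> \<in> borel_measurable borel" "\<zeta> \<in> borel_measurable borel"
    by (rule borel_measurable_continuous_onI[OF linear_continuous_on[OF \<eta>]], rule borel_measurable_continuous_onI[OF linear_continuous_on[OF \<zeta>]])
  obtain M where M: "M \<ge> 1" "\<And>s x. 0 \<le> s \<Longrightarrow> s \<le> t \<Longrightarrow> norm (S s x) \<le> M * norm x"
    using bounded_on by blast
  obtain C where C: "C > 0" "\<And>x. \<bar>\<eta> x\<bar> \<le> C * norm x"
    using bounded_linear.pos_bounded[OF \<eta>] by (auto simp: mult.commute)
  have \<eta>0 [simp]: "\<eta> 0 = 0" and \<zeta>0 [simp]: "\<zeta> 0 = 0"
    using \<eta> \<zeta> by (auto intro: linear_0 bounded_linear.linear)
  \<comment> \<open>The integrand on the triangle \<open>0 \<le> s \<le> r \<le> t\<close>.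
    Integrating over \<open>r\<close> gives the orbit started at time \<open>s\<close>
    (\<open>H1\<close>), integrating over \<open>s\<close> gives \<open>\<eta> (Z r)\<close>
    (\<open>H2\<close>).\<close>
  define H where "H = (\<lambda>s r. indicator {0..t} s * (indicator {..t} r * \<eta> (indicator {0..} (r - s) *\<^sub>R S (r - s) (F s))))"
  have Hi: "integrable (lborel \<Otimes>\<^sub>M lborel) (\<lambda>(s, r). H s r)"
  proof (rule Bochner_Integration.integrable_bound)
    have "integrable lborel (\<lambda>s. C * M * norm (indicator {0..t} s *\<^sub>R F s))"
      by (intro integrable_mult_right integrable_norm F(2)[unfolded set_integrable_def])
    moreover have "integrable lborel (indicator {0..t} :: real \<Rightarrow> real)" by (intro integrable_real_indicator) (auto simp: emeasure_lborel_Icc_eq)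
    ultimately show "integrable (lborel \<Otimes>\<^sub>M lborel) (\<lambda>(s, r). (C * M * norm (indicator {0..t} s *\<^sub>R F s)) * indicator {0..t} r)"
      by (rule integrable_lborel_times)
    show "(\<lambda>(s, r). H s r) \<in> borel_measurable (lborel \<Otimes>\<^sub>M lborel)" unfolding H_def by measurable
    have *: "\<bar>\<eta> (S (r - s) x)\<bar> \<le> C * M * norm x" if "0 \<le> s" "s \<le> r" "r \<le> t" for s r x
    proof -
      have "\<bar>\<eta> (S (r - s) x)\<bar> \<le> C * norm (S (r - s) x)" by (rule C)
      also have "\<dots> \<le> C * (M * norm x)" by (intro mult_left_mono M) (use that C in auto)
      finally show ?thesis by simp
    qed
    show "AE p in lborel \<Otimes>\<^sub>M lborel. norm (case p of (s, r) \<Rightarrow> H s r) \<le>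
       norm (case p of (s, r) \<Rightarrow> C * M * norm (indicator {0..t} s *\<^sub>R F s) * indicator {0..t} r)"
      using * C M by (auto simp: H_def indicator_def split: prod.splits)
  qed
  have H1: "(\<integral>r. H s r \<partial>lborel) = (LINT \<rho>:{0..t-s}|lborel. \<eta> (S \<rho> (F s)))" if s: "s \<in> {0..t}" for s
  proof -
    have "(LINT \<rho>:{0..t-s}|lborel. \<eta> (S \<rho> (F s))) = (\<integral>r. indicator {0..t-s} (-s + 1 * r) *\<^sub>R \<eta> (S (-s + 1 * r) (F s)) \<partial>lborel)"
      unfolding set_lebesgue_integral_def by (subst lborel_integral_real_affine[where c=1 and t="-s"]) auto
    also have "\<dots> = (\<integral>r. H s r \<partial>lborel)"
      by (rule Bochner_Integration.integral_cong)
        (use s in \<open>auto simp: H_def indicator_def \<close>)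
    finally show ?thesis by simp
  qed
  have H2: "(\<integral>s. H s r \<partial>lborel) = indicator {0..t} r *\<^sub>R \<eta> (Z r)" for r
  proof (cases "r \<in> {0..t}")
    case True
    then have "set_integrable lborel {0..r} F" by (intro set_integrable_subset[OF F(2)]) auto
    from duhamel_integrable[OF F(1) this]
    have "\<eta> (Z r) = (\<integral>s. \<eta> (indicator {0..r} s *\<^sub>R S (r - s) (F s)) \<partial>lborel)"
      unfolding Z_def set_lebesgue_integral_def set_integrable_def
      by (rule integral_bounded_linear[OF \<eta>, symmetric])
    also have "\<dots> = (\<integral>s. H s r \<partial>lborel)"
      by (rule Bochner_Integration.integral_cong)
        (use True in \<open>auto simp: H_def indicator_def \<close>)
    finally show ?thesis using True by simp
  next
    case False
    then have "H s r = 0" for s by (auto simp: H_def indicator_def )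
    with False show ?thesis by simp
  qed
  have "integrable lborel (\<lambda>r. \<integral>s. H s r \<partial>lborel)"
    using lborel_pair.integrable_snd[OF Hi] by simp
  then show *: "set_integrable lborel {0..t} (\<lambda>r. \<eta> (Z r))"
    by (simp add: H2 set_integrable_def)
  have Fz: "set_integrable lborel {0..t} (\<lambda>s. \<zeta> (F s))"
    using integrable_bounded_linear[OF \<zeta> F(2)[unfolded set_integrable_def]]
    by (simp add: set_integrable_def linear_simps[OF \<zeta>])
  have Heq: "indicator {0..t} s *\<^sub>R (\<integral>r. H s r \<partial>lborel) = (\<integral>r. H s r \<partial>lborel)" for s
    by (cases "s \<in> {0..t}") (auto simp: H_def)
  have "integrable lborel (\<lambda>s. \<integral>r. H s r \<partial>lborel)"
    using lborel_pair.integrable_fst[OF Hi] by simp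
  then have Fh: "integrable lborel (\<lambda>s. indicator {0..t} s *\<^sub>R (\<integral>r. H s r \<partial>lborel))"
    by (simp only: Heq)
  have "\<zeta> (Z t) = (\<integral>s. \<zeta> (indicator {0..t} s *\<^sub>R S (t - s) (F s)) \<partial>lborel)"
    using duhamel_integrable[OF F] unfolding Z_def set_lebesgue_integral_def set_integrable_def
    by (rule integral_bounded_linear[OF \<zeta>, symmetric])
  also have "\<dots> = (\<integral>s. indicator {0..t} s *\<^sub>R \<zeta> (F s) + indicator {0..t} s *\<^sub>R (\<integral>r. H s r \<partial>lborel) \<partial>lborel)"
  proof (rule Bochner_Integration.integral_cong[OF refl])
    fix s
    obtain y where y: "(F s, y) \<in> generator S" using dom by blast
    show "\<zeta> (indicator {0..t} s *\<^sub>R S (t - s) (F s)) =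
        indicator {0..t} s *\<^sub>R \<zeta> (F s) + indicator {0..t} s *\<^sub>R (\<integral>r. H s r \<partial>lborel)"
      using weak_orbit[OF \<zeta> \<eta> rel y, of "t - s"] H1[of s]
      by (auto simp: indicator_def )
  qed
  also have "\<dots> = (LINT s:{0..t}|lborel. \<zeta> (F s)) + (\<integral>s. indicator {0..t} s *\<^sub>R (\<integral>r. H s r \<partial>lborel) \<partial>lborel)"
    unfolding set_lebesgue_integral_def
    by (rule Bochner_Integration.integral_add) (use Fz Fh in \<open>auto simp: set_integrable_def\<close>)
  also have "(\<integral>s. indicator {0..t} s *\<^sub>R (\<integral>r. H s r \<partial>lborel) \<partial>lborel) = (\<integral>s. (\<integral>r. H s r \<partial>lborel) \<partial>lborel)"
    by (simp only: Heq)
  also have "\<dots> = (\<integral>r. (\<integral>s. H s r \<partial>lborel) \<partial>lborel)"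
    by (rule lborel_pair.Fubini_integral[symmetric]) (use Hi in simp)
  also have "\<dots> = (LINT r:{0..t}|lborel. \<eta> (Z r))"
    by (simp add: H2 set_lebesgue_integral_def)
  finally show "\<zeta> (Z t) = (LINT s:{0..t}|lborel. \<zeta> (F s)) + (LINT r:{0..t}|lborel. \<eta> (Z r))" .
qed

end

section \<open>Energy estimates for one mode\<close>

lemma continuous_on_primitive:
  fixes p :: "real \<Rightarrow> real"
  assumes "set_integrable lborel {0..T} p"
  shows "continuous_on {0..T} (\<lambda>t. LINT s:{0..t}|lborel. p s)"
proof -
  have "p integrable_on {0..T}" using set_borel_integral_eq_integral(1)[OF assms] .
  then have "continuous_on {0..T} (\<lambda>t. integral {0..t} p)" by (rule indefinite_integral_continuous_1)
  moreover have "integral {0..t} p = (LINT s:{0..t}|lborel. p s)" if "t \<in> {0..T}" for t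
    by (rule set_borel_integral_eq_integral(2)[symmetric], rule set_integrable_subset[OF assms]) (use that in auto)
  ultimately show ?thesis by (rule continuous_on_eq)
qed

lemma set_integrable_times_continuous:
  fixes p q :: "real \<Rightarrow> real"
  assumes p: "set_integrable lborel {0..T} p" and q: "continuous_on {0..T} q"
  shows "set_integrable lborel {0..T} (\<lambda>s. p s * q s)"
proof -
  obtain C where C: "C > 0" "\<And>s. s \<in> {0..T} \<Longrightarrow> \<bar>q s\<bar> \<le> C"
    using compact_imp_bounded[OF compact_continuous_image[OF q compact_Icc]] unfolding bounded_pos
    by auto
  have mq: "(\<lambda>s. indicator {0..T} s *\<^sub>R q s) \<in> borel_measurable borel"
    by (rule borel_measurable_continuous_on_indicator[OF _ q]) auto
  have mp: "(\<lambda>s. indicator {0..T} s *\<^sub>R p s) \<in> borel_measurable borel"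
    using p by (auto simp: set_integrable_def)
  have "integrable lborel (\<lambda>s. C * (indicator {0..T} s *\<^sub>R p s))"
    by (intro integrable_mult_right p[unfolded set_integrable_def])
  then show ?thesis unfolding set_integrable_def
  proof (rule Bochner_Integration.integrable_bound)
    have "(\<lambda>s. (indicator {0..T} s *\<^sub>R p s) * (indicator {0..T} s *\<^sub>R q s)) \<in> borel_measurable lborel"
      using borel_measurable_times[OF mp mq] by simp
    then show "(\<lambda>s. indicator {0..T} s *\<^sub>R (p s * q s)) \<in> borel_measurable lborel"
      by (rule measurable_cong[THEN iffD1, rotated]) (auto simp: indicator_def)
    show "AE s in lborel. norm (indicator {0..T} s *\<^sub>R (p s * q s)) \<le> norm (C * indicator {0..T} s *\<^sub>R p s)"
      using C by (auto simp: indicator_def abs_mult mult.commute[of "\<bar>p _\<bar>"] intro!: mult_right_mono)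
  qed
qed

text \<open>Integration by parts for primitives of merely integrable functions. The product of the
  two integrals is an integral over the square; the triangles below and above the diagonal give the
  two mixed terms.\<close>

lemma product_rule_primitives:
  fixes p q P Q :: "real \<Rightarrow> real"
  assumes T: "0 \<le> T"
    and p: "set_integrable lborel {0..T} p" and q: "set_integrable lborel {0..T} q"
    and P: "\<And>t. t \<in> {0..T} \<Longrightarrow> P t = a + (LINT s:{0..t}|lborel. p s)"
    and Q: "\<And>t. t \<in> {0..T} \<Longrightarrow> Q t = b + (LINT s:{0..t}|lborel. q s)"
  shows "P T * Q T = a * b + (LINT s:{0..T}|lborel. p s * Q s) + (LINT s:{0..T}|lborel. P s * q s)"
proof -
  define p' where "p' = (\<lambda>s. indicator {0..T} s *\<^sub>R p s)"
  define q' where "q' = (\<lambda>s. indicator {0..T} s *\<^sub>R q s)"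
  have p': "integrable lborel p'" and q': "integrable lborel q'"
    using p q by (auto simp: p'_def q'_def set_integrable_def)
  have [measurable]: "p' \<in> borel_measurable borel" "q' \<in> borel_measurable borel" using p' q' by auto
  have prim: "(LINT s:{0..t}|lborel. h s) = (\<integral>s. indicator {..t} s * (indicator {0..T} s *\<^sub>R h s) \<partial>lborel)"
    if "t \<in> {0..T}" for h :: "real \<Rightarrow> real" and t
    unfolding set_lebesgue_integral_def by (rule Bochner_Integration.integral_cong) (use that in \<open>auto simp: indicator_def\<close>)
  define A B where "A = (\<integral>s. p' s \<partial>lborel)" and "B = (\<integral>s. q' s \<partial>lborel)"
  define X where "X = (\<lambda>s r. indicator {..s} r * (p' s * q' r) :: real)"
  define Y where "Y = (\<lambda>s r. indicator {..r} s * (p' s * q' r) :: real)"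
  have pq: "integrable (lborel \<Otimes>\<^sub>M lborel) (\<lambda>(s, r). p' s * q' r)"
    by (rule integrable_lborel_times[OF p' q'])
  have Xi: "integrable (lborel \<Otimes>\<^sub>M lborel) (\<lambda>(s, r). X s r)"
    using pq by (rule Bochner_Integration.integrable_bound) (auto simp: X_def indicator_def)
  have Yi: "integrable (lborel \<Otimes>\<^sub>M lborel) (\<lambda>(s, r). Y s r)"
    using pq by (rule Bochner_Integration.integrable_bound) (auto simp: Y_def indicator_def)
  have 1: "(LINT s:{0..T}|lborel. p s * Q s) = b * A + (\<integral>s. \<integral>r. X s r \<partial>lborel \<partial>lborel)"
  proof -
    have "(LINT s:{0..T}|lborel. p s * Q s) = (\<integral>s. b * p' s + (\<integral>r. X s r \<partial>lborel) \<partial>lborel)"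
      unfolding set_lebesgue_integral_def
    proof (rule Bochner_Integration.integral_cong[OF refl])
      fix s
      have "(\<integral>r. X s r \<partial>lborel) = (\<integral>r. p' s * (indicator {..s} r * q' r) \<partial>lborel)"
        unfolding X_def by (rule Bochner_Integration.integral_cong) auto
      also have "\<dots> = p' s * (\<integral>r. indicator {..s} r * q' r \<partial>lborel)" by simp
      finally show "indicator {0..T} s *\<^sub>R (p s * Q s) = b * p' s + (\<integral>r. X s r \<partial>lborel)"
        by (cases "s \<in> {0..T}") (auto simp: Q prim p'_def q'_def algebra_simps)
    qed
    also have "\<dots> = b * A + (\<integral>s. \<integral>r. X s r \<partial>lborel \<partial>lborel)"
      using p' lborel_pair.integrable_fst[OF Xi] by (simp add: A_def)
    finally show ?thesis .
  qed
  have 2: "(LINT s:{0..T}|lborel. P s * q s) = a * B + (\<integral>r. \<integral>s. Y s r \<partial>lborel \<partial>lborel)"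
  proof -
    have "(LINT s:{0..T}|lborel. P s * q s) = (\<integral>r. a * q' r + (\<integral>s. Y s r \<partial>lborel) \<partial>lborel)"
      unfolding set_lebesgue_integral_def
    proof (rule Bochner_Integration.integral_cong[OF refl])
      fix r
      have "(\<integral>s. Y s r \<partial>lborel) = (\<integral>s. q' r * (indicator {..r} s * p' s) \<partial>lborel)"
        unfolding Y_def by (rule Bochner_Integration.integral_cong) auto
      also have "\<dots> = q' r * (\<integral>s. indicator {..r} s * p' s \<partial>lborel)" by simp
      finally show "indicator {0..T} r *\<^sub>R (P r * q r) = a * q' r + (\<integral>s. Y s r \<partial>lborel)"
        by (cases "r \<in> {0..T}") (auto simp: P prim p'_def q'_def algebra_simps)
    qed
    also have "\<dots> = a * B + (\<integral>r. \<integral>s. Y s r \<partial>lborel \<partial>lborel)"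
      using q' lborel_pair.integrable_snd[OF Yi] by (simp add: B_def)
    finally show ?thesis .
  qed
  have "(\<integral>r. \<integral>s. Y s r \<partial>lborel \<partial>lborel) = (\<integral>s. \<integral>r. Y s r \<partial>lborel \<partial>lborel)"
    by (rule lborel_pair.Fubini_integral) (use Yi in simp)
  then have "(\<integral>s. \<integral>r. X s r \<partial>lborel \<partial>lborel) + (\<integral>r. \<integral>s. Y s r \<partial>lborel \<partial>lborel)
      = (\<integral>s. (\<integral>r. X s r \<partial>lborel) + (\<integral>r. Y s r \<partial>lborel) \<partial>lborel)"
    using lborel_pair.integrable_fst[OF Xi] lborel_pair.integrable_fst[OF Yi] by simp
  also have "\<dots> = (\<integral>s. p' s * B \<partial>lborel)"
  proof (rule Bochner_Integration.integral_cong[OF refl])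
    fix s
    have qs: "integrable lborel (\<lambda>r. p' s * q' r)" using q' by simp
    have x: "integrable lborel (\<lambda>r. X s r)"
      using qs by (rule Bochner_Integration.integrable_bound) (auto simp: X_def indicator_def)
    have y: "integrable lborel (\<lambda>r. Y s r)"
      using qs by (rule Bochner_Integration.integrable_bound) (auto simp: Y_def indicator_def)
    have "(\<integral>r. X s r \<partial>lborel) + (\<integral>r. Y s r \<partial>lborel) = (\<integral>r. X s r + Y s r \<partial>lborel)"
      using x y by simp
    also have "\<dots> = (\<integral>r. p' s * q' r \<partial>lborel)"
      \<comment> \<open>The triangles overlap in the diagonal, which for fixed \<open>s\<close> is
        the single point \<open>{s}\<close>.\<close>
      by (rule integral_discrete_difference[where X="{s}"]) (auto simp: X_def Y_def indicator_def)
    finally show "(\<integral>r. X s r \<partial>lborel) + (\<integral>r. Y s r \<partial>lborel) = p' s * B" by (simp add: B_def)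
  qed
  also have "\<dots> = A * B" by (simp add: A_def)
  finally have XY: "(\<integral>s. \<integral>r. X s r \<partial>lborel \<partial>lborel) + (\<integral>r. \<integral>s. Y s r \<partial>lborel \<partial>lborel) = A * B" .
  have "P T = a + A" "Q T = b + B" using T by (auto simp: P Q A_def B_def p'_def q'_def set_lebesgue_integral_def)
  then show ?thesis unfolding 1 2 using XY by (simp add: algebra_simps)
qed

text \<open>The integral form of y' = f - a y. It follows from the product rule for the primitive of
  \<open>f s * exp (a * s)\<close> and the factor \<open>exp (- a * t)\<close>.\<close>

lemma heat_mode_primitive:
  fixes f :: "real \<Rightarrow> real" and a T :: real
  assumes f: "set_integrable lborel {0..T} f" and t: "t \<in> {0..T}"
  defines "y \<equiv> \<lambda>t. LINT s:{0..t}|lborel. exp (- a * (t - s)) * f s"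
  shows "continuous_on {0..T} y" and "y t = (LINT s:{0..t}|lborel. f s - a * y s)"
proof -
  define P where "P = (\<lambda>t. LINT s:{0..t}|lborel. f s * exp (a * s))"
  have ef: "set_integrable lborel {0..T} (\<lambda>s. f s * exp (a * s))"
    by (intro set_integrable_times_continuous f continuous_intros)
  have y: "y t = P t * exp (- a * t)" for t
  proof -
    have "y t = (LINT s:{0..t}|lborel. (f s * exp (a * s)) * exp (- a * t))"
      unfolding y_def by (rule set_lebesgue_integral_cong) (auto simp: exp_diff exp_minus field_simps right_diff_distrib)
    then show ?thesis by (simp add: P_def)
  qed
  show yc: "continuous_on {0..T} y"
    unfolding y P_def by (intro continuous_intros continuous_on_primitive ef)
  have E: "exp (- a * r) = 1 + (LINT s:{0..r}|lborel. - a * exp (- a * s))" if "r \<in> {0..t}" for r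
  proof -
    have "(\<integral>s. indicator {0..r} s *\<^sub>R (- a * exp (- a * s)) \<partial>lborel) = exp (- a * r) - exp (- a * 0)"
      using that by (intro integral_FTC_atLeastAtMost) (auto intro!: derivative_eq_intros continuous_intros simp: has_real_derivative_iff_has_vector_derivative[symmetric])
    then show ?thesis by (simp add: set_lebesgue_integral_def)
  qed
  have sub: "{0..t} \<subseteq> {0..T}" using t by auto
  have ift: "set_integrable lborel {0..t} f" by (rule set_integrable_subset[OF f]) (use sub in auto)
  have iyt: "set_integrable lborel {0..t} y"
    using borel_integrable_atLeastAtMost'[OF continuous_on_subset[OF yc sub]] .
  have "P t * exp (- a * t) = 0 * 1 + (LINT s:{0..t}|lborel. (f s * exp (a * s)) * exp (- a * s)) + (LINT s:{0..t}|lborel. P s * (- a * exp (- a * s)))"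
  proof (rule product_rule_primitives)
    show "set_integrable lborel {0..t} (\<lambda>s. f s * exp (a * s))" by (rule set_integrable_subset[OF ef]) (use sub in auto)
    show "set_integrable lborel {0..t} (\<lambda>s. - a * exp (- a * s))"
      by (intro borel_integrable_atLeastAtMost' continuous_intros)
  qed (use t E in \<open>auto simp: P_def\<close>)
  also have "(LINT s:{0..t}|lborel. (f s * exp (a * s)) * exp (- a * s)) = (LINT s:{0..t}|lborel. f s)"
    by (rule set_lebesgue_integral_cong) (auto simp: exp_minus)
  also have "(LINT s:{0..t}|lborel. P s * (- a * exp (- a * s))) = - (LINT s:{0..t}|lborel. a * y s)"
    unfolding set_lebesgue_integral_def Bochner_Integration.integral_minus[symmetric] by (rule Bochner_Integration.integral_cong) (auto simp: y)
  finally show "y t = (LINT s:{0..t}|lborel. f s - a * y s)"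
    using ift iyt by (simp add: y[of t] set_integral_diff)
qed

text \<open>Here \<open>w\<close> is u', and the hypotheses are \<mu> u'' + u' + a u = f with zero
  data. Pairing the equation with \<open>w\<close> bounds the velocity and the endpoint, pairing it
  with \<open>u\<close> bounds \<open>u\<close> in L2, and pairing the heat equation with
  \<open>y\<close> bounds \<open>y\<close>. As everything starts from rest, boundary terms occur at
  T only, and no constant depends on T.\<close>

lemma mode_estimates:
  fixes f u w y :: "real \<Rightarrow> real" and \<mu> a T :: real
  assumes T: "0 \<le> T" and \<mu>: "\<mu> > 0" and a: "a > 0"
    and f: "set_integrable lborel {0..T} f" and f2: "set_integrable lborel {0..T} (\<lambda>s. (f s)\<^sup>2)"
    and w: "set_integrable lborel {0..T} w"
    and u_eq: "\<And>t. t \<in> {0..T} \<Longrightarrow> u t = (LINT s:{0..t}|lborel. w s)"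
    and w_eq: "\<And>t. t \<in> {0..T} \<Longrightarrow> w t = (LINT s:{0..t}|lborel. (f s - w s - a * u s) / \<mu>)"
  defines "y \<equiv> \<lambda>t. LINT s:{0..t}|lborel. exp (- a * (t - s)) * f s"
  defines "N \<equiv> LINT s:{0..T}|lborel. (f s)\<^sup>2"
  shows "a * (u T)\<^sup>2 \<le> N / 2"
    and "a * (LINT s:{0..T}|lborel. (u s)\<^sup>2) \<le> (1 / a + 5 * \<mu> / 2) * N"
    and "a\<^sup>2 * (LINT s:{0..T}|lborel. (y s)\<^sup>2) \<le> N"
    and "(LINT s:{0..T}|lborel. (u s - y s)\<^sup>2) \<le> \<mu>\<^sup>2 * N"
    and "(u T - y T)\<^sup>2 \<le> (a * \<mu>\<^sup>2 + \<mu>) * N"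
proof -
  define I where "I = (\<lambda>h. LINT s:{0..T}|lborel. h s :: real)"
  let ?i = "\<lambda>h. set_integrable lborel {0..T} (h :: real \<Rightarrow> real)"
  have add: "I (\<lambda>s. g s + h s) = I g + I h" if "?i g" "?i h" for g h
    using that by (simp add: I_def set_integral_add)
  have diff: "I (\<lambda>s. g s - h s) = I g - I h" if "?i g" "?i h" for g h
    using that by (simp add: I_def set_integral_diff)
  have scale: "I (\<lambda>s. c * h s) = c * I h" "I (\<lambda>s. h s / c) = I h / c" for c h by (simp_all add: I_def)
  have cong: "I g = I h" if "\<And>s. s \<in> {0..T} \<Longrightarrow> g s = h s" for g h
    unfolding I_def by (rule set_lebesgue_integral_cong) (use that in auto)
  have pos: "0 \<le> I (\<lambda>s. h s * h s)" for h
    unfolding I_def set_lebesgue_integral_def by (rule Bochner_Integration.integral_nonneg) (auto simp: indicator_def)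
  have uc: "continuous_on {0..T} u"
    by (rule continuous_on_eq[OF continuous_on_primitive[OF w]]) (simp add: u_eq)
  have ui: "?i u" by (rule borel_integrable_atLeastAtMost'[OF uc])
  have wi': "?i (\<lambda>s. (f s - w s - a * u s) / \<mu>)"
    by (intro set_integrable_divide set_integral_diff set_integrable_mult_right f w ui)
  have wc: "continuous_on {0..T} w"
    by (rule continuous_on_eq[OF continuous_on_primitive[OF wi']]) (simp add: w_eq)
  have yc: "continuous_on {0..T} y" and yeq: "t \<in> {0..T} \<Longrightarrow> y t = (LINT s:{0..t}|lborel. f s - a * y s)" for t
    using heat_mode_primitive[OF f] T by (auto simp: y_def)
  define d where "d = (\<lambda>s. u s - y s)"
  have dc: "continuous_on {0..T} d" unfolding d_def by (intro continuous_intros uc yc)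
  note ci = borel_integrable_atLeastAtMost'
  have [simp]: "?i (\<lambda>s. f s * w s)" "?i (\<lambda>s. f s * u s)" "?i (\<lambda>s. f s * y s)"
    by (intro set_integrable_times_continuous f uc wc yc)+
  have [simp]: "?i (\<lambda>s. w s * w s)" "?i (\<lambda>s. u s * u s)" "?i (\<lambda>s. u s * w s)" "?i (\<lambda>s. y s * y s)"
    "?i (\<lambda>s. d s * d s)" "?i (\<lambda>s. d s * w s)"
    by (intro ci continuous_on_mult uc wc yc dc)+
  have [simp]: "?i (\<lambda>s. f s * f s)" using f2 by (simp add: power2_eq_square)
  have sc [simp]: "?i (\<lambda>s. c * h s)" if "?i h" for c h using that by simp
  \<comment> \<open>Cauchy-Schwarz in the form that the integral of
    \<open>(g + c * h)\<^sup>2\<close> is nonnegative; each use chooses its own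
    \<open>c\<close>.\<close>
  have young: "0 \<le> I (\<lambda>s. g s * g s) + 2 * c * I (\<lambda>s. g s * h s) + c\<^sup>2 * I (\<lambda>s. h s * h s)"
    if "?i (\<lambda>s. g s * g s)" "?i (\<lambda>s. g s * h s)" "?i (\<lambda>s. h s * h s)" for g h c
  proof -
    have "0 \<le> I (\<lambda>s. (g s + c * h s) * (g s + c * h s))" by (rule pos)
    also have "\<dots> = I (\<lambda>s. (g s * g s + (2 * c) * (g s * h s)) + c\<^sup>2 * (h s * h s))"
      by (rule cong) (simp add: power2_eq_square algebra_simps)
    also have "\<dots> = I (\<lambda>s. g s * g s) + 2 * c * I (\<lambda>s. g s * h s) + c\<^sup>2 * I (\<lambda>s. h s * h s)"
      using that by (simp add: add scale set_integral_add)
    finally show ?thesis .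
  qed
  define FF WW FW UU FU YY FY DD DW where defs:
    "FF = I (\<lambda>s. f s * f s)" "WW = I (\<lambda>s. w s * w s)" "FW = I (\<lambda>s. f s * w s)" "UU = I (\<lambda>s. u s * u s)"
    "FU = I (\<lambda>s. f s * u s)" "YY = I (\<lambda>s. y s * y s)" "FY = I (\<lambda>s. f s * y s)"
    "DD = I (\<lambda>s. d s * d s)" "DW = I (\<lambda>s. d s * w s)"
  have N: "N = FF" by (simp add: N_def defs I_def power2_eq_square)
  have prod: "P T * Q T = I (\<lambda>s. p s * Q s) + I (\<lambda>s. P s * q s)"
    if "?i p" "?i q" "\<And>t. t \<in> {0..T} \<Longrightarrow> P t = (LINT s:{0..t}|lborel. p s)"
      "\<And>t. t \<in> {0..T} \<Longrightarrow> Q t = (LINT s:{0..t}|lborel. q s)" for P Q p q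
    using product_rule_primitives[OF T that(1,2), of P 0 Q 0] that(3,4) by (simp add: I_def)
  have UW: "2 * I (\<lambda>s. u s * w s) = u T * u T"
    using prod[OF w w u_eq u_eq] by (simp add: mult.commute)
  have "w T * w T = 2 * I (\<lambda>s. w s * ((f s - w s - a * u s) / \<mu>))"
    using prod[OF wi' wi' w_eq w_eq] by (simp add: mult.commute)
  also have "I (\<lambda>s. w s * ((f s - w s - a * u s) / \<mu>)) = I (\<lambda>s. (1/\<mu>) * ((f s * w s - w s * w s) - a * (u s * w s)))"
    by (rule cong) (simp add: field_simps)
  also have "\<dots> = (1/\<mu>) * ((FW - WW) - a * I (\<lambda>s. u s * w s))"
    by (simp add: scale diff set_integral_diff defs)
  finally have e1: "\<mu> * (w T * w T) / 2 + a * (u T * u T) / 2 + WW = FW"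
    using \<mu> UW by (simp add: field_simps)
  \<comment> \<open>With c = -1 the identity \<open>e1\<close> yields \<open>WW \<le> FF\<close>.
    With c = -2 it reads \<open>FW - WW \<le> FF / 4\<close>, which bounds both boundary terms of
    \<open>e1\<close>.\<close>
  have y1: "0 \<le> FF + 2 * (-1) * FW + (-1)\<^sup>2 * WW" "0 \<le> FF + 2 * (-2) * FW + (-2)\<^sup>2 * WW"
    unfolding defs by (rule young; simp)+
  have "0 \<le> \<mu> * (w T * w T)" "0 \<le> a * (u T * u T)" using \<mu> a by auto
  with e1 y1 have WF: "WW \<le> FF" and auT: "a * (u T * u T) \<le> FF / 2" and mwT: "\<mu> * (w T * w T) \<le> FF / 2"
    by (auto simp: power2_eq_square)
  show "a * (u T)\<^sup>2 \<le> N / 2" using auT by (simp add: N power2_eq_square)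

  have "u T * w T = WW + I (\<lambda>s. u s * ((f s - w s - a * u s) / \<mu>))"
    using prod[OF w wi' u_eq w_eq] by (simp add: defs)
  also have "I (\<lambda>s. u s * ((f s - w s - a * u s) / \<mu>)) = I (\<lambda>s. (1/\<mu>) * ((f s * u s - u s * w s) - a * (u s * u s)))"
    by (rule cong) (simp add: field_simps)
  also have "\<dots> = (1/\<mu>) * ((FU - I (\<lambda>s. u s * w s)) - a * UU)"
    by (simp add: scale diff set_integral_diff defs)
  finally have e2: "a * UU = FU - u T * u T / 2 + \<mu> * WW - \<mu> * (u T * w T)"
    using \<mu> UW by (simp add: field_simps)
  \<comment> \<open>The boundary terms of \<open>e2\<close> are completed to a square, leaving only
    the kinetic energy at T, which is already bounded. Together with \<open>\<mu> * WW\<close> this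
    is 1 + 1/4, and absorbing half of \<open>a * UU\<close> doubles it to the constant 5/2.\<close>
  have "0 \<le> (u T + \<mu> * w T)\<^sup>2" by simp
  then have "- (u T * u T) / 2 - \<mu> * (u T * w T) \<le> \<mu> * (\<mu> * (w T * w T)) / 2"
    by (simp add: power2_eq_square algebra_simps)
  also have "\<dots> \<le> \<mu> * (FF / 2) / 2" using mwT \<mu> by (intro divide_right_mono mult_left_mono) auto
  finally have e3: "- (u T * u T) / 2 - \<mu> * (u T * w T) \<le> \<mu> * FF / 4" by simp
  have "0 \<le> FF + 2 * (-a) * FU + (-a)\<^sup>2 * UU" unfolding defs by (rule young; simp)
  then have "2 * FU \<le> FF / a + a * UU" using a by (simp add: field_simps power2_eq_square)
  moreover have "\<mu> * WW \<le> \<mu> * FF" using WF \<mu> by simp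
  ultimately have "a * UU \<le> FF / a + 5 * (\<mu> * FF) / 2" using e2 e3 by linarith
  then show "a * (LINT s:{0..T}|lborel. (u s)\<^sup>2) \<le> (1 / a + 5 * \<mu> / 2) * N"
    by (simp add: N defs I_def power2_eq_square algebra_simps)

  have yi': "?i (\<lambda>s. f s - a * y s)" by (intro set_integral_diff f sc ci yc)
  have "y T * y T = 2 * I (\<lambda>s. y s * (f s - a * y s))"
    using prod[OF yi' yi' yeq yeq] by (simp add: mult.commute)
  also have "I (\<lambda>s. y s * (f s - a * y s)) = I (\<lambda>s. f s * y s - a * (y s * y s))"
    by (rule cong) (simp add: algebra_simps)
  also have "\<dots> = FY - a * YY" by (simp add: diff scale defs)
  finally have y_sq: "y T * y T = 2 * (FY - a * YY)" .
  have "0 \<le> 2 * (FY - a * YY)" unfolding y_sq[symmetric] by simp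
  then have "2 * (a * YY) \<le> 2 * FY" by simp
  moreover have "0 \<le> FF + 2 * (-a) * FY + (-a)\<^sup>2 * YY" unfolding defs by (rule young; simp)
  then have "2 * FY \<le> FF / a + a * YY" using a by (simp add: field_simps power2_eq_square)
  ultimately have "a * YY \<le> FF / a" by linarith
  then show "a\<^sup>2 * (LINT s:{0..T}|lborel. (y s)\<^sup>2) \<le> N"
    using a by (simp add: N defs I_def power2_eq_square field_simps)

  \<comment> \<open>In \<open>d + \<mu> w\<close> the forcing and the derivative of \<open>w\<close> cancel: its derivative is \<open>- a d\<close>.\<close>
  define v where "v = (\<lambda>t. d t + \<mu> * w t)"
  have vi': "?i (\<lambda>s. - a * d s)" by (intro sc ci dc)
  have veq: "v t = (LINT s:{0..t}|lborel. - a * d s)" if t: "t \<in> {0..T}" for t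
  proof -
    have st: "set_integrable lborel {0..t} h" if "?i h" for h :: "real \<Rightarrow> real"
      by (rule set_integrable_subset[OF that]) (use t in auto)
    have "v t = (LINT s:{0..t}|lborel. w s) - (LINT s:{0..t}|lborel. f s - a * y s) + \<mu> * (LINT s:{0..t}|lborel. (f s - w s - a * u s) / \<mu>)"
      unfolding v_def d_def u_eq[OF t, symmetric] yeq[OF t, symmetric] w_eq[OF t, symmetric] by simp
    also have "\<mu> * (LINT s:{0..t}|lborel. (f s - w s - a * u s) / \<mu>) = (LINT s:{0..t}|lborel. f s - w s - a * u s)"
      unfolding set_integral_mult_right[symmetric] using \<mu> by (intro arg_cong[where f="set_lebesgue_integral _ _"]) auto
    also have "(LINT s:{0..t}|lborel. w s) - (LINT s:{0..t}|lborel. f s - a * y s) = (LINT s:{0..t}|lborel. w s - (f s - a * y s))"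
      by (intro set_integral_diff(2)[symmetric] st w yi')
    also have "\<dots> + (LINT s:{0..t}|lborel. f s - w s - a * u s) = (LINT s:{0..t}|lborel. (w s - (f s - a * y s)) + (f s - w s - a * u s))"
      by (intro set_integral_add(2)[symmetric] set_integral_diff st w yi' sc f ui)
    finally show ?thesis by (simp add: d_def algebra_simps)
  qed
  have "v T * v T = 2 * I (\<lambda>s. v s * (- a * d s))"
    using prod[OF vi' vi' veq veq] by (simp add: mult.commute)
  also have "I (\<lambda>s. v s * (- a * d s)) = I (\<lambda>s. - a * (d s * d s + \<mu> * (d s * w s)))"
    by (rule cong) (simp add: v_def algebra_simps)
  also have "\<dots> = - a * (DD + \<mu> * DW)" unfolding scale by (simp add: add scale defs)
  finally have e4: "v T * v T / (2 * a) + DD = - \<mu> * DW" using a by (simp add: field_simps)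
  \<comment> \<open>With c = \<mu> the identity \<open>e4\<close> gives the L2 bound for
    \<open>d\<close>; with c = \<mu>/2 it gives the bound for \<open>v T\<close>.\<close>
  have y2: "0 \<le> DD + 2 * \<mu> * DW + \<mu>\<^sup>2 * WW" "0 \<le> DD + 2 * (\<mu>/2) * DW + (\<mu>/2)\<^sup>2 * WW"
    unfolding defs by (rule young; simp)+
  have "0 \<le> v T * v T / (2 * a)" using a by simp
  with e4 y2(1) have DDW: "DD \<le> \<mu>\<^sup>2 * WW" by simp
  have MM: "\<mu>\<^sup>2 * WW \<le> \<mu>\<^sup>2 * FF" using WF by (intro mult_left_mono) auto
  show "(LINT s:{0..T}|lborel. (u s - y s)\<^sup>2) \<le> \<mu>\<^sup>2 * N"
    using DDW MM by (simp add: N defs I_def d_def power2_eq_square)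
  have "v T * v T / (2 * a) \<le> \<mu>\<^sup>2 * FF / 4" using e4 y2(2) MM by (simp add: power2_eq_square)
  then have vT: "2 * (v T * v T) \<le> a * (\<mu>\<^sup>2 * FF)" using a by (simp add: field_simps)
  \<comment> \<open>The endpoint error is \<open>d T = v T - \<mu> * w T\<close>. The first part
    contributes a * \<mu>^2, the kinetic energy in the second contributes \<mu>.\<close>
  have "0 \<le> (v T + \<mu> * w T)\<^sup>2" by simp
  then have "(v T - \<mu> * w T)\<^sup>2 \<le> 2 * (v T * v T) + 2 * \<mu> * (\<mu> * (w T * w T))"
    by (simp add: power2_eq_square algebra_simps)
  also have "\<dots> \<le> a * (\<mu>\<^sup>2 * FF) + 2 * \<mu> * (FF / 2)"
    using vT mwT \<mu> by (intro add_mono mult_left_mono) auto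
  also have "\<dots> = (a * \<mu>\<^sup>2 + \<mu>) * N" by (simp add: N algebra_simps)
  finally show "(u T - y T)\<^sup>2 \<le> (a * \<mu>\<^sup>2 + \<mu>) * N" by (simp add: v_def d_def)
qed

section \<open>Orthonormal sequences\<close>

text \<open>Instantiated twice: by the basis of H, and by the rescaled images of its elements in
  H^-1.\<close>

locale orthonormal_seq =
  fixes e :: "nat \<Rightarrow> 'h::{real_inner,banach}"
  assumes ortho: "\<And>j k. e j \<bullet> e k = (if j = k then 1 else 0)"
begin

lemma inner_sum_basis: "finite A \<Longrightarrow> (\<Sum>k\<in>A. a k *\<^sub>R e k) \<bullet> e j = (if j \<in> A then a j else 0)"
  by (simp add: inner_sum_left ortho if_distrib[of "\<lambda>x. _ * x"] cong: if_cong)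

lemma norm_sum_basis: "finite A \<Longrightarrow> (norm (\<Sum>k\<in>A. a k *\<^sub>R e k))\<^sup>2 = (\<Sum>k\<in>A. (a k)\<^sup>2)"
  unfolding power2_norm_eq_inner
  by (simp add: inner_sum_right inner_sum_basis power2_eq_square)

lemma summable_basis:
  assumes a: "summable (\<lambda>k. (a k)\<^sup>2)"
  shows "summable (\<lambda>k. a k *\<^sub>R e k)"
  unfolding summable_Cauchy
proof (intro allI impI)
  fix \<epsilon> :: real assume \<epsilon>: "\<epsilon> > 0"
  then obtain N where N: "\<And>m n. m \<ge> N \<Longrightarrow> norm (\<Sum>k=m..<n. (a k)\<^sup>2) < \<epsilon>\<^sup>2"
    using a unfolding summable_Cauchy by (meson zero_less_power)
  have "norm (\<Sum>k=m..<n. a k *\<^sub>R e k) < \<epsilon>" if "m \<ge> N" for m n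
  proof (rule power2_less_imp_less)
    show "(norm (\<Sum>k=m..<n. a k *\<^sub>R e k))\<^sup>2 < \<epsilon>\<^sup>2"
      using N[OF that, of n] by (simp add: norm_sum_basis)
  qed (use \<epsilon> in auto)
  then show "\<exists>N. \<forall>m\<ge>N. \<forall>n. norm (\<Sum>k=m..<n. a k *\<^sub>R e k) < \<epsilon>" by auto
qed

lemma inner_suminf_basis:
  assumes a: "summable (\<lambda>k. (a k)\<^sup>2)"
  shows "(\<Sum>k. a k *\<^sub>R e k) \<bullet> e j = a j"
proof -
  have "(\<lambda>n. (\<Sum>k<n. a k *\<^sub>R e k) \<bullet> e j) \<longlonglongrightarrow> (\<Sum>k. a k *\<^sub>R e k) \<bullet> e j"
    by (intro tendsto_intros summable_LIMSEQ summable_basis a)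
  moreover have "(\<lambda>n. (\<Sum>k<n. a k *\<^sub>R e k) \<bullet> e j) \<longlonglongrightarrow> a j"
    by (rule tendsto_eventually, rule eventually_mono[OF eventually_gt_at_top[of j]])
      (simp add: inner_sum_basis)
  ultimately show ?thesis by (rule LIMSEQ_unique)
qed

end

locale complete_orthonormal_seq =
  fixes e :: "nat \<Rightarrow> 'h::{real_inner,banach}"
  assumes co: "complete_orthonormal e"

sublocale complete_orthonormal_seq \<subseteq> orthonormal_seq e
  by unfold_locales (use co in \<open>auto simp: complete_orthonormal_def\<close>)

context complete_orthonormal_seq
begin

lemma span_basis_bound:
  assumes "y \<in> span (range e)"
  shows "\<exists>n. \<forall>k\<ge>n. y \<bullet> e k = 0 \<and> y = (\<Sum>k<n. (y \<bullet> e k) *\<^sub>R e k)"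
proof -
  obtain t r where t: "finite t" "t \<subseteq> range e" "y = (\<Sum>v\<in>t. r v *\<^sub>R v)"
    using assms unfolding span_explicit by auto
  have "inj e" by (rule injI) (metis ortho zero_neq_one)
  obtain A where A: "t = e ` A" "finite A"
    using t by (metis finite_subset_image)
  have y: "y = (\<Sum>k\<in>A. r (e k) *\<^sub>R e k)"
    unfolding t(3) A(1) by (rule sum.reindex_cong[OF inj_on_subset[OF \<open>inj e\<close>]]) auto
  obtain n where n: "A \<subseteq> {..<n}"
    using finite_nat_bounded[OF A(2)] by auto
  have c: "y \<bullet> e k = (if k \<in> A then r (e k) else 0)" for k
    by (simp add: y inner_sum_basis[OF A(2), of "\<lambda>k. r (e k)"])
  have "(\<Sum>k\<in>A. r (e k) *\<^sub>R e k) = (\<Sum>k<n. (y \<bullet> e k) *\<^sub>R e k)"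
    by (rule sum.mono_neutral_cong_left) (use n c in auto)
  then have "y = (\<Sum>k<n. (y \<bullet> e k) *\<^sub>R e k)" using y by simp
  then show ?thesis using c n by (intro exI[of _ n]) auto
qed

text \<open>Best approximation: the m-th partial sum is the orthogonal projection of
  \<open>x\<close>, so it is at least as close to \<open>x\<close> as any finite combination
  \<open>y\<close> of the first m basis vectors.\<close>

lemma expansion_sums: "(\<lambda>k. (x \<bullet> e k) *\<^sub>R e k) sums x"
  unfolding sums_def
proof (rule LIMSEQ_I)
  fix \<epsilon> :: real assume "\<epsilon> > 0"
  have "x \<in> closure (span (range e))" using co by (auto simp: complete_orthonormal_def)
  then obtain y where y: "y \<in> span (range e)" "dist y x < \<epsilon>"
    using \<open>\<epsilon> > 0\<close> by (auto simp: closure_approachable)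
  obtain n where n: "\<And>k. k \<ge> n \<Longrightarrow> y \<bullet> e k = 0" "y = (\<Sum>k<n. (y \<bullet> e k) *\<^sub>R e k)"
    using span_basis_bound[OF y(1)] by blast
  have "norm ((\<Sum>k<m. (x \<bullet> e k) *\<^sub>R e k) - x) < \<epsilon>" if m: "m \<ge> n" for m
  proof -
    let ?P = "\<Sum>k<m. (x \<bullet> e k) *\<^sub>R e k"
    have ym: "y = (\<Sum>k<m. (y \<bullet> e k) *\<^sub>R e k)"
      by (subst n(2), rule sum.mono_neutral_left) (use m n(1) in auto)
    have orth: "(x - ?P) \<bullet> (\<Sum>k<m. c k *\<^sub>R e k) = 0" for c
      by (simp add: inner_sum_right inner_diff_left inner_sum_basis)
    have "?P - y = (\<Sum>k<m. (x \<bullet> e k - y \<bullet> e k) *\<^sub>R e k)"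
      by (subst ym) (simp add: sum_subtractf scaleR_diff_left)
    then have "(x - ?P) \<bullet> (?P - y) = 0" using orth by simp
    then have "(norm (x - y))\<^sup>2 = (norm (x - ?P))\<^sup>2 + (norm (?P - y))\<^sup>2"
      using norm_add_Pythagorean[of "x - ?P" "?P - y"] by (simp add: orthogonal_def)
    then have "(norm (x - ?P))\<^sup>2 \<le> (norm (x - y))\<^sup>2" by simp
    then have "norm (x - ?P) \<le> norm (x - y)" by (rule power2_le_imp_le) simp
    also have "\<dots> < \<epsilon>" using y(2) by (simp add: dist_norm norm_minus_commute)
    finally show ?thesis by (simp add: norm_minus_commute)
  qed
  then show "\<exists>no. \<forall>n\<ge>no. norm ((\<Sum>k<n. (x \<bullet> e k) *\<^sub>R e k) - x) < \<epsilon>" by auto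
qed

lemma parseval_sums: "(\<lambda>k. (x \<bullet> e k)\<^sup>2) sums (norm x)\<^sup>2"
proof -
  have "(\<lambda>n. (norm (\<Sum>k<n. (x \<bullet> e k) *\<^sub>R e k))\<^sup>2) \<longlonglongrightarrow> (norm x)\<^sup>2"
    using expansion_sums[of x] unfolding sums_def by (intro tendsto_intros)
  then show ?thesis by (simp add: norm_sum_basis sums_def)
qed

lemma summable_coeff: "summable (\<lambda>k. (x \<bullet> e k)\<^sup>2)"
  using parseval_sums by (rule sums_summable)

lemma parseval: "(\<Sum>k. (x \<bullet> e k)\<^sup>2) = (norm x)\<^sup>2"
  using parseval_sums by (rule sums_unique[symmetric])

lemma eq_coeffI: "(\<And>k. x \<bullet> e k = y \<bullet> e k) \<Longrightarrow> x = y"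
  using expansion_sums[of x] expansion_sums[of y] by (simp add: sums_unique2)

lemma coeff_le_norm: "\<bar>x \<bullet> e k\<bar> \<le> norm x"
  using Cauchy_Schwarz_ineq2[of x "e k"] ortho[of k k] by (simp add: norm_eq_sqrt_inner)

text \<open>This reads off the coefficients of a diagonal bounded operator from its values on the
  basis; it serves for \<open>Q\<close> and for \<open>E t\<close>.\<close>

lemma functional_eq_coeff:
  fixes L :: "'h \<Rightarrow> real"
  assumes "bounded_linear L" and "\<And>j. L (e j) = (if j = k then c else 0)"
  shows "L x = c * (x \<bullet> e k)"
proof -
  have "(\<lambda>j. L ((x \<bullet> e j) *\<^sub>R e j)) sums L x"
    by (rule bounded_linear.sums[OF assms(1) expansion_sums])
  moreover have "L ((x \<bullet> e j) *\<^sub>R e j) = (if j = k then c * (x \<bullet> e k) else 0)" for j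
    using assms(2) by (simp add: linear_simps[OF assms(1)])
  ultimately show ?thesis using sums_single[of k "\<lambda>_. c * (x \<bullet> e k)"] by (simp add: sums_unique2)
qed

end

section \<open>Integrals on the time interval\<close>

lemma lborel_integral_delay:
  fixes h :: "real \<Rightarrow> real"
  shows "(LINT s:{0..t}|lborel. if s < 1 then 0 else h (s - 1)) = (if t < 1 then 0 else LINT s:{0..t-1}|lborel. h s)"
proof -
  have "(if t < 1 then 0 else LINT s:{0..t-1}|lborel. h s) = (LINT s:{0..t-1}|lborel. h s)"
    by (simp add: set_lebesgue_integral_def)
  also have "\<dots> = (\<integral>s. indicator {0..t-1} (-1 + 1 * s) *\<^sub>R h (-1 + 1 * s) \<partial>lborel)"
    unfolding set_lebesgue_integral_def by (subst lborel_integral_real_affine[where c=1 and t="-1"]) auto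
  also have "\<dots> = (LINT s:{0..t}|lborel. if s < 1 then 0 else h (s - 1))"
    unfolding set_lebesgue_integral_def
    by (rule Bochner_Integration.integral_cong) (auto simp: indicator_def)
  finally show ?thesis by simp
qed

lemma set_integrable_delay:
  fixes h :: "real \<Rightarrow> real"
  assumes "set_integrable lborel {0..T} h"
  shows "set_integrable lborel {0..T+1} (\<lambda>s. if s < 1 then 0 else h (s - 1))"
proof -
  have "integrable lborel (\<lambda>s. indicator {0..T} (-1 + 1 * s) *\<^sub>R h (-1 + 1 * s))"
    using assms unfolding set_integrable_def
    by (subst lborel_integrable_real_affine_iff[where c=1 and t="-1" and f="\<lambda>s. indicator {0..T} s *\<^sub>R h s"]) auto
  also have "(\<lambda>s. indicator {0..T} (-1 + 1 * s) *\<^sub>R h (-1 + 1 * s)) = (\<lambda>s. indicator {0..T+1} s *\<^sub>R (if s < 1 then 0 else h (s - 1)))"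
    by (auto simp: indicator_def fun_eq_iff)
  finally show ?thesis by (simp add: set_integrable_def)
qed

lemma set_integrable_square_imp:
  fixes \<psi> :: "real \<Rightarrow> 'a::{banach,second_countable_topology}"
  assumes m: "\<psi> \<in> borel_measurable borel" and i: "integrable lborel (\<lambda>s. (norm (\<psi> s))\<^sup>2)"
  shows "set_integrable lborel {a..b} \<psi>"
  unfolding set_integrable_def
proof (rule Bochner_Integration.integrable_bound)
  have "integrable lborel (indicator {a..b} :: real \<Rightarrow> real)"
    by (intro integrable_real_indicator) (auto simp: emeasure_lborel_Icc_eq)
  with i show "integrable lborel (\<lambda>s. indicator {a..b} s + (norm (\<psi> s))\<^sup>2)"
    by (intro Bochner_Integration.integrable_add)
  show "(\<lambda>s. indicator {a..b} s *\<^sub>R \<psi> s) \<in> borel_measurable lborel" using m by simp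
  have "x \<le> 1 + x\<^sup>2" for x :: real
    using zero_le_power2[of "x - 1/2"] by (simp add: power2_eq_square algebra_simps)
  then show "AE s in lborel. norm (indicator {a..b} s *\<^sub>R \<psi> s) \<le> norm (indicator {a..b} s + (norm (\<psi> s))\<^sup>2)"
    by (auto simp: indicator_def)
qed

text \<open>A strict bound on the infimum produces an actual control. Near-optimal controls suffice
  throughout, so attainment of the infimum is never discussed.\<close>

lemma action_less_iff:
  "action S F G T z < ereal L \<longleftrightarrow> (\<exists>\<psi>. L2_control T \<psi> \<and> L2_energy T \<psi> < 2 * L \<and>
    (\<forall>t\<in>{0..T}. z t = S t (z 0) + (LINT s:{0..t}|lborel. S (t - s) (F (z s)))
                          + (LINT s:{0..t}|lborel. S (t - s) (G (\<psi> s)))))"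
proof -
  have half: "ereal (1/2) * I < ereal L \<longleftrightarrow> I < ereal (2 * L)" for I
    by (cases I) auto
  have bex: "(\<exists>a\<in>{g \<psi> |\<psi>. P \<psi>}. R a) \<longleftrightarrow> (\<exists>\<psi>. P \<psi> \<and> R (g \<psi>))" for g :: "(real \<Rightarrow> 'c) \<Rightarrow> ereal" and P R
    by blast
  show ?thesis unfolding action_def half Inf_less_iff bex less_ereal.simps conj_assoc
    by (rule ex_cong1) (simp only: conj_ac)
qed

text \<open>Extended nonnegative values let sums over modes and time integrals be interchanged
  without integrability conditions.\<close>

definition sq_int :: "real \<Rightarrow> (real \<Rightarrow> real) \<Rightarrow> ennreal" where
  "sq_int T h = (\<integral>\<^sup>+s\<in>{0..T}. ennreal ((h s)\<^sup>2) \<partial>lborel)"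

lemma sq_int_eq:
  assumes "set_integrable lborel {0..T} (\<lambda>s. (h s)\<^sup>2)"
  shows "sq_int T h = ennreal (LINT s:{0..T}|lborel. (h s)\<^sup>2)"
proof -
  have "sq_int T h = (\<integral>\<^sup>+s. ennreal (indicator {0..T} s *\<^sub>R (h s)\<^sup>2) \<partial>lborel)"
    unfolding sq_int_def by (rule nn_integral_cong) (auto simp: indicator_def)
  also have "\<dots> = ennreal (LINT s:{0..T}|lborel. (h s)\<^sup>2)"
    using assms unfolding set_lebesgue_integral_def set_integrable_def
    by (intro nn_integral_eq_integral) auto
  finally show ?thesis .
qed

lemma sq_int_mono: "(\<And>s. s \<in> {0..T} \<Longrightarrow> (g s)\<^sup>2 \<le> (h s)\<^sup>2) \<Longrightarrow> sq_int T g \<le> sq_int T h"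
  unfolding sq_int_def by (intro nn_integral_mono) (auto simp: indicator_def intro: ennreal_leI)

lemma sq_int_cong: "(\<And>s. s \<in> {0..T} \<Longrightarrow> g s = h s) \<Longrightarrow> sq_int T g = sq_int T h"
  unfolding sq_int_def by (intro nn_integral_cong) (auto simp: indicator_def)

text \<open>The weight \<eta> keeps the factor of the leading term close to 1. The contraction
  estimate and the final energy comparison both depend on this.\<close>

lemma sq_add_le:
  fixes a b :: real
  assumes "\<eta> > 0"
  shows "(a + b)\<^sup>2 \<le> (1 + \<eta>) * a\<^sup>2 + (1 + 1 / \<eta>) * b\<^sup>2"
proof -
  have "0 \<le> (\<eta> * a - b)\<^sup>2 / \<eta>" using assms by simp
  also have "\<dots> = \<eta> * a\<^sup>2 + b\<^sup>2 / \<eta> - 2 * (a * b)"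
    using assms by (simp add: power2_eq_square field_simps)
  finally show ?thesis by (simp add: power2_eq_square algebra_simps)
qed

lemma sq_int_add_le:
  assumes [measurable]: "g \<in> borel_measurable borel" "h \<in> borel_measurable borel"
    and \<eta>: "\<eta> > 0"
  shows "sq_int T (\<lambda>s. g s + h s) \<le> ennreal (1 + \<eta>) * sq_int T g + ennreal (1 + 1/\<eta>) * sq_int T h"
proof -
  have "sq_int T (\<lambda>s. g s + h s) \<le> (\<integral>\<^sup>+s. ennreal (1 + \<eta>) * (ennreal ((g s)\<^sup>2) * indicator {0..T} s)
       + ennreal (1 + 1/\<eta>) * (ennreal ((h s)\<^sup>2) * indicator {0..T} s) \<partial>lborel)"
    unfolding sq_int_def
    using \<eta> sq_add_le[OF \<eta>] by (intro nn_integral_mono) (auto simp: indicator_def simp flip: ennreal_mult ennreal_plus intro: ennreal_leI)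
  also have "\<dots> = ennreal (1 + \<eta>) * sq_int T g + ennreal (1 + 1/\<eta>) * sq_int T h"
    unfolding sq_int_def by (simp add: nn_integral_add nn_integral_cmult)
  finally show ?thesis .
qed

lemma ennreal_suminf_mono: "(\<And>k. f k \<le> g k) \<Longrightarrow> (\<Sum>k. f k) \<le> (\<Sum>k. g k :: ennreal)"
  by (intro suminf_le summableI)

text \<open>Composition with this projection onto \<open>[0, T]\<close> extends functions on the
  interval to continuous, hence Borel, functions on the line.\<close>

definition clamp_to :: "real \<Rightarrow> real \<Rightarrow> real" where
  "clamp_to T t = min T (max 0 t)"

lemma clamp_to_in: "0 \<le> T \<Longrightarrow> clamp_to T t \<in> {0..T}"
  by (auto simp: clamp_to_def)

lemma clamp_to_id [simp]: "t \<in> {0..T} \<Longrightarrow> clamp_to T t = t"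
  by (auto simp: clamp_to_def)

lemma continuous_on_clamp_to:
  assumes "continuous_on {0..T} g" and "0 \<le> T"
  shows "continuous_on A (\<lambda>t. g (clamp_to T t))"
  by (rule continuous_on_compose2[OF assms(1)])
    (use clamp_to_in[OF assms(2)] in \<open>auto simp: clamp_to_def intro!: continuous_intros\<close>)

lemma ennreal_mult_leI:
  fixes a b x y :: real
  shows "a * x \<le> b * y \<Longrightarrow> 0 \<le> a \<Longrightarrow> 0 \<le> b \<Longrightarrow> ennreal a * ennreal x \<le> ennreal b * ennreal y"
  by (simp add: ennreal_leI flip: ennreal_mult')

lemma sq_int_exp_le:
  assumes "a > 0" "T \<ge> 0"
  shows "sq_int T (\<lambda>s. exp (- a * (T - s))) \<le> ennreal (1 / (2 * a))"
proof -
  have "set_integrable lborel {0..T} (\<lambda>s. (exp (- a * (T - s)))\<^sup>2)"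
    by (intro borel_integrable_atLeastAtMost' continuous_intros)
  then have "sq_int T (\<lambda>s. exp (- a * (T - s))) = ennreal (LINT s:{0..T}|lborel. (exp (- a * (T - s)))\<^sup>2)"
    by (rule sq_int_eq)
  also have "(LINT s:{0..T}|lborel. (exp (- a * (T - s)))\<^sup>2) = exp (- 2 * a * (T - T)) / (2 * a) - exp (- 2 * a * (T - 0)) / (2 * a)"
    unfolding set_lebesgue_integral_def
  proof (rule integral_FTC_atLeastAtMost[OF assms(2)])
    fix s
    have "((\<lambda>s. exp (- 2 * a * (T - s)) / (2 * a)) has_real_derivative (exp (- a * (T - s)))\<^sup>2) (at s within {0..T})"
      using assms(1) by (auto intro!: derivative_eq_intros simp: power2_eq_square field_simps simp flip: exp_add)
    then show "((\<lambda>s. exp (- 2 * a * (T - s)) / (2 * a)) has_vector_derivative (exp (- a * (T - s)))\<^sup>2) (at s within {0..T})"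
      by (simp add: has_real_derivative_iff_has_vector_derivative)
  qed (intro continuous_intros)
  also have "\<dots> \<le> 1 / (2 * a)" using assms by simp
  finally show ?thesis by (simp add: ennreal_leI)
qed

lemma sq_int_scale: "sq_int T (\<lambda>s. c * h s) = ennreal (c\<^sup>2) * sq_int T h"
  if [measurable]: "h \<in> borel_measurable borel"
  unfolding sq_int_def
  by (subst nn_integral_cmult[symmetric]) (auto intro!: nn_integral_cong simp: power_mult_distrib ennreal_mult mult.assoc)

lemma ennreal_linear:
  fixes a b x y :: real
  shows "0 \<le> a \<Longrightarrow> 0 \<le> x \<Longrightarrow> 0 \<le> b \<Longrightarrow> 0 \<le> y \<Longrightarrow>
    ennreal a * ennreal x + ennreal b * ennreal y = ennreal (a * x + b * y)"
  by (simp add: ennreal_mult ennreal_plus)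

text \<open>The integrand is the derivative in \<open>s\<close> of
  \<open>s / T * exp (- a * (t - s) - a * (T - s))\<close>, which vanishes at
  \<open>s = 0\<close>.\<close>

lemma duhamel_ramp:
  fixes a t T :: real
  assumes T: "T > 0" and t: "t \<ge> 0"
  shows "(LINT s:{0..t}|lborel. exp (- a * (t - s)) * (exp (- a * (T - s)) * (2 * a * s / T + 1 / T))) = t / T * exp (- a * (T - t))"
proof -
  have "(LINT s:{0..t}|lborel. exp (- a * (t - s)) * (exp (- a * (T - s)) * (2 * a * s / T + 1 / T))) =
     t / T * exp (- a * (t - t) + - a * (T - t)) - 0 / T * exp (- a * (t - 0) + - a * (T - 0))"
    unfolding set_lebesgue_integral_def
  proof (rule integral_FTC_atLeastAtMost[OF t])
    fix s
    have "((\<lambda>s. s / T * exp (- a * (t - s) + - a * (T - s))) has_real_derivative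
        exp (- a * (t - s) + - a * (T - s)) * (2 * a * s / T + 1 / T)) (at s within {0..t})"
      using T by (auto intro!: derivative_eq_intros simp: field_simps)
    then show "((\<lambda>s. s / T * exp (- a * (t - s) + - a * (T - s))) has_vector_derivative
        exp (- a * (t - s)) * (exp (- a * (T - s)) * (2 * a * s / T + 1 / T))) (at s within {0..t})"
      by (simp only: has_real_derivative_iff_has_vector_derivative mult.assoc exp_add)
  qed (intro continuous_intros, use T in auto)
  then show ?thesis by simp
qed

lemma sq_add3_le:
  fixes a b c :: real
  shows "(a + b + c)\<^sup>2 \<le> 3 * (a\<^sup>2 + b\<^sup>2 + c\<^sup>2)"
proof -
  have "0 \<le> (a - b)\<^sup>2 + (a - c)\<^sup>2 + (b - c)\<^sup>2" by simp
  then show ?thesis by (simp add: power2_eq_square algebra_simps)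
qed

section \<open>The coefficients of the wave equation\<close>

text \<open>The spectral form of the hypotheses. The growth of the eigenvalues appears as divergence
  to infinity, and (d-2)/4 \<ge> -1/4 for d \<ge> 1 turns the dimension condition into a bound on
  \<beta> that makes the exponent 1 + 2\<beta> positive.\<close>

locale smoluchowski = complete_orthonormal_seq e
  for e :: "nat \<Rightarrow> 'h::{real_inner,banach,second_countable_topology}" +
  fixes \<alpha> lam :: "nat \<Rightarrow> real"
    and \<iota> :: "'h \<Rightarrow> 'v::{real_inner,banach,second_countable_topology}"
    and Q B :: "'h \<Rightarrow> 'h"
    and \<beta> c :: real
    and \<gamma> :: "real \<Rightarrow> real"
    and E :: "real \<Rightarrow> 'h \<Rightarrow> 'h"
  assumes \<alpha>_0: "0 < \<alpha> 0" and \<alpha>_Suc: "\<And>k. \<alpha> k \<le> \<alpha> (Suc k)"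
    and \<alpha>_lim: "filterlim \<alpha> at_top sequentially"
    and neg: "is_negative_Hspace e \<alpha> (-1) \<iota>"
    and Q: "bounded_linear Q" and Q_e: "\<And>k. Q (e k) = lam k *\<^sub>R e k"
    and c: "c > 0" and \<beta>: "\<beta> > -1/4"
    and lam_ge: "\<And>k. (1/c) * \<alpha> k powr (-\<beta>) \<le> lam k" and lam_le: "\<And>k. lam k \<le> c * \<alpha> k powr (-\<beta>)"
    and B_lip: "\<And>\<delta>. \<delta> \<in> {0..1 + 2*\<beta>} \<Longrightarrow> Hlipschitz e \<alpha> \<delta> (\<gamma> \<delta>) B"
    and \<gamma>: "\<And>\<delta>. \<delta> \<in> {0..1 + 2*\<beta>} \<Longrightarrow> \<gamma> \<delta> < \<alpha> 0"
    and B_0: "B 0 = 0"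
    and E: "C0_semigroup E" and E_gen: "\<And>k. (e k, - \<alpha> k *\<^sub>R e k) \<in> generator E"
begin

lemma \<alpha>_mono: "i \<le> j \<Longrightarrow> \<alpha> i \<le> \<alpha> j"
  using \<alpha>_Suc by (rule lift_Suc_mono_le)

lemma \<alpha>_ge: "\<alpha> 0 \<le> \<alpha> k" by (rule \<alpha>_mono) simp

lemma \<alpha>_pos [simp]: "0 < \<alpha> k" using \<alpha>_ge[of k] \<alpha>_0 by linarith

lemma \<alpha>_neq_0 [simp]: "\<alpha> k \<noteq> 0" using \<alpha>_pos[of k] by linarith

lemma lam_pos [simp]: "0 < lam k"
proof -
  have "0 < (1/c) * \<alpha> k powr (-\<beta>)" using c by simp
  then show ?thesis using lam_ge[of k] by linarith
qed

text \<open>Eigenvalues may lie below 1, so comparing powers costs a factor in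
  \<open>\<alpha> 0\<close>. This is the source of the powers of \<open>\<alpha> 0\<close> in later
  constants.\<close>

lemma powr_le:
  assumes "a \<le> b"
  shows "\<alpha> k powr a \<le> \<alpha> 0 powr (a - b) * \<alpha> k powr b"
proof -
  have "\<alpha> k powr a = \<alpha> k powr (a - b) * \<alpha> k powr b" by (simp flip: powr_add)
  also have "\<dots> \<le> \<alpha> 0 powr (a - b) * \<alpha> k powr b"
    by (intro mult_right_mono powr_mono2') (use assms \<alpha>_0 \<alpha>_ge in auto)
  finally show ?thesis .
qed

lemma Q_coeff: "Q x \<bullet> e k = lam k * (x \<bullet> e k)"
  by (rule functional_eq_coeff)
    (auto simp: Q_e ortho intro!: bounded_linear_compose[OF bounded_linear_inner_left Q])

lemma continuous_B: "continuous_on A B"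
proof -
  have "Hspace e \<alpha> 0 = UNIV" using summable_coeff by (auto simp: Hspace_def)
  moreover have "Hnorm e \<alpha> 0 x = norm x" for x using parseval by (simp add: Hnorm_def)
  moreover have "0 \<in> {0..1 + 2*\<beta>}" using \<beta> by simp
  ultimately have L: "norm (B x - B y) \<le> \<gamma> 0 * norm (x - y)" for x y
    using B_lip[of 0] by (auto simp: Hlipschitz_def)
  have L': "norm (B x - B y) \<le> \<bar>\<gamma> 0\<bar> * norm (x - y)" for x y
    by (rule order_trans[OF L]) (simp add: mult_right_mono)
  have "lipschitz_on \<bar>\<gamma> 0\<bar> A B"
    by (intro lipschitz_onI) (auto simp: dist_norm L')
  then show ?thesis by (rule lipschitz_on_continuous_on)
qed

lemma measurable_B [measurable]: "B \<in> borel_measurable borel"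
  by (rule borel_measurable_continuous_onI[OF continuous_B])

lemma measurable_Q [measurable]: "Q \<in> borel_measurable borel"
  by (rule borel_measurable_continuous_onI[OF linear_continuous_on[OF Q]])

section \<open>Coordinates in H^-1 and the projected wave equation\<close>

lemma linear_iota: "linear \<iota>" using neg by (simp add: is_negative_Hspace_def)

lemma norm_iota_sums: "(\<lambda>j. (x \<bullet> e j)\<^sup>2 / \<alpha> j) sums (norm (\<iota> x))\<^sup>2"
proof -
  have "(\<lambda>j. \<alpha> j powr (-1) * (x \<bullet> e j)\<^sup>2) = (\<lambda>j. (x \<bullet> e j)\<^sup>2 / \<alpha> j)"
    by (auto simp: powr_minus less_imp_le divide_inverse)
  moreover have sm: "summable (\<lambda>j. (x \<bullet> e j)\<^sup>2 / \<alpha> j)"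
  proof (rule summable_comparison_test'[of "\<lambda>j. (x \<bullet> e j)\<^sup>2 * (1 / \<alpha> 0)" 0])
    show "summable (\<lambda>j. (x \<bullet> e j)\<^sup>2 * (1 / \<alpha> 0))" by (intro summable_mult2 summable_coeff)
    show "norm ((x \<bullet> e j)\<^sup>2 / \<alpha> j) \<le> (x \<bullet> e j)\<^sup>2 * (1 / \<alpha> 0)" for j
      using \<alpha>_ge[of j] \<alpha>_0 by (simp add: abs_of_pos frac_le)
  qed
  moreover have "(norm (\<iota> x))\<^sup>2 = (Hnorm e \<alpha> (-1) x)\<^sup>2"
    using neg by (simp add: is_negative_Hspace_def)
  moreover have "0 \<le> (\<Sum>j. (x \<bullet> e j)\<^sup>2 / \<alpha> j)" by (intro suminf_nonneg sm) (simp add: less_imp_le)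
  ultimately show ?thesis
    by (auto simp: Hnorm_def intro: summable_sums)
qed

lemma bounded_linear_iota: "bounded_linear \<iota>"
proof -
  have "norm (\<iota> x) \<le> norm x * sqrt (1 / \<alpha> 0)" for x
  proof -
    have "(norm (\<iota> x))\<^sup>2 \<le> (norm x)\<^sup>2 * (1 / \<alpha> 0)"
    proof (rule sums_le[OF _ norm_iota_sums sums_mult2[OF parseval_sums]])
      show "(x \<bullet> e j)\<^sup>2 / \<alpha> j \<le> (x \<bullet> e j)\<^sup>2 * (1 / \<alpha> 0)" for j
        using \<alpha>_ge[of j] \<alpha>_0 by (simp add: frac_le)
    qed
    then show ?thesis using real_le_rsqrt[of "norm (\<iota> x)"] by (metis norm_ge_zero real_sqrt_abs abs_of_nonneg real_sqrt_mult)
  qed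
  then show ?thesis using linear_iota
    by (intro bounded_linear_intro[where K="sqrt (1 / \<alpha> 0)"]) (auto simp: linear_add linear_scale)
qed

text \<open>Polarization of the norm formula, since the embedding is specified through its
  norm.\<close>

lemma iota_inner: "\<iota> x \<bullet> \<iota> (e k) = (x \<bullet> e k) / \<alpha> k"
proof -
  have "(\<lambda>j. ((x + e k) \<bullet> e j)\<^sup>2 / \<alpha> j - ((x - e k) \<bullet> e j)\<^sup>2 / \<alpha> j) sums
      ((norm (\<iota> (x + e k)))\<^sup>2 - (norm (\<iota> (x - e k)))\<^sup>2)"
    by (intro sums_diff norm_iota_sums)
  moreover have "(\<lambda>j. ((x + e k) \<bullet> e j)\<^sup>2 / \<alpha> j - ((x - e k) \<bullet> e j)\<^sup>2 / \<alpha> j) =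
      (\<lambda>j. if j = k then 4 * (x \<bullet> e k) / \<alpha> k else 0)"
    by (auto simp: inner_add_left inner_diff_left ortho power2_eq_square algebra_simps fun_eq_iff add_divide_distrib diff_divide_distrib)
  ultimately have "(norm (\<iota> (x + e k)))\<^sup>2 - (norm (\<iota> (x - e k)))\<^sup>2 = 4 * (x \<bullet> e k) / \<alpha> k"
    using sums_single[of k "\<lambda>_. 4 * (x \<bullet> e k) / \<alpha> k"] by (simp add: sums_unique2)
  moreover have "(norm (\<iota> (x + e k)))\<^sup>2 - (norm (\<iota> (x - e k)))\<^sup>2 = 4 * (\<iota> x \<bullet> \<iota> (e k))"
    by (simp add: linear_add[OF linear_iota] linear_diff[OF linear_iota] power2_norm_eq_inner
        inner_add_left inner_diff_left inner_add_right inner_diff_right inner_commute)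
  ultimately show ?thesis by simp
qed

text \<open>The factor \<open>\<alpha> k\<close> undoes the weight of the H^-1 inner product. The
  functional is thus the continuous extension to H^-1 of the coefficient on H.\<close>

definition vcoeff :: "nat \<Rightarrow> 'v \<Rightarrow> real" where
  "vcoeff k v = \<alpha> k * (v \<bullet> \<iota> (e k))"

lemma vcoeff_iota [simp]: "vcoeff k (\<iota> x) = x \<bullet> e k"
  by (simp add: vcoeff_def iota_inner)

lemma bounded_linear_vcoeff: "bounded_linear (vcoeff k)"
  unfolding vcoeff_def by (intro bounded_linear_mult_const bounded_linear_inner_left bounded_linear_const_mult)

text \<open>In H^-1 the vectors \<open>sqrt (\<alpha> k) *\<^sub>R \<iota> (e k)\<close> are
  orthonormal, and membership of \<open>u\<close> in H^1 says exactly that the series of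
  \<open>A_ext\<close> has square summable coefficients with respect to them.\<close>

lemma vcoeff_A_ext:
  assumes u: "u \<in> Hspace e \<alpha> 1"
  shows "vcoeff k (A_ext e \<alpha> \<iota> u) = - \<alpha> k * (u \<bullet> e k)"
proof -
  interpret v: orthonormal_seq "\<lambda>k. sqrt (\<alpha> k) *\<^sub>R \<iota> (e k)"
    by unfold_locales (simp add: iota_inner ortho less_imp_le)
  have sm: "summable (\<lambda>j. (- sqrt (\<alpha> j) * (u \<bullet> e j))\<^sup>2)"
    using u by (simp add: Hspace_def power_mult_distrib less_imp_le)
  have "A_ext e \<alpha> \<iota> u = (\<Sum>j. (- sqrt (\<alpha> j) * (u \<bullet> e j)) *\<^sub>R (sqrt (\<alpha> j) *\<^sub>R \<iota> (e j)))"
    unfolding A_ext_def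
  proof (intro arg_cong[where f=suminf] ext)
    fix j
    have "sqrt (\<alpha> j) * sqrt (\<alpha> j) = \<alpha> j" by (simp add: less_imp_le)
    then have "(- sqrt (\<alpha> j) * (u \<bullet> e j)) * sqrt (\<alpha> j) = - \<alpha> j * (u \<bullet> e j)"
      by (simp add: algebra_simps)
    then show "(- \<alpha> j * (u \<bullet> e j)) *\<^sub>R \<iota> (e j) = (- sqrt (\<alpha> j) * (u \<bullet> e j)) *\<^sub>R sqrt (\<alpha> j) *\<^sub>R \<iota> (e j)"
      by (auto simp: less_imp_le)
  qed
  then have "sqrt (\<alpha> k) * (A_ext e \<alpha> \<iota> u \<bullet> \<iota> (e k)) = - sqrt (\<alpha> k) * (u \<bullet> e k)"
    using v.inner_suminf_basis[OF sm, of k] by simp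
  then have "sqrt (\<alpha> k) * (A_ext e \<alpha> \<iota> u \<bullet> \<iota> (e k) + u \<bullet> e k) = 0" by (simp add: algebra_simps)
  then have "A_ext e \<alpha> \<iota> u \<bullet> \<iota> (e k) = - (u \<bullet> e k)" by simp
  then show ?thesis by (simp add: vcoeff_def)
qed

lemma A_mu_coeff:
  assumes "(a, b) \<in> A_mu e \<alpha> \<iota> \<mu>"
  shows "fst b \<bullet> e k = vcoeff k (snd a)"
    and "vcoeff k (snd b) = (- vcoeff k (snd a) - \<alpha> k * (fst a \<bullet> e k)) / \<mu>"
proof -
  obtain u v where uv: "u \<in> Hspace e \<alpha> 1" "a = (u, \<iota> v)"
    "b = (v, (1/\<mu>) *\<^sub>R A_ext e \<alpha> \<iota> u - (1/\<mu>) *\<^sub>R \<iota> v)"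
    using assms by (auto simp: A_mu_def)
  show "fst b \<bullet> e k = vcoeff k (snd a)" using uv by simp
  show "vcoeff k (snd b) = (- vcoeff k (snd a) - \<alpha> k * (fst a \<bullet> e k)) / \<mu>"
    using uv by (simp add: linear_simps[OF bounded_linear_vcoeff] vcoeff_A_ext diff_divide_distrib)
qed

text \<open>\<open>weak_duhamel\<close> is used once with the position coefficient and once with the
  velocity coefficient; \<open>A_mu_coeff\<close> supplies the two adjoint relations. The outcome is
  the second order mode equation as a first order system in integral form.\<close>

lemma wave_mode:
  fixes S :: "real \<Rightarrow> 'h \<times> 'v \<Rightarrow> 'h \<times> 'v" and k :: nat
  assumes S: "C0_semigroup S" and gen: "generator S = A_mu e \<alpha> \<iota> \<mu>" and \<mu>: "\<mu> > 0"
    and f: "f \<in> borel_measurable borel" "set_integrable lborel {0..T} f"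
  defines "z \<equiv> \<lambda>t. LINT s:{0..t}|lborel. S (t - s) ((1/\<mu>) *\<^sub>R (0, \<iota> (f s)))"
  defines "u \<equiv> \<lambda>t. fst (z t) \<bullet> e k" and "w \<equiv> \<lambda>t. vcoeff k (snd (z t))"
  assumes t: "0 \<le> t" "t \<le> T"
  shows "set_integrable lborel {0..t} w" and "u t = (LINT s:{0..t}|lborel. w s)"
    and "w t = (LINT s:{0..t}|lborel. (f s \<bullet> e k - w s - \<alpha> k * u s) / \<mu>)"
proof -
  interpret S: C0_sg S by unfold_locales (rule S)
  define F where "F = (\<lambda>s. (1/\<mu>) *\<^sub>R (0 :: 'h, \<iota> (f s)))"
  have blF: "bounded_linear (\<lambda>x. (1/\<mu>) *\<^sub>R (0 :: 'h, \<iota> x))"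
    by (intro bounded_linear_scaleR_right[THEN bounded_linear_compose] bounded_linear_Pair bounded_linear_zero bounded_linear_iota)
  have Fm: "F \<in> borel_measurable borel"
    unfolding F_def using measurable_compose[OF f(1) borel_measurable_continuous_onI[OF linear_continuous_on[OF blF]]] .
  have ft: "set_integrable lborel {0..t} f" by (rule set_integrable_subset[OF f(2)]) (use t in auto)
  have Fi: "set_integrable lborel {0..t} F"
    using integrable_bounded_linear[OF blF ft[unfolded set_integrable_def]]
    by (simp add: set_integrable_def F_def linear_simps[OF bounded_linear_iota])
  have dom: "\<exists>y. (F s, y) \<in> generator S" for s
  proof -
    have "0 \<in> Hspace e \<alpha> 1" by (simp add: Hspace_def)
    then have "(0, \<iota> ((1/\<mu>) *\<^sub>R f s)) \<in> Domain (A_mu e \<alpha> \<iota> \<mu>)" unfolding A_mu_def by blast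
    moreover have "F s = (0, \<iota> ((1/\<mu>) *\<^sub>R f s))" by (simp add: F_def linear_simps[OF bounded_linear_iota])
    ultimately show ?thesis unfolding gen by auto
  qed
  have z: "z = (\<lambda>t. LINT s:{0..t}|lborel. S (t - s) (F s))" by (simp add: z_def F_def)
  have bu: "bounded_linear (\<lambda>a :: 'h \<times> 'v. fst a \<bullet> e k)"
    by (intro bounded_linear_inner_left[THEN bounded_linear_compose] bounded_linear_fst)
  have bw: "bounded_linear (\<lambda>a :: 'h \<times> 'v. vcoeff k (snd a))"
    by (intro bounded_linear_vcoeff[THEN bounded_linear_compose] bounded_linear_snd)
  have bwu: "bounded_linear (\<lambda>a :: 'h \<times> 'v. (- vcoeff k (snd a) - \<alpha> k * (fst a \<bullet> e k)) / \<mu>)"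
    by (intro bounded_linear_divide[THEN bounded_linear_compose] bounded_linear_sub bounded_linear_minus
        bounded_linear_mult_right[THEN bounded_linear_compose] bu bw)
  have rel1: "(a, b) \<in> generator S \<Longrightarrow> fst b \<bullet> e k = vcoeff k (snd a)" for a b
    unfolding gen by (rule A_mu_coeff)
  have rel2: "(a, b) \<in> generator S \<Longrightarrow> vcoeff k (snd b) = (- vcoeff k (snd a) - \<alpha> k * (fst a \<bullet> e k)) / \<mu>" for a b
    unfolding gen by (rule A_mu_coeff)
  note 1 = S.weak_duhamel[OF bu bw rel1 Fm Fi dom]
  note 2 = S.weak_duhamel[OF bw bwu rel2 Fm Fi dom]
  show "set_integrable lborel {0..t} w" using 1(1) by (simp add: w_def z)
  have "(LINT s:{0..t}|lborel. fst (F s) \<bullet> e k) = 0" by (simp add: F_def set_lebesgue_integral_def)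
  then show "u t = (LINT s:{0..t}|lborel. w s)" using 1(2) by (simp add: u_def w_def z)
  have fk: "set_integrable lborel {0..t} (\<lambda>s. (f s \<bullet> e k) / \<mu>)"
    using integrable_bounded_linear[OF bounded_linear_inner_left ft[unfolded set_integrable_def], of "e k"]
    by (intro set_integrable_divide) (simp add: set_integrable_def)
  have "w t = (LINT s:{0..t}|lborel. (f s \<bullet> e k) / \<mu>) + (LINT s:{0..t}|lborel. (- w s - \<alpha> k * u s) / \<mu>)"
    using 2(2) by (simp add: u_def w_def z) (simp add: F_def linear_simps[OF bounded_linear_vcoeff])
  also have "\<dots> = (LINT s:{0..t}|lborel. (f s \<bullet> e k) / \<mu> + (- w s - \<alpha> k * u s) / \<mu>)"
    by (rule set_integral_add(2)[symmetric, OF fk]) (use 2(1) in \<open>simp add: u_def w_def z\<close>)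
  finally show "w t = (LINT s:{0..t}|lborel. (f s \<bullet> e k - w s - \<alpha> k * u s) / \<mu>)"
    by (simp add: add_divide_distrib diff_divide_distrib algebra_simps)
qed

section \<open>Wave paths of finite action\<close>

text \<open>Finite action paths are delayed by one time unit below, which is where \<open>1 \<le> T\<close> comes from; it leaves
  room for the endpoint correction of the heat path at a cost that does not depend on \<open>T\<close>.\<close>

definition wave_path :: "real \<Rightarrow> real \<Rightarrow> (real \<Rightarrow> 'h) \<Rightarrow> (real \<Rightarrow> 'h) \<Rightarrow> bool" where
  "wave_path \<mu> T \<phi> \<psi> \<longleftrightarrow> 1 \<le> T \<and> continuous_on UNIV \<phi> \<and>
     \<psi> \<in> borel_measurable borel \<and> integrable lborel (\<lambda>s. (norm (\<psi> s))\<^sup>2) \<and>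
     (\<forall>k. \<exists>w. set_integrable lborel {0..T} w \<and> (\<forall>t\<in>{0..T}.
        \<phi> t \<bullet> e k = (LINT s:{0..t}|lborel. w s) \<and>
        w t = (LINT s:{0..t}|lborel. ((Q (\<psi> s) + B (\<phi> s)) \<bullet> e k - w s - \<alpha> k * (\<phi> s \<bullet> e k)) / \<mu>)))"

text \<open>The path is frozen and the control is set to 0 outside the time interval, so that both
  live on the whole line; then the motion is started one time unit later. The initial rest at 0 adds
  no energy.\<close>

lemma wave_path_mild:
  fixes S :: "real \<Rightarrow> 'h \<times> 'v \<Rightarrow> 'h \<times> 'v"
  assumes S: "C0_semigroup S" and gen: "generator S = A_mu e \<alpha> \<iota> \<mu>" and \<mu>: "\<mu> > 0"
    and T: "T > 0" and zc: "continuous_on {0..T} z" and z0: "z 0 = 0"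
    and ctl: "L2_control T \<psi>"
    and eq: "\<And>t. t \<in> {0..T} \<Longrightarrow> z t = S t (z 0) + (LINT s:{0..t}|lborel. S (t - s) (B_mu \<iota> B \<mu> (z s)))
                          + (LINT s:{0..t}|lborel. S (t - s) (Q_mu \<iota> Q \<mu> (\<psi> s)))"
  obtains \<phi>' \<psi>' where "wave_path \<mu> (T + 1) \<phi>' \<psi>'" "\<phi>' (T + 1) = fst (z T)"
    "(\<integral>s. (norm (\<psi>' s))\<^sup>2 \<partial>lborel) = L2_energy T \<psi>"
proof -
  interpret S: C0_sg S by unfold_locales (rule S)
  define cl where "cl = (\<lambda>t. min T (max 0 t))"
  have cl: "cl t \<in> {0..T}" "t \<in> {0..T} \<Longrightarrow> cl t = t" for t using T by (auto simp: cl_def)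
  have clc: "continuous_on A cl" for A unfolding cl_def by (intro continuous_intros)
  define \<phi> where "\<phi> = (\<lambda>t. fst (z (cl t)))"
  have \<phi>c: "continuous_on UNIV \<phi>"
    unfolding \<phi>_def by (intro continuous_on_fst continuous_on_compose2[OF zc clc]) (use cl in auto)
  have [measurable]: "\<phi> \<in> borel_measurable borel" by (rule borel_measurable_continuous_onI[OF \<phi>c])
  define \<psi>1 where "\<psi>1 = (\<lambda>s. indicator {0<..<T} s *\<^sub>R \<psi> s)"
  have \<psi>1m [measurable]: "\<psi>1 \<in> borel_measurable borel"
    using ctl by (simp add: L2_control_def set_borel_measurable_def \<psi>1_def)
  have nn: "(norm (\<psi>1 s))\<^sup>2 = indicator {0<..<T} s *\<^sub>R (norm (\<psi> s))\<^sup>2" for s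
    by (simp add: \<psi>1_def indicator_def)
  have \<psi>1i: "integrable lborel (\<lambda>s. (norm (\<psi>1 s))\<^sup>2)"
    using ctl by (simp add: nn L2_control_def set_integrable_def)
  have en: "(\<integral>s. (norm (\<psi>1 s))\<^sup>2 \<partial>lborel) = L2_energy T \<psi>"
    by (simp add: nn L2_energy_def set_lebesgue_integral_def)
  define f where "f = (\<lambda>s. Q (\<psi>1 s) + B (\<phi> s))"
  have fm: "f \<in> borel_measurable borel" unfolding f_def by measurable
  have Qi: "set_integrable lborel {0..T} (\<lambda>s. Q (\<psi>1 s))"
    using integrable_bounded_linear[OF Q set_integrable_square_imp[OF \<psi>1m \<psi>1i, unfolded set_integrable_def]]
    by (simp add: set_integrable_def linear_simps[OF Q])
  have Bi: "set_integrable lborel {0..T} (\<lambda>s. B (\<phi> s))"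
    by (intro borel_integrable_atLeastAtMost' continuous_on_compose2[OF continuous_B[of UNIV]] continuous_on_subset[OF \<phi>c]) auto
  have fi: "set_integrable lborel {0..T} f" unfolding f_def by (rule set_integral_add(1)[OF Qi Bi])
  let ?J = "\<lambda>x. (1/\<mu>) *\<^sub>R (0 :: 'h, \<iota> x)"
  have blF: "bounded_linear ?J"
    by (intro bounded_linear_scaleR_right[THEN bounded_linear_compose] bounded_linear_Pair bounded_linear_zero bounded_linear_iota)
  have blm: "?J \<in> borel_measurable borel"
    by (rule borel_measurable_continuous_onI[OF linear_continuous_on[OF blF]])
  have zeq: "z t = (LINT s:{0..t}|lborel. S (t - s) (?J (f s)))" if t: "t \<in> {0..T}" for t
  proof -
    have I: "set_integrable lborel {0..t} (\<lambda>s. S (t - s) (?J (g s)))"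
      if g: "g \<in> borel_measurable borel" "set_integrable lborel {0..T} g" for g
    proof (rule S.duhamel_integrable)
      show "(\<lambda>s. ?J (g s)) \<in> borel_measurable borel" using measurable_compose[OF g(1) blm] .
      have "set_integrable lborel {0..T} (\<lambda>s. ?J (g s))"
        using integrable_bounded_linear[OF blF g(2)[unfolded set_integrable_def]]
        by (simp add: set_integrable_def linear_simps[OF bounded_linear_iota])
      then show "set_integrable lborel {0..t} (\<lambda>s. ?J (g s))"
        by (rule set_integrable_subset) (use t in auto)
    qed
    have "(LINT s:{0..t}|lborel. S (t - s) (B_mu \<iota> B \<mu> (z s))) = (LINT s:{0..t}|lborel. S (t - s) (?J (B (\<phi> s))))"
      by (rule set_lebesgue_integral_cong) (use t cl in \<open>auto simp: B_mu_def \<phi>_def\<close>)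
    \<comment> \<open>The cut-off control lives on the open interval; the closed one differs from it
      only in the times 0 and T.\<close>
    moreover have "(LINT s:{0..t}|lborel. S (t - s) (Q_mu \<iota> Q \<mu> (\<psi> s))) = (LINT s:{0..t}|lborel. S (t - s) (?J (Q (\<psi>1 s))))"
      unfolding set_lebesgue_integral_def
      by (rule integral_discrete_difference[where X="{0, T}"]) (use t in \<open>auto simp: Q_mu_def \<psi>1_def indicator_def\<close>)
    ultimately have "z t = (LINT s:{0..t}|lborel. S (t - s) (?J (B (\<phi> s)))) + (LINT s:{0..t}|lborel. S (t - s) (?J (Q (\<psi>1 s))))"
      using eq[OF t] t by (simp add: z0)
    also have "\<dots> = (LINT s:{0..t}|lborel. S (t - s) (?J (B (\<phi> s))) + S (t - s) (?J (Q (\<psi>1 s))))"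
      by (intro set_integral_add(2)[symmetric] I Bi Qi) measurable
    also have "\<dots> = (LINT s:{0..t}|lborel. S (t - s) (?J (f s)))"
      by (rule set_lebesgue_integral_cong)
        (auto simp: f_def linear_simps[OF bounded_linear_iota] add_divide_distrib algebra_simps simp flip: S.S_plus)
    finally show ?thesis .
  qed
  define del where "del = (\<lambda>(h :: real \<Rightarrow> real) s. if s < 1 then 0 else h (s - 1))"
  define \<phi>' where "\<phi>' = (\<lambda>s. \<phi> (s - 1))"
  define \<psi>' where "\<psi>' = (\<lambda>s. \<psi>1 (s - 1))"
  have \<phi>neg: "\<phi> s = 0" if "s \<le> 0" for s using that T by (simp add: \<phi>_def cl_def z0)
  have \<psi>neg: "\<psi>1 s = 0" if "s \<le> 0" for s using that by (simp add: \<psi>1_def)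
  have "wave_path \<mu> (T + 1) \<phi>' \<psi>'"
    unfolding wave_path_def
  proof (intro conjI allI)
    show "1 \<le> T + 1" using T by simp
    show "continuous_on UNIV \<phi>'"
      unfolding \<phi>'_def by (rule continuous_on_compose2[OF \<phi>c]) (auto intro!: continuous_intros)
    show "\<psi>' \<in> borel_measurable borel" unfolding \<psi>'_def by measurable
    show "integrable lborel (\<lambda>s. (norm (\<psi>' s))\<^sup>2)"
      using lborel_integrable_real_affine[OF \<psi>1i, of 1 "-1"] by (simp add: \<psi>'_def)
    fix k
    define u w where "u = (\<lambda>t. \<phi> t \<bullet> e k)" and
      "w = (\<lambda>t. vcoeff k (snd (LINT s:{0..t}|lborel. S (t - s) (?J (f s)))))"
    note wm = wave_mode[OF S gen \<mu> fm fi, of _ k]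
    have u: "u t = (LINT s:{0..t}|lborel. w s)" if t: "t \<in> {0..T}" for t
      using wm(2)[of t] t zeq[OF t] cl(2)[OF t] by (simp add: u_def w_def \<phi>_def)
    have wi: "set_integrable lborel {0..T} w" using wm(1)[of T] T by (simp add: w_def)
    have w: "w t = (LINT s:{0..t}|lborel. (f s \<bullet> e k - w s - \<alpha> k * u s) / \<mu>)" if t: "t \<in> {0..T}" for t
    proof -
      have "w t = (LINT s:{0..t}|lborel. (f s \<bullet> e k - w s - \<alpha> k *
          (fst (LINT r:{0..s}|lborel. S (s - r) (?J (f r))) \<bullet> e k)) / \<mu>)"
        using wm(3)[of t] t by (simp add: w_def)
      also have "\<dots> = (LINT s:{0..t}|lborel. (f s \<bullet> e k - w s - \<alpha> k * u s) / \<mu>)"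
        by (rule set_lebesgue_integral_cong) (use t cl(2) zeq in \<open>auto simp: u_def \<phi>_def\<close>)
      finally show ?thesis .
    qed
    show "\<exists>w. set_integrable lborel {0..T+1} w \<and> (\<forall>t\<in>{0..T+1}.
        \<phi>' t \<bullet> e k = (LINT s:{0..t}|lborel. w s) \<and>
        w t = (LINT s:{0..t}|lborel. ((Q (\<psi>' s) + B (\<phi>' s)) \<bullet> e k - w s - \<alpha> k * (\<phi>' s \<bullet> e k)) / \<mu>))"
    proof (intro exI[of _ "del w"] conjI ballI)
      show "set_integrable lborel {0..T+1} (del w)" unfolding del_def by (rule set_integrable_delay[OF wi])
      fix t assume t: "t \<in> {0..T+1}"
      show "\<phi>' t \<bullet> e k = (LINT s:{0..t}|lborel. del w s)"
        unfolding del_def lborel_integral_delay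
        using u[of "t - 1"] t \<phi>neg[of "t - 1"] by (auto simp: \<phi>'_def u_def)
      \<comment> \<open>Resting at 0 solves the equation without control because
        \<open>B 0 = 0\<close>; hence the delayed right-hand side is 0 during the first time
        unit.\<close>
      have "(Q (\<psi>' s) + B (\<phi>' s)) \<bullet> e k - del w s - \<alpha> k * (\<phi>' s \<bullet> e k) =
          del (\<lambda>s. f s \<bullet> e k - w s - \<alpha> k * u s) s" for s
        using \<phi>neg[of "s - 1"] \<psi>neg[of "s - 1"]
        by (auto simp: del_def f_def u_def \<phi>'_def \<psi>'_def B_0 linear_simps[OF Q])
      then have "(LINT s:{0..t}|lborel. ((Q (\<psi>' s) + B (\<phi>' s)) \<bullet> e k - del w s - \<alpha> k * (\<phi>' s \<bullet> e k)) / \<mu>)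
          = (LINT s:{0..t}|lborel. if s < 1 then 0 else (f (s-1) \<bullet> e k - w (s-1) - \<alpha> k * u (s-1)) / \<mu>)"
        by (intro arg_cong[where f="set_lebesgue_integral _ _"] ext) (simp add: del_def)
      also have "\<dots> = del w t"
        unfolding lborel_integral_delay[of t "\<lambda>s. (f s \<bullet> e k - w s - \<alpha> k * u s) / \<mu>"]
        using w[of "t - 1"] t by (auto simp: del_def)
      finally show "del w t = (LINT s:{0..t}|lborel. ((Q (\<psi>' s) + B (\<phi>' s)) \<bullet> e k - del w s - \<alpha> k * (\<phi>' s \<bullet> e k)) / \<mu>)" ..
    qed
  qed
  moreover have "\<phi>' (T + 1) = fst (z T)" using T by (simp add: \<phi>'_def \<phi>_def cl_def)
  moreover have "(\<integral>s. (norm (\<psi>' s))\<^sup>2 \<partial>lborel) = L2_energy T \<psi>"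
    using lborel_integral_real_affine[of 1 "\<lambda>s. (norm (\<psi>1 s))\<^sup>2" "-1"] en by (simp add: \<psi>'_def)
  ultimately show ?thesis by (rule that)
qed

lemma V_mu_lessE:
  fixes S :: "real \<Rightarrow> real \<Rightarrow> 'h \<times> 'v \<Rightarrow> 'h \<times> 'v"
  assumes S: "C0_semigroup (S \<mu>)" and gen: "generator (S \<mu>) = A_mu e \<alpha> \<iota> \<mu>" and \<mu>: "\<mu> > 0"
    and less: "V_mu S \<iota> B Q \<mu> x < ereal L"
  obtains T \<phi> \<psi> where "wave_path \<mu> T \<phi> \<psi>" "\<phi> T = x" "(\<integral>s. (norm (\<psi> s))\<^sup>2 \<partial>lborel) < 2 * L"
proof -
  obtain y where "V_pair S \<iota> B Q \<mu> (x, y) < ereal L"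
    using less unfolding V_mu_def by (auto simp: INF_less_iff)
  then obtain T z where z: "T > 0" "continuous_on {0..T} z" "z 0 = 0" "z T = (x, y)"
    "action (S \<mu>) (B_mu \<iota> B \<mu>) (Q_mu \<iota> Q \<mu>) T z < ereal L"
    unfolding V_pair_def by (auto simp: Inf_less_iff)
  then obtain \<psi> where \<psi>: "L2_control T \<psi>" "L2_energy T \<psi> < 2 * L"
    "\<forall>t\<in>{0..T}. z t = S \<mu> t (z 0) + (LINT s:{0..t}|lborel. S \<mu> (t - s) (B_mu \<iota> B \<mu> (z s)))
                          + (LINT s:{0..t}|lborel. S \<mu> (t - s) (Q_mu \<iota> Q \<mu> (\<psi> s)))"
    unfolding action_less_iff by blast
  show ?thesis
    by (rule wave_path_mild[OF S gen \<mu> z(1-3) \<psi>(1) \<psi>(3)[rule_format]])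
      (use z(4) \<psi>(2) that in auto)
qed

section \<open>The heat equation\<close>

abbreviation control_sq :: "(real \<Rightarrow> 'h) \<Rightarrow> ennreal" where
  "control_sq \<psi> \<equiv> (\<integral>\<^sup>+s. ennreal ((norm (\<psi> s))\<^sup>2) \<partial>lborel)"

sublocale E: C0_sg E by unfold_locales (rule E)

text \<open>The product \<open>exp (\<alpha> k * s) *\<^sub>R E s (e k)\<close> has derivative zero,
  so it keeps its value at time 0.\<close>

lemma E_basis: "t \<ge> 0 \<Longrightarrow> E t (e k) = exp (- \<alpha> k * t) *\<^sub>R e k"
proof -
  assume t: "t \<ge> 0"
  have "((\<lambda>s. exp (\<alpha> k * s) *\<^sub>R E s (e k)) has_vector_derivative 0) (at s within {0..})" if "s \<in> {0..}" for s
  proof -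
    have "((\<lambda>s. exp (\<alpha> k * s) *\<^sub>R E s (e k)) has_vector_derivative
        (exp (\<alpha> k * s) *\<^sub>R E s (- \<alpha> k *\<^sub>R e k) + (\<alpha> k * exp (\<alpha> k * s)) *\<^sub>R E s (e k))) (at s within {0..})"
      by (rule has_vector_derivative_scaleR[OF _ E.has_vector_derivative_orbit[OF E_gen]])
        (use that in \<open>auto intro!: derivative_eq_intros\<close>)
    moreover have "E s (- \<alpha> k *\<^sub>R e k) = - \<alpha> k *\<^sub>R E s (e k)" using that by (intro E.S_scaleR) auto
    ultimately show ?thesis by (simp add: mult.commute)
  qed
  then obtain v where v: "\<And>s. s \<in> {0..} \<Longrightarrow> exp (\<alpha> k * s) *\<^sub>R E s (e k) = v"
    by (rule has_vector_derivative_zero_constant[OF convex_real_interval(1), of 0 "\<lambda>s. exp (\<alpha> k * s) *\<^sub>R E s (e k)"]) auto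
  have "v = e k" using v[of 0] by simp
  then have "exp (\<alpha> k * t) *\<^sub>R E t (e k) = e k" using v[of t] t by simp
  then have "exp (- \<alpha> k * t) *\<^sub>R (exp (\<alpha> k * t) *\<^sub>R E t (e k)) = exp (- \<alpha> k * t) *\<^sub>R e k" by simp
  then show ?thesis by (simp add: exp_minus)
qed

lemma E_coeff: "t \<ge> 0 \<Longrightarrow> E t x \<bullet> e k = exp (- \<alpha> k * t) * (x \<bullet> e k)"
  by (rule functional_eq_coeff)
    (auto simp: E_basis ortho intro!: bounded_linear_compose[OF bounded_linear_inner_left E.bl])

lemma E_duhamel_coeff:
  assumes F: "F \<in> borel_measurable borel" "set_integrable lborel {0..t} F"
  shows "(LINT s:{0..t}|lborel. E (t - s) (F s)) \<bullet> e k = (LINT s:{0..t}|lborel. exp (- \<alpha> k * (t - s)) * (F s \<bullet> e k))"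
proof -
  have "(LINT s:{0..t}|lborel. E (t - s) (F s)) \<bullet> e k = (\<integral>s. (indicator {0..t} s *\<^sub>R E (t - s) (F s)) \<bullet> e k \<partial>lborel)"
    using E.duhamel_integrable[OF F] unfolding set_lebesgue_integral_def set_integrable_def
    by (rule integral_bounded_linear[OF bounded_linear_inner_left, symmetric])
  also have "\<dots> = (LINT s:{0..t}|lborel. exp (- \<alpha> k * (t - s)) * (F s \<bullet> e k))"
    unfolding set_lebesgue_integral_def
    by (rule Bochner_Integration.integral_cong) (auto simp: indicator_def E_coeff)
  finally show ?thesis .
qed

text \<open>Upper bounds for \<open>V\<close> come from controls prescribed mode by mode. Once the
  coefficients are assembled into a control in H, the mild equation holds because all its
  coefficients agree.\<close>

lemma V_le_of_coeff:
  fixes a :: "nat \<Rightarrow> real \<Rightarrow> real"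
  assumes T: "T \<ge> 0" and \<phi>: "continuous_on {0..T} \<phi>" "\<phi> 0 = 0"
    and a [measurable]: "\<And>k. a k \<in> borel_measurable borel"
    and en: "(\<integral>\<^sup>+s. (\<Sum>k. ennreal ((a k s)\<^sup>2)) \<partial>lborel) \<le> ennreal A" and A: "A \<ge> 0"
    and eq: "\<And>k t. t \<in> {0..T} \<Longrightarrow>
      \<phi> t \<bullet> e k = (LINT s:{0..t}|lborel. exp (- \<alpha> k * (t - s)) * (B (\<phi> s) \<bullet> e k + lam k * a k s))"
  shows "V E B Q (\<phi> T) \<le> ereal (A / 2)"
proof -
  \<comment> \<open>Times at which the coefficients are not square summable form a null set, as the
    energy integral is finite. The control is 0 there, which does not affect the mild
    equation.\<close>
  define G where "G = {s. (\<Sum>k. ennreal ((a k s)\<^sup>2)) \<noteq> \<infinity>}"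
  have G [measurable]: "G \<in> sets borel" unfolding G_def by measurable
  have Gsm: "summable (\<lambda>k. (a k s)\<^sup>2)" if "s \<in> G" for s
    using that by (intro summable_suminf_not_top) (auto simp: G_def)
  define \<psi> where "\<psi> = (\<lambda>s. \<Sum>k. (indicator G s * a k s) *\<^sub>R e k)"
  have sq: "summable (\<lambda>k. (indicator G s * a k s)\<^sup>2)" for s
    using Gsm[of s] by (cases "s \<in> G") auto
  have \<psi>m [measurable]: "\<psi> \<in> borel_measurable borel"
  proof (rule borel_measurable_LIMSEQ_metric)
    show "(\<lambda>s. \<Sum>k<n. (indicator G s * a k s) *\<^sub>R e k) \<in> borel_measurable borel" for n by measurable
    show "(\<lambda>n. \<Sum>k<n. (indicator G s * a k s) *\<^sub>R e k) \<longlonglongrightarrow> \<psi> s" for s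
      unfolding \<psi>_def by (intro summable_LIMSEQ summable_basis sq)
  qed
  have \<psi>c: "\<psi> s \<bullet> e k = indicator G s * a k s" for s k
    unfolding \<psi>_def by (rule inner_suminf_basis[OF sq])
  have \<psi>n: "ennreal ((norm (\<psi> s))\<^sup>2) \<le> (\<Sum>k. ennreal ((a k s)\<^sup>2))" for s
  proof (cases "s \<in> G")
    case True
    have "(norm (\<psi> s))\<^sup>2 = (\<Sum>k. (a k s)\<^sup>2)"
      using parseval[of "\<psi> s"] True by (simp add: \<psi>c)
    then show ?thesis using Gsm[OF True] by (simp add: suminf_ennreal2)
  next
    case False
    then show ?thesis by (simp add: \<psi>_def)
  qed
  have AEG: "AE s in lborel. s \<in> G"
  proof -
    have "(\<integral>\<^sup>+s. (\<Sum>k. ennreal ((a k s)\<^sup>2)) \<partial>lborel) \<noteq> \<infinity>" using en by (auto simp: top_unique)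
    then have "AE s in lborel. (\<Sum>k. ennreal ((a k s)\<^sup>2)) \<noteq> \<infinity>"
      by (intro nn_integral_PInf_AE) auto
    then show ?thesis by (simp add: G_def)
  qed
  have le: "control_sq \<psi> \<le> ennreal A"
    by (rule order_trans[OF nn_integral_mono en]) (rule \<psi>n)
  have \<psi>i: "integrable lborel (\<lambda>s. (norm (\<psi> s))\<^sup>2)"
    by (rule integrableI_bounded) (use le in \<open>auto simp: top_unique less_top[symmetric]\<close>)
  have "(\<integral>s. (norm (\<psi> s))\<^sup>2 \<partial>lborel) \<le> A"
    using le A nn_integral_eq_integral[OF \<psi>i] by simp
  moreover have si: "set_integrable lborel {0<..<T} (\<lambda>s. (norm (\<psi> s))\<^sup>2)"
    unfolding set_integrable_def by (rule integrable_mult_indicator[OF _ \<psi>i]) auto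
  then have "L2_energy T \<psi> \<le> (\<integral>s. (norm (\<psi> s))\<^sup>2 \<partial>lborel)"
    unfolding L2_energy_def set_lebesgue_integral_def set_integrable_def
    by (rule integral_mono[OF _ \<psi>i]) (auto simp: indicator_def)
  ultimately have energy: "L2_energy T \<psi> \<le> A" by linarith
  have ctl: "L2_control T \<psi>" using si by (simp add: L2_control_def set_borel_measurable_def)
  have Q\<psi>: "(\<lambda>s. Q (\<psi> s)) \<in> borel_measurable borel" by measurable
  have Qi: "set_integrable lborel {0..T} (\<lambda>s. Q (\<psi> s))"
    using integrable_bounded_linear[OF Q set_integrable_square_imp[OF \<psi>m \<psi>i, unfolded set_integrable_def]]
    by (simp add: set_integrable_def linear_simps[OF Q])
  define b where "b = (\<lambda>s. indicator {0..T} s *\<^sub>R B (\<phi> s))"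
  have Bc: "continuous_on {0..T} (\<lambda>s. B (\<phi> s))"
    by (rule continuous_on_compose2[OF continuous_B[of UNIV] \<phi>(1)]) auto
  have bm: "b \<in> borel_measurable borel"
    unfolding b_def by (rule borel_measurable_continuous_on_indicator[OF _ Bc]) auto
  have bi: "set_integrable lborel {0..T} b"
    using borel_integrable_atLeastAtMost'[OF Bc] by (simp add: set_integrable_def b_def indicator_inter_arith[symmetric])
  have mild: "\<phi> t = E t (\<phi> 0) + (LINT s:{0..t}|lborel. E (t - s) (B (\<phi> s))) + (LINT s:{0..t}|lborel. E (t - s) (Q (\<psi> s)))"
    if t: "t \<in> {0..T}" for t
  proof (rule eq_coeffI)
    fix k
    have sub: "set_integrable lborel {0..t} g" if "set_integrable lborel {0..T} g" for g :: "real \<Rightarrow> 'h"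
      by (rule set_integrable_subset[OF that]) (use t in auto)
    have subr: "set_integrable lborel {0..t} (\<lambda>s. exp (- \<alpha> k * (t - s)) * (g s \<bullet> e k))"
      if "set_integrable lborel {0..T} g" for g :: "real \<Rightarrow> 'h"
    proof -
      have "set_integrable lborel {0..t} (\<lambda>s. g s \<bullet> e k)"
        using integrable_bounded_linear[OF bounded_linear_inner_left sub[OF that, unfolded set_integrable_def], of "e k"]
        by (simp add: set_integrable_def)
      then have "set_integrable lborel {0..t} (\<lambda>s. (g s \<bullet> e k) * exp (- \<alpha> k * (t - s)))"
        by (intro set_integrable_times_continuous continuous_intros)
      then show ?thesis by (simp add: mult.commute)
    qed
    have "(LINT s:{0..t}|lborel. E (t - s) (B (\<phi> s))) = (LINT s:{0..t}|lborel. E (t - s) (b s))"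
      by (rule set_lebesgue_integral_cong) (use t in \<open>auto simp: b_def\<close>)
    then have 1: "(LINT s:{0..t}|lborel. E (t - s) (B (\<phi> s))) \<bullet> e k = (LINT s:{0..t}|lborel. exp (- \<alpha> k * (t - s)) * (b s \<bullet> e k))"
      by (simp add: E_duhamel_coeff[OF bm sub[OF bi]])
    have 2: "(LINT s:{0..t}|lborel. E (t - s) (Q (\<psi> s))) \<bullet> e k = (LINT s:{0..t}|lborel. exp (- \<alpha> k * (t - s)) * (Q (\<psi> s) \<bullet> e k))"
      by (rule E_duhamel_coeff[OF Q\<psi> sub[OF Qi]])
    have [measurable]: "b \<in> borel_measurable borel" by (rule bm)
    have "(LINT s:{0..t}|lborel. exp (- \<alpha> k * (t - s)) * (b s \<bullet> e k)) + (LINT s:{0..t}|lborel. exp (- \<alpha> k * (t - s)) * (Q (\<psi> s) \<bullet> e k))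
      = (LINT s:{0..t}|lborel. exp (- \<alpha> k * (t - s)) * (b s \<bullet> e k) + exp (- \<alpha> k * (t - s)) * (Q (\<psi> s) \<bullet> e k))"
      by (intro set_integral_add(2)[symmetric] subr bi Qi)
    also have "\<dots> = (LINT s:{0..t}|lborel. exp (- \<alpha> k * (t - s)) * (b s \<bullet> e k + lam k * a k s))"
      unfolding set_lebesgue_integral_def
    proof (rule integral_cong_AE)
      show "AE s in lborel. indicator {0..t} s *\<^sub>R (exp (- \<alpha> k * (t - s)) * (b s \<bullet> e k) + exp (- \<alpha> k * (t - s)) * (Q (\<psi> s) \<bullet> e k)) =
          indicator {0..t} s *\<^sub>R (exp (- \<alpha> k * (t - s)) * (b s \<bullet> e k + lam k * a k s))"
        using AEG by eventually_elim (simp add: Q_coeff \<psi>c algebra_simps)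
    qed measurable
    also have "\<dots> = (LINT s:{0..t}|lborel. exp (- \<alpha> k * (t - s)) * (B (\<phi> s) \<bullet> e k + lam k * a k s))"
      by (rule set_lebesgue_integral_cong) (use t in \<open>auto simp: b_def\<close>)
    finally show "\<phi> t \<bullet> e k = (E t (\<phi> 0) + (LINT s:{0..t}|lborel. E (t - s) (B (\<phi> s))) + (LINT s:{0..t}|lborel. E (t - s) (Q (\<psi> s)))) \<bullet> e k"
      using eq[OF t] t by (simp add: inner_add_left 1 2 \<phi>(2))
  qed
  have "action E B Q T \<phi> \<le> ereal (1/2) * ereal (L2_energy T \<psi>)"
    unfolding action_def by (intro ereal_mult_left_mono Inf_lower CollectI exI[of _ \<psi>] conjI ballI refl ctl mild) auto
  also have "\<dots> \<le> ereal (A / 2)" using energy by simp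
  finally have "action E B Q T \<phi> \<le> ereal (A / 2)" .
  moreover have "V E B Q (\<phi> T) \<le> action E B Q T \<phi>"
    unfolding V_def by (intro Inf_lower CollectI exI[of _ T] exI[of _ \<phi>] conjI refl T \<phi>)
  ultimately show ?thesis by (rule order_trans[rotated])
qed

section \<open>Norms of the scale \<open>H\<^sup>\<delta>\<close>\<close>

text \<open>The square of the H^\<delta> norm, with value infinity outside H^\<delta>. Estimates can
  thus be stated for all vectors before membership is known.\<close>

definition hn :: "real \<Rightarrow> 'h \<Rightarrow> ennreal" where
  "hn \<delta> x = (\<Sum>k. ennreal (\<alpha> k powr \<delta>) * ennreal ((x \<bullet> e k)\<^sup>2))"

abbreviation path_sq :: "real \<Rightarrow> real \<Rightarrow> (real \<Rightarrow> 'h) \<Rightarrow> ennreal" where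
  "path_sq T \<delta> h \<equiv> (\<integral>\<^sup>+s\<in>{0..T}. hn \<delta> (h s) \<partial>lborel)"

lemma hn_alt: "hn \<delta> x = (\<Sum>k. ennreal (\<alpha> k powr \<delta> * (x \<bullet> e k)\<^sup>2))"
  by (simp add: hn_def ennreal_mult)

lemma hn_measurable [measurable]: "hn \<delta> \<in> borel_measurable borel"
  unfolding hn_def by measurable

lemma hn_Hspace: "x \<in> Hspace e \<alpha> \<delta> \<Longrightarrow> hn \<delta> x = ennreal ((Hnorm e \<alpha> \<delta> x)\<^sup>2)"
  unfolding hn_alt Hspace_def Hnorm_def
  by (subst suminf_ennreal2) (auto simp: suminf_nonneg)

lemma Hspace_iff: "x \<in> Hspace e \<alpha> \<delta> \<longleftrightarrow> hn \<delta> x \<noteq> \<infinity>"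
proof
  assume "hn \<delta> x \<noteq> \<infinity>"
  then show "x \<in> Hspace e \<alpha> \<delta>"
    unfolding Hspace_def hn_alt using summable_suminf_not_top by fastforce
qed (simp add: hn_Hspace)

lemma hn_0: "hn 0 x = ennreal ((norm x)\<^sup>2)"
proof -
  have "x \<in> Hspace e \<alpha> 0" using summable_coeff by (simp add: Hspace_def)
  moreover have "Hnorm e \<alpha> 0 x = norm x" using parseval by (simp add: Hnorm_def)
  ultimately show ?thesis by (simp add: hn_Hspace)
qed

lemma hn_mono: "a \<le> b \<Longrightarrow> hn a x \<le> ennreal (\<alpha> 0 powr (a - b)) * hn b x"
  unfolding hn_def ennreal_suminf_cmult[symmetric] mult.assoc[symmetric]
  using powr_le[of a b] by (intro ennreal_suminf_mono mult_right_mono) (auto simp flip: ennreal_mult intro: ennreal_leI)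

lemma hn_add_le: "hn \<delta> (x + y) \<le> 2 * hn \<delta> x + 2 * hn \<delta> y"
proof -
  have "hn \<delta> (x + y) \<le> (\<Sum>k. 2 * (ennreal (\<alpha> k powr \<delta>) * ennreal ((x \<bullet> e k)\<^sup>2)) + 2 * (ennreal (\<alpha> k powr \<delta>) * ennreal ((y \<bullet> e k)\<^sup>2)))"
    unfolding hn_def
  proof (intro ennreal_suminf_mono)
    fix k
    have "((x + y) \<bullet> e k)\<^sup>2 \<le> 2 * (x \<bullet> e k)\<^sup>2 + 2 * (y \<bullet> e k)\<^sup>2"
      using sq_add_le[of 1 "x \<bullet> e k" "y \<bullet> e k"] by (simp add: inner_add_left)
    then have "ennreal (((x + y) \<bullet> e k)\<^sup>2) \<le> 2 * ennreal ((x \<bullet> e k)\<^sup>2) + 2 * ennreal ((y \<bullet> e k)\<^sup>2)"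
      by (simp flip: ennreal_mult ennreal_plus ennreal_numeral add: ennreal_leI)
    then have "ennreal (\<alpha> k powr \<delta>) * ennreal (((x + y) \<bullet> e k)\<^sup>2) \<le> ennreal (\<alpha> k powr \<delta>) * (2 * ennreal ((x \<bullet> e k)\<^sup>2) + 2 * ennreal ((y \<bullet> e k)\<^sup>2))"
      by (rule mult_left_mono) simp
    then show "ennreal (\<alpha> k powr \<delta>) * ennreal (((x + y) \<bullet> e k)\<^sup>2) \<le>
       2 * (ennreal (\<alpha> k powr \<delta>) * ennreal ((x \<bullet> e k)\<^sup>2)) + 2 * (ennreal (\<alpha> k powr \<delta>) * ennreal ((y \<bullet> e k)\<^sup>2))"
      by (simp add: distrib_left mult.left_commute)
  qed
  also have "\<dots> = 2 * hn \<delta> x + 2 * hn \<delta> y"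
    unfolding hn_def by (subst suminf_add[symmetric, OF summableI summableI]) (simp add: ennreal_suminf_cmult)
  finally show ?thesis .
qed

lemma hn_minus: "hn \<delta> (- x) = hn \<delta> x"
  by (simp add: hn_def)

text \<open>In this form the bound also holds for \<open>y\<close> outside \<open>H\<^sup>\<delta>\<close>, where the right-hand side is
  infinite because the constant \<open>\<alpha> 0\<close>, unlike \<open>\<gamma> \<delta>\<close>, is nonzero.\<close>

lemma hn_B_diff:
  assumes \<delta>: "\<delta> \<in> {0..1 + 2*\<beta>}" and x: "hn \<delta> x \<noteq> \<infinity>"
  shows "hn \<delta> (B x - B y) \<le> ennreal ((\<alpha> 0)\<^sup>2) * hn \<delta> (x - y)"
proof (cases "hn \<delta> (x - y) = \<infinity>")
  case True
  then show ?thesis using \<alpha>_0 by (simp add: ennreal_mult_top)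
next
  case False
  have "hn \<delta> (x + - (x - y)) \<le> 2 * hn \<delta> x + 2 * hn \<delta> (x - y)"
    using hn_add_le[of \<delta> x "- (x - y)"] unfolding hn_minus .
  also have "\<dots> < \<infinity>" using x False by (simp add: less_top ennreal_mult_less_top)
  finally have y: "y \<in> Hspace e \<alpha> \<delta>" by (simp add: Hspace_iff)
  have xH: "x \<in> Hspace e \<alpha> \<delta>" and xy: "x - y \<in> Hspace e \<alpha> \<delta>" using x False by (auto simp: Hspace_iff)
  note L = B_lip[OF \<delta>, unfolded Hlipschitz_def]
  have "B x \<in> Hspace e \<alpha> \<delta>" "B y \<in> Hspace e \<alpha> \<delta>" using L xH y by auto
  then have "hn \<delta> (B x + - B y) < \<infinity>"
    by (intro le_less_trans[OF hn_add_le]) (simp add: Hspace_iff hn_minus less_top ennreal_mult_less_top)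
  then have BH: "B x - B y \<in> Hspace e \<alpha> \<delta>" by (simp add: Hspace_iff)
  have nn: "0 \<le> Hnorm e \<alpha> \<delta> z" if "z \<in> Hspace e \<alpha> \<delta>" for z
    using that by (auto simp: Hnorm_def Hspace_def intro!: suminf_nonneg)
  have "Hnorm e \<alpha> \<delta> (B x - B y) \<le> \<gamma> \<delta> * Hnorm e \<alpha> \<delta> (x - y)" using L xH y by blast
  also have "\<dots> \<le> \<alpha> 0 * Hnorm e \<alpha> \<delta> (x - y)"
    using \<gamma>[OF \<delta>] nn[OF xy] by (intro mult_right_mono) auto
  finally have "(Hnorm e \<alpha> \<delta> (B x - B y))\<^sup>2 \<le> (\<alpha> 0)\<^sup>2 * (Hnorm e \<alpha> \<delta> (x - y))\<^sup>2"
    using nn[OF BH] by (metis power_mono power_mult_distrib)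
  then show ?thesis by (simp add: hn_Hspace BH xy ennreal_leI flip: ennreal_mult)
qed

lemma hn_B: "\<delta> \<in> {0..1 + 2*\<beta>} \<Longrightarrow> hn \<delta> (B x) \<le> ennreal ((\<alpha> 0)\<^sup>2) * hn \<delta> x"
  using hn_B_diff[of \<delta> 0 x] by (simp add: B_0 hn_minus hn_def[of _ 0])

lemma lam_sq_le: "(lam k)\<^sup>2 \<le> c\<^sup>2 * \<alpha> k powr (-2*\<beta>)"
proof -
  have "(lam k)\<^sup>2 \<le> (c * \<alpha> k powr (-\<beta>))\<^sup>2"
    using lam_le[of k] lam_pos[of k] by (intro power_mono) (auto simp del: lam_pos)
  also have "\<dots> = c\<^sup>2 * \<alpha> k powr (-2*\<beta>)"
    by (simp add: power_mult_distrib power2_eq_square flip: powr_add)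
  finally show ?thesis .
qed

lemma inverse_lam_sq_le: "1 / (lam k)\<^sup>2 \<le> c\<^sup>2 * \<alpha> k powr (2*\<beta>)"
proof -
  have "((1/c) * \<alpha> k powr (-\<beta>))\<^sup>2 \<le> (lam k)\<^sup>2"
    using lam_ge[of k] c by (intro power_mono) auto
  from divide_left_mono[OF this, of 1] have "1 / (lam k)\<^sup>2 \<le> 1 / ((1/c) * \<alpha> k powr (-\<beta>))\<^sup>2"
    using c lam_pos[of k, THEN less_imp_neq] by simp
  also have "\<dots> = c\<^sup>2 * \<alpha> k powr (2*\<beta>)"
    using c by (simp add: power_mult_distrib power2_eq_square powr_minus field_simps flip: powr_add)
  finally show ?thesis .
qed

text \<open>The decay of \<open>lam\<close> like \<open>\<alpha> k powr (- \<beta>)\<close> trades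
  the weight of index 2\<beta> for the norm of H; lower indices follow by embedding.\<close>

lemma hn_Q:
  assumes "\<tau> \<le> 2*\<beta>"
  shows "hn \<tau> (Q x) \<le> ennreal (c\<^sup>2 * \<alpha> 0 powr (\<tau> - 2*\<beta>)) * hn 0 x"
  unfolding hn_def ennreal_suminf_cmult[symmetric]
proof (intro ennreal_suminf_mono)
  fix k
  have "\<alpha> k powr \<tau> * (lam k)\<^sup>2 \<le> \<alpha> k powr \<tau> * (c\<^sup>2 * \<alpha> k powr (-2*\<beta>))"
    by (intro mult_left_mono lam_sq_le) auto
  also have "\<dots> = c\<^sup>2 * \<alpha> k powr (\<tau> - 2*\<beta>)" by (simp flip: powr_add)
  also have "\<dots> \<le> c\<^sup>2 * \<alpha> 0 powr (\<tau> - 2*\<beta>)"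
    using assms \<alpha>_0 \<alpha>_ge by (intro mult_left_mono powr_mono2') auto
  finally have "\<alpha> k powr \<tau> * (lam k)\<^sup>2 * (x \<bullet> e k)\<^sup>2 \<le> c\<^sup>2 * \<alpha> 0 powr (\<tau> - 2*\<beta>) * (x \<bullet> e k)\<^sup>2"
    by (rule mult_right_mono) simp
  then show "ennreal (\<alpha> k powr \<tau>) * ennreal ((Q x \<bullet> e k)\<^sup>2) \<le>
      ennreal (c\<^sup>2 * \<alpha> 0 powr (\<tau> - 2*\<beta>)) * (ennreal (\<alpha> k powr 0) * ennreal ((x \<bullet> e k)\<^sup>2))"
    by (simp add: Q_coeff power_mult_distrib mult.assoc ennreal_leI flip: ennreal_mult)
qed

text \<open>Tonelli: the path norm is a weighted sum over modes, so each scalar estimate that is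
  uniform in \<open>k\<close> holds in every space of the scale.\<close>

lemma nn_integral_hn:
  assumes [measurable]: "h \<in> borel_measurable borel"
  shows "path_sq T \<delta> h = (\<Sum>k. ennreal (\<alpha> k powr \<delta>) * sq_int T (\<lambda>s. h s \<bullet> e k))"
proof -
  have "path_sq T \<delta> h = (\<integral>\<^sup>+s. (\<Sum>k. ennreal (\<alpha> k powr \<delta>) * (ennreal ((h s \<bullet> e k)\<^sup>2) * indicator {0..T} s)) \<partial>lborel)"
    by (simp add: hn_def ennreal_suminf_multc[symmetric] mult.assoc)
  also have "\<dots> = (\<Sum>k. ennreal (\<alpha> k powr \<delta>) * sq_int T (\<lambda>s. h s \<bullet> e k))"
    unfolding sq_int_def by (subst nn_integral_suminf) (auto simp: nn_integral_cmult)
  finally show ?thesis .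
qed

section \<open>Estimates for wave paths\<close>

lemma \<alpha>_nonneg [simp]: "0 \<le> \<alpha> k"
  by (rule less_imp_le[OF \<alpha>_pos])

definition forcing :: "(real \<Rightarrow> 'h) \<Rightarrow> (real \<Rightarrow> 'h) \<Rightarrow> real \<Rightarrow> 'h" where
  "forcing \<phi> \<psi> s = Q (\<psi> s) + B (\<phi> s)"

text \<open>The nonlinearity inside \<open>forcing\<close> is evaluated along the wave path. This is
  therefore the linear response to the same right-hand side, and not yet a solution of the
  semilinear heat equation.\<close>

definition heat_response :: "real \<Rightarrow> (real \<Rightarrow> 'h) \<Rightarrow> (real \<Rightarrow> 'h) \<Rightarrow> nat \<Rightarrow> real \<Rightarrow> real" where
  "heat_response T \<phi> \<psi> k t =
     (LINT s:{0..clamp_to T t}|lborel. exp (- \<alpha> k * (clamp_to T t - s)) * (forcing \<phi> \<psi> s \<bullet> e k))"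

context
  fixes \<mu> T :: real and \<phi> \<psi> :: "real \<Rightarrow> 'h"
  assumes wp: "wave_path \<mu> T \<phi> \<psi>" and \<mu>: "0 < \<mu>"
begin

lemma wave_T: "1 \<le> T" "0 \<le> T"
  using wp by (auto simp: wave_path_def)

lemma wave_phi: "continuous_on A \<phi>" "\<phi> \<in> borel_measurable borel"
  using wp unfolding wave_path_def
  by (auto intro: continuous_on_subset borel_measurable_continuous_onI)

lemma wave_psi: "\<psi> \<in> borel_measurable borel" "integrable lborel (\<lambda>s. (norm (\<psi> s))\<^sup>2)"
  using wp by (auto simp: wave_path_def)

lemma measurable_forcing: "forcing \<phi> \<psi> \<in> borel_measurable borel"
proof -
  note [measurable] = wave_phi(2) wave_psi(1)
  show ?thesis unfolding forcing_def[abs_def] by measurable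
qed

text \<open>The factor of the path term can be brought as close to \<open>g\<^sup>2\<close> as
  desired, at the expense of the control term. The contraction in \<open>wave_L2_bound\<close> lives
  on this.\<close>

lemma nn_integral_forcing_0:
  assumes \<eta>: "\<eta> > 0" and Cq: "\<And>x. norm (Q x) \<le> Cq * norm x" and g: "g \<ge> 0" "\<And>x. norm (B x) \<le> g * norm x"
  shows "path_sq T 0 (forcing \<phi> \<psi>) \<le>
    ennreal ((1 + \<eta>) * g\<^sup>2) * path_sq T 0 \<phi> +
    ennreal ((1 + 1/\<eta>) * Cq\<^sup>2) * control_sq \<psi>"
proof -
  note [measurable] = wave_phi(2) wave_psi(1)
  have pt: "ennreal ((norm (forcing \<phi> \<psi> s))\<^sup>2) \<le> ennreal ((1 + \<eta>) * g\<^sup>2) * ennreal ((norm (\<phi> s))\<^sup>2) +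
      ennreal ((1 + 1/\<eta>) * Cq\<^sup>2) * ennreal ((norm (\<psi> s))\<^sup>2)" for s
  proof -
    have "norm (forcing \<phi> \<psi> s) \<le> norm (B (\<phi> s)) + norm (Q (\<psi> s))"
      unfolding forcing_def by (metis add.commute norm_triangle_ineq)
    then have "(norm (forcing \<phi> \<psi> s))\<^sup>2 \<le> (norm (B (\<phi> s)) + norm (Q (\<psi> s)))\<^sup>2"
      by (intro power_mono) auto
    also have "\<dots> \<le> (1 + \<eta>) * (norm (B (\<phi> s)))\<^sup>2 + (1 + 1/\<eta>) * (norm (Q (\<psi> s)))\<^sup>2"
      by (rule sq_add_le[OF \<eta>])
    also have "\<dots> \<le> (1 + \<eta>) * (g * norm (\<phi> s))\<^sup>2 + (1 + 1/\<eta>) * (Cq * norm (\<psi> s))\<^sup>2"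
      using \<eta> by (intro add_mono mult_left_mono power_mono g Cq) auto
    finally show ?thesis using \<eta>
      by (simp add: power_mult_distrib mult.assoc ennreal_leI flip: ennreal_mult ennreal_plus)
  qed
  have "path_sq T 0 (forcing \<phi> \<psi>) \<le>
     (\<integral>\<^sup>+s. ennreal ((1 + \<eta>) * g\<^sup>2) * (hn 0 (\<phi> s) * indicator {0..T} s) +
        ennreal ((1 + 1/\<eta>) * Cq\<^sup>2) * ennreal ((norm (\<psi> s))\<^sup>2) \<partial>lborel)"
    using pt by (intro nn_integral_mono) (auto simp: hn_0 indicator_def)
  also have "\<dots> = ennreal ((1 + \<eta>) * g\<^sup>2) * path_sq T 0 \<phi> +
    ennreal ((1 + 1/\<eta>) * Cq\<^sup>2) * control_sq \<psi>"
    by (simp add: nn_integral_add nn_integral_cmult)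
  finally show ?thesis .
qed

lemma finite_psi: "control_sq \<psi> < \<infinity>"
  using nn_integral_eq_integral[OF wave_psi(2)] by simp

text \<open>A priori finiteness, from continuity on a compact interval; the contraction argument
  subtracts a multiple of this quantity from both sides.\<close>

lemma finite_phi_0: "path_sq T 0 \<phi> < \<infinity>"
proof -
  have "set_integrable lborel {0..T} (\<lambda>s. (norm (\<phi> s))\<^sup>2)"
    by (intro borel_integrable_atLeastAtMost' continuous_intros wave_phi)
  from sq_int_eq[OF this] show ?thesis by (simp add: hn_0 sq_int_def)
qed

lemma forcing_coeff_integrable:
  "set_integrable lborel {0..T} (\<lambda>s. forcing \<phi> \<psi> s \<bullet> e k)"
  "set_integrable lborel {0..T} (\<lambda>s. (forcing \<phi> \<psi> s \<bullet> e k)\<^sup>2)"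
proof -
  note [measurable] = measurable_forcing
  obtain Cq where Cq: "\<And>x. norm (Q x) \<le> Cq * norm x"
    using bounded_linear.bounded[OF Q] by (auto simp: mult.commute)
  \<comment> \<open>The constant \<open>\<alpha> 0\<close> in place of the Lipschitz constant is
    good enough here, as only finiteness is at stake.\<close>
  have g: "norm (B x) \<le> \<alpha> 0 * norm x" for x
  proof -
    have "ennreal ((norm (B x))\<^sup>2) \<le> ennreal ((\<alpha> 0 * norm x)\<^sup>2)"
      using hn_B[of 0 x] \<beta> by (simp add: hn_0 power_mult_distrib flip: ennreal_mult)
    then have "(norm (B x))\<^sup>2 \<le> (\<alpha> 0 * norm x)\<^sup>2" by (simp add: ennreal_le_iff)
    then show ?thesis by (rule power2_le_imp_le) (use \<alpha>_0 in \<open>simp add: less_imp_le\<close>)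
  qed
  have "path_sq T 0 (forcing \<phi> \<psi>) < \<infinity>"
    using finite_psi finite_phi_0 less_imp_le[OF \<alpha>_0]
    by (intro le_less_trans[OF nn_integral_forcing_0[OF zero_less_one Cq _ g]]) (auto simp: ennreal_mult_less_top)
  then have "(\<integral>\<^sup>+s. ennreal (norm (indicator {0..T} s *\<^sub>R (norm (forcing \<phi> \<psi> s))\<^sup>2)) \<partial>lborel) < \<infinity>"
    by (subst nn_integral_cong[of _ _ "\<lambda>s. hn 0 (forcing \<phi> \<psi> s) * indicator {0..T} s"]) (auto simp: hn_0 indicator_def)
  then have i: "integrable lborel (\<lambda>s. indicator {0..T} s *\<^sub>R (norm (forcing \<phi> \<psi> s))\<^sup>2)"
    by (intro integrableI_bounded) auto
  show 2: "set_integrable lborel {0..T} (\<lambda>s. (forcing \<phi> \<psi> s \<bullet> e k)\<^sup>2)"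
    unfolding set_integrable_def
  proof (rule Bochner_Integration.integrable_bound[OF i])
    show "AE s in lborel. norm (indicator {0..T} s *\<^sub>R (forcing \<phi> \<psi> s \<bullet> e k)\<^sup>2) \<le>
        norm (indicator {0..T} s *\<^sub>R (norm (forcing \<phi> \<psi> s))\<^sup>2)"
      using coeff_le_norm by (auto simp: indicator_def abs_le_square_iff[symmetric])
  qed measurable
  have "set_integrable lborel {0..T} (\<lambda>s. indicator {0..T} s * (forcing \<phi> \<psi> s \<bullet> e k))"
  proof (rule set_integrable_square_imp)
    have "(\<lambda>s. indicator {0..T} s *\<^sub>R (forcing \<phi> \<psi> s \<bullet> e k)\<^sup>2) = (\<lambda>s. (norm (indicator {0..T} s * (forcing \<phi> \<psi> s \<bullet> e k)))\<^sup>2)"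
      by (auto simp: indicator_def)
    with 2 show "integrable lborel (\<lambda>s. (norm (indicator {0..T} s * (forcing \<phi> \<psi> s \<bullet> e k)))\<^sup>2)"
      by (simp add: set_integrable_def)
  qed measurable
  then show "set_integrable lborel {0..T} (\<lambda>s. forcing \<phi> \<psi> s \<bullet> e k)"
    unfolding set_integrable_def by (rule Bochner_Integration.integrable_cong[OF refl, THEN iffD1, rotated]) (auto simp: indicator_def)
qed

lemma continuous_heat_response: "continuous_on A (heat_response T \<phi> \<psi> k)"
  unfolding heat_response_def
  by (rule continuous_on_clamp_to[OF heat_mode_primitive(1)[OF forcing_coeff_integrable(1), where t=0] wave_T(2)])
    (use wave_T in auto)

lemma measurable_heat_response: "heat_response T \<phi> \<psi> k \<in> borel_measurable borel"
  by (rule borel_measurable_continuous_onI[OF continuous_heat_response])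

text \<open>\<open>mode_estimates\<close> with constants made uniform in \<open>k\<close> through
  \<open>\<alpha> 0 \<le> \<alpha> k\<close>. Only the endpoint error in the last bound keeps a
  factor that grows with \<open>k\<close>; it is usable on finitely many modes.\<close>

lemma wave_mode_estimates:
  fixes k :: nat
  defines "F \<equiv> sq_int T (\<lambda>s. forcing \<phi> \<psi> s \<bullet> e k)"
  shows "ennreal (\<alpha> k * (\<phi> T \<bullet> e k)\<^sup>2) \<le> F"
    and "ennreal (\<alpha> k) * sq_int T (\<lambda>s. \<phi> s \<bullet> e k) \<le> ennreal (1 / \<alpha> 0 + 5 * \<mu> / 2) * F"
    and "sq_int T (heat_response T \<phi> \<psi> k) \<le> ennreal (1 / (\<alpha> 0)\<^sup>2) * F"
    and "sq_int T (\<lambda>s. \<phi> s \<bullet> e k - heat_response T \<phi> \<psi> k s) \<le> ennreal (\<mu>\<^sup>2) * F"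
    and "ennreal ((\<phi> T \<bullet> e k - heat_response T \<phi> \<psi> k T)\<^sup>2) \<le> ennreal (\<alpha> k * \<mu>\<^sup>2 + \<mu>) * F"
proof -
  define u where "u = (\<lambda>s. \<phi> s \<bullet> e k)"
  define f where "f = (\<lambda>s. forcing \<phi> \<psi> s \<bullet> e k)"
  define y where "y = (\<lambda>t. LINT s:{0..t}|lborel. exp (- \<alpha> k * (t - s)) * f s)"
  define N where "N = (LINT s:{0..T}|lborel. (f s)\<^sup>2)"
  obtain w where w: "set_integrable lborel {0..T} w" "\<And>t. t \<in> {0..T} \<Longrightarrow> u t = (LINT s:{0..t}|lborel. w s)"
    "\<And>t. t \<in> {0..T} \<Longrightarrow> w t = (LINT s:{0..t}|lborel. (f s - w s - \<alpha> k * u s) / \<mu>)"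
    using wp unfolding wave_path_def u_def f_def forcing_def by blast
  have f: "set_integrable lborel {0..T} f" "set_integrable lborel {0..T} (\<lambda>s. (f s)\<^sup>2)"
    unfolding f_def by (rule forcing_coeff_integrable)+
  note m = mode_estimates[OF wave_T(2) \<mu> \<alpha>_pos f w(1), of u, folded N_def]
  have m1: "\<alpha> k * (u T)\<^sup>2 \<le> N / 2"
    by (rule m(1)) (erule w(2), erule w(3))
  have m2: "\<alpha> k * (LINT s:{0..T}|lborel. (u s)\<^sup>2) \<le> (1 / \<alpha> k + 5 * \<mu> / 2) * N"
    by (rule m(2)) (erule w(2), erule w(3))
  have m3: "(\<alpha> k)\<^sup>2 * (LINT s:{0..T}|lborel. (y s)\<^sup>2) \<le> N"
    unfolding y_def by (rule m(3)) (erule w(2), erule w(3))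
  have m4: "(LINT s:{0..T}|lborel. (u s - y s)\<^sup>2) \<le> \<mu>\<^sup>2 * N"
    unfolding y_def by (rule m(4)) (erule w(2), erule w(3))
  have m5: "(u T - y T)\<^sup>2 \<le> (\<alpha> k * \<mu>\<^sup>2 + \<mu>) * N"
    unfolding y_def by (rule m(5)) (erule w(2), erule w(3))
  have F: "F = ennreal N" unfolding F_def N_def f_def by (rule sq_int_eq[OF forcing_coeff_integrable(2)])
  have N0: "0 \<le> N" unfolding N_def set_lebesgue_integral_def by (rule Bochner_Integration.integral_nonneg) (auto simp: indicator_def)
  have yh: "heat_response T \<phi> \<psi> k s = y s" if "s \<in> {0..T}" for s
    using that by (simp add: heat_response_def y_def f_def)
  have uc: "continuous_on {0..T} u" unfolding u_def by (intro continuous_intros wave_phi)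
  have yc: "continuous_on {0..T} y"
    using heat_mode_primitive(1)[OF f(1), where t=0 and a="\<alpha> k"] wave_T by (simp add: y_def)
  have Ju: "sq_int T u = ennreal (LINT s:{0..T}|lborel. (u s)\<^sup>2)"
    by (intro sq_int_eq borel_integrable_atLeastAtMost' continuous_intros uc)
  have Jy: "sq_int T (heat_response T \<phi> \<psi> k) = ennreal (LINT s:{0..T}|lborel. (y s)\<^sup>2)"
    by (subst sq_int_cong[OF yh], assumption) (intro sq_int_eq borel_integrable_atLeastAtMost' continuous_intros yc)
  have Jd: "sq_int T (\<lambda>s. u s - heat_response T \<phi> \<psi> k s) = ennreal (LINT s:{0..T}|lborel. (u s - y s)\<^sup>2)"
    by (subst sq_int_cong[where h="\<lambda>s. u s - y s"])
      (auto simp: yh intro!: sq_int_eq borel_integrable_atLeastAtMost' continuous_intros uc yc)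
  show "ennreal (\<alpha> k * (\<phi> T \<bullet> e k)\<^sup>2) \<le> F"
    unfolding F using m1 N0 by (intro ennreal_leI) (simp add: u_def)
  have "1 / \<alpha> k \<le> 1 / \<alpha> 0" using \<alpha>_ge[of k] \<alpha>_0 by (simp add: frac_le)
  then have "(1 / \<alpha> k + 5 * \<mu> / 2) * N \<le> (1 / \<alpha> 0 + 5 * \<mu> / 2) * N" using N0 by (intro mult_right_mono) auto
  then show "ennreal (\<alpha> k) * sq_int T (\<lambda>s. \<phi> s \<bullet> e k) \<le> ennreal (1 / \<alpha> 0 + 5 * \<mu> / 2) * F"
    unfolding F Ju[unfolded u_def] using m2 N0 \<mu> \<alpha>_0 unfolding u_def
    by (intro ennreal_mult_leI) (auto simp: less_imp_le)
  have "(\<alpha> 0)\<^sup>2 \<le> (\<alpha> k)\<^sup>2" using \<alpha>_ge[of k] \<alpha>_0 by (intro power_mono) auto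
  moreover have "0 \<le> (LINT s:{0..T}|lborel. (y s)\<^sup>2)"
    unfolding set_lebesgue_integral_def by (rule Bochner_Integration.integral_nonneg) (auto simp: indicator_def)
  ultimately have "(\<alpha> 0)\<^sup>2 * (LINT s:{0..T}|lborel. (y s)\<^sup>2) \<le> N"
    using m3 by (meson mult_right_mono order_trans)
  then have "(LINT s:{0..T}|lborel. (y s)\<^sup>2) \<le> 1 / (\<alpha> 0)\<^sup>2 * N" using \<alpha>_0 by (simp add: field_simps)
  then show "sq_int T (heat_response T \<phi> \<psi> k) \<le> ennreal (1 / (\<alpha> 0)\<^sup>2) * F"
    unfolding Jy F using N0 by (simp add: ennreal_leI flip: ennreal_mult)
  show "sq_int T (\<lambda>s. \<phi> s \<bullet> e k - heat_response T \<phi> \<psi> k s) \<le> ennreal (\<mu>\<^sup>2) * F"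
    using m4 Jd unfolding F u_def using N0 by (simp add: ennreal_leI flip: ennreal_mult)
  show "ennreal ((\<phi> T \<bullet> e k - heat_response T \<phi> \<psi> k T)\<^sup>2) \<le> ennreal (\<alpha> k * \<mu>\<^sup>2 + \<mu>) * F"
    using ennreal_mult_leI[of 1 "(u T - y T)\<^sup>2" "\<alpha> k * \<mu>\<^sup>2 + \<mu>" N] m5 \<mu> wave_T yh[of T] unfolding F u_def
    by (simp add: less_imp_le del: ennreal_plus)
qed

lemma wave_smoothing:
  "path_sq T (\<tau> + 1) \<phi> \<le>
    ennreal (1 / \<alpha> 0 + 5 * \<mu> / 2) * path_sq T \<tau> (forcing \<phi> \<psi>)"
  unfolding nn_integral_hn[OF wave_phi(2)] nn_integral_hn[OF measurable_forcing] ennreal_suminf_cmult[symmetric]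
proof (intro ennreal_suminf_mono)
  fix k
  have "ennreal (\<alpha> k powr (\<tau> + 1)) * sq_int T (\<lambda>s. \<phi> s \<bullet> e k) = ennreal (\<alpha> k powr \<tau>) * (ennreal (\<alpha> k) * sq_int T (\<lambda>s. \<phi> s \<bullet> e k))"
    by (simp add: powr_add less_imp_le ennreal_mult mult.assoc)
  also have "\<dots> \<le> ennreal (\<alpha> k powr \<tau>) * (ennreal (1 / \<alpha> 0 + 5 * \<mu> / 2) * sq_int T (\<lambda>s. forcing \<phi> \<psi> s \<bullet> e k))"
    by (intro mult_left_mono wave_mode_estimates) simp
  finally show "ennreal (\<alpha> k powr (\<tau> + 1)) * sq_int T (\<lambda>s. \<phi> s \<bullet> e k) \<le>
     ennreal (1 / \<alpha> 0 + 5 * \<mu> / 2) * (ennreal (\<alpha> k powr \<tau>) * sq_int T (\<lambda>s. forcing \<phi> \<psi> s \<bullet> e k))"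
    by (simp add: mult.left_commute)
qed

text \<open>The potential energy at the final time supplies one derivative without any integration
  in time.\<close>

lemma wave_endpoint:
  "hn (\<tau> + 1) (\<phi> T) \<le> path_sq T \<tau> (forcing \<phi> \<psi>)"
  unfolding hn_def[of _ "\<phi> T"] nn_integral_hn[OF measurable_forcing]
proof (intro ennreal_suminf_mono)
  fix k
  have "ennreal (\<alpha> k powr (\<tau> + 1)) * ennreal ((\<phi> T \<bullet> e k)\<^sup>2) = ennreal (\<alpha> k powr \<tau>) * ennreal (\<alpha> k * (\<phi> T \<bullet> e k)\<^sup>2)"
    by (simp add: powr_add less_imp_le mult.assoc flip: ennreal_mult)
  also have "\<dots> \<le> ennreal (\<alpha> k powr \<tau>) * sq_int T (\<lambda>s. forcing \<phi> \<psi> s \<bullet> e k)"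
    by (intro mult_left_mono wave_mode_estimates) simp
  finally show "ennreal (\<alpha> k powr (\<tau> + 1)) * ennreal ((\<phi> T \<bullet> e k)\<^sup>2) \<le> ennreal (\<alpha> k powr \<tau>) * sq_int T (\<lambda>s. forcing \<phi> \<psi> s \<bullet> e k)" .
qed

text \<open>The maximum with 0 appears because \<open>B\<close> is Lipschitz on spaces of
  nonnegative index. For negative \<tau> it is estimated in H, which embeds into the larger
  space.\<close>

lemma nn_integral_forcing:
  assumes \<tau>: "\<tau> \<le> 2*\<beta>"
  shows "path_sq T \<tau> (forcing \<phi> \<psi>) \<le>
    ennreal (2 * (c\<^sup>2 * \<alpha> 0 powr (\<tau> - 2*\<beta>))) * control_sq \<psi> +
    ennreal (2 * \<alpha> 0 powr (\<tau> - max \<tau> 0) * (\<alpha> 0)\<^sup>2) * path_sq T (max \<tau> 0) \<phi>"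
proof -
  note [measurable] = wave_phi(2) wave_psi(1)
  have pt: "hn \<tau> (forcing \<phi> \<psi> s) \<le> ennreal (2 * (c\<^sup>2 * \<alpha> 0 powr (\<tau> - 2*\<beta>))) * ennreal ((norm (\<psi> s))\<^sup>2) +
      ennreal (2 * \<alpha> 0 powr (\<tau> - max \<tau> 0) * (\<alpha> 0)\<^sup>2) * hn (max \<tau> 0) (\<phi> s)" for s
  proof -
    have "hn \<tau> (forcing \<phi> \<psi> s) \<le> 2 * hn \<tau> (Q (\<psi> s)) + 2 * hn \<tau> (B (\<phi> s))"
      unfolding forcing_def by (rule hn_add_le)
    also have "hn \<tau> (Q (\<psi> s)) \<le> ennreal (c\<^sup>2 * \<alpha> 0 powr (\<tau> - 2*\<beta>)) * ennreal ((norm (\<psi> s))\<^sup>2)"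
      using hn_Q[OF \<tau>] by (simp add: hn_0)
    also have "hn \<tau> (B (\<phi> s)) \<le> ennreal (\<alpha> 0 powr (\<tau> - max \<tau> 0)) * hn (max \<tau> 0) (B (\<phi> s))"
      by (rule hn_mono) simp
    also have "hn (max \<tau> 0) (B (\<phi> s)) \<le> ennreal ((\<alpha> 0)\<^sup>2) * hn (max \<tau> 0) (\<phi> s)"
      by (rule hn_B) (use \<tau> \<beta> in auto)
    finally show ?thesis by (simp add: mult_left_mono add_mono ennreal_mult mult.assoc)
  qed
  have "path_sq T \<tau> (forcing \<phi> \<psi>) \<le>
     (\<integral>\<^sup>+s. ennreal (2 * (c\<^sup>2 * \<alpha> 0 powr (\<tau> - 2*\<beta>))) * ennreal ((norm (\<psi> s))\<^sup>2) +
        ennreal (2 * \<alpha> 0 powr (\<tau> - max \<tau> 0) * (\<alpha> 0)\<^sup>2) * (hn (max \<tau> 0) (\<phi> s) * indicator {0..T} s) \<partial>lborel)"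
    using pt by (intro nn_integral_mono) (auto simp: indicator_def)
  also have "\<dots> = ennreal (2 * (c\<^sup>2 * \<alpha> 0 powr (\<tau> - 2*\<beta>))) * control_sq \<psi> +
    ennreal (2 * \<alpha> 0 powr (\<tau> - max \<tau> 0) * (\<alpha> 0)\<^sup>2) * path_sq T (max \<tau> 0) \<phi>"
    by (simp add: nn_integral_add nn_integral_cmult)
  finally show ?thesis .
qed

text \<open>Each mode is split into its heat response, bounded with 1 / \<alpha> 0, and the distance
  to it, bounded with \<mu>. For small \<mu> the factor is thus nearly that of the heat
  equation.\<close>

lemma wave_L2_contraction:
  assumes \<eta>: "\<eta> > 0"
  shows "path_sq T 0 \<phi> \<le>
    ennreal ((1 + \<eta>) / (\<alpha> 0)\<^sup>2 + (1 + 1/\<eta>) * \<mu>\<^sup>2) * path_sq T 0 (forcing \<phi> \<psi>)"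
  unfolding nn_integral_hn[OF wave_phi(2)] nn_integral_hn[OF measurable_forcing] ennreal_suminf_cmult[symmetric]
proof (intro ennreal_suminf_mono)
  fix k
  let ?y = "heat_response T \<phi> \<psi> k" and ?F = "sq_int T (\<lambda>s. forcing \<phi> \<psi> s \<bullet> e k)"
  note [measurable] = wave_phi(2) measurable_heat_response
  have "sq_int T (\<lambda>s. \<phi> s \<bullet> e k) = sq_int T (\<lambda>s. ?y s + (\<phi> s \<bullet> e k - ?y s))" by simp
  also have "\<dots> \<le> ennreal (1 + \<eta>) * sq_int T ?y + ennreal (1 + 1/\<eta>) * sq_int T (\<lambda>s. \<phi> s \<bullet> e k - ?y s)"
    by (rule sq_int_add_le[OF _ _ \<eta>]) measurable
  also have "\<dots> \<le> ennreal (1 + \<eta>) * (ennreal (1 / (\<alpha> 0)\<^sup>2) * ?F) + ennreal (1 + 1/\<eta>) * (ennreal (\<mu>\<^sup>2) * ?F)"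
    by (intro add_mono mult_left_mono wave_mode_estimates) auto
  also have "\<dots> = ennreal ((1 + \<eta>) * (1 / (\<alpha> 0)\<^sup>2) + (1 + 1/\<eta>) * \<mu>\<^sup>2) * ?F"
  proof -
    have nn: "0 \<le> 1 + \<eta>" "0 \<le> 1 + 1/\<eta>" "0 \<le> 1 / (\<alpha> 0)\<^sup>2" using \<eta> by auto
    show ?thesis
      by (subst ennreal_plus[OF mult_nonneg_nonneg[OF nn(1,3)] mult_nonneg_nonneg[OF nn(2) zero_le_power2]])
        (simp only: ennreal_mult[OF nn(1,3)] ennreal_mult[OF nn(2) zero_le_power2] distrib_right[where 'a=ennreal] mult.assoc)
  qed
  finally show "ennreal (\<alpha> k powr 0) * sq_int T (\<lambda>s. \<phi> s \<bullet> e k) \<le>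
     ennreal ((1 + \<eta>) / (\<alpha> 0)\<^sup>2 + (1 + 1/\<eta>) * \<mu>\<^sup>2) * (ennreal (\<alpha> k powr 0) * ?F)"
    by simp
qed

end

text \<open>Small gain: the forcing carries the factor (1+\<eta>) g^2 and the response (1+\<eta>) /
  (\<alpha> 0)^2 + O(\<mu>^2). Since g < \<alpha> 0, their product stays below 1 for small \<eta>
  and \<mu>, and the path term is absorbed.\<close>

lemma wave_L2_bound:
  "\<exists>\<mu>0>0. \<mu>0 \<le> 1 \<and> (\<exists>C\<ge>0. \<forall>\<mu> T \<phi> \<psi>. 0 < \<mu> \<longrightarrow> \<mu> \<le> \<mu>0 \<longrightarrow> wave_path \<mu> T \<phi> \<psi> \<longrightarrow>
     path_sq T 0 \<phi> \<le> ennreal C * control_sq \<psi>)"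
proof -
  obtain Cq where Cq: "\<And>x. norm (Q x) \<le> Cq * norm x"
    using bounded_linear.bounded[OF Q] by (auto simp: mult.commute)
  define g where "g = max (\<gamma> 0) 0"
  have zero: "0 \<in> {0..1 + 2*\<beta>}" using \<beta> by simp
  have g: "0 \<le> g" "g < \<alpha> 0" using \<gamma>[OF zero] \<alpha>_0 by (auto simp: g_def)
  have gB: "norm (B x) \<le> g * norm x" for x
  proof -
    have "x \<in> Hspace e \<alpha> 0" for x using summable_coeff by (simp add: Hspace_def)
    moreover have "Hnorm e \<alpha> 0 x = norm x" for x using parseval by (simp add: Hnorm_def)
    ultimately have "norm (B x - B 0) \<le> \<gamma> 0 * norm (x - 0)"
      using B_lip[OF zero] unfolding Hlipschitz_def by metis
    also have "\<dots> \<le> g * norm (x - 0)" by (rule mult_right_mono) (auto simp: g_def)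
    finally show ?thesis by (simp add: B_0)
  qed
  define \<rho> where "\<rho> = g\<^sup>2 / (\<alpha> 0)\<^sup>2"
  have \<rho>: "0 \<le> \<rho>" "\<rho> < 1"
    using g \<alpha>_0 by (auto simp: \<rho>_def divide_less_eq power_strict_mono)
  \<comment> \<open>As \<eta> is at most 1/4, (1+\<eta>)^2 is at most 1 + 3\<eta>, and \<rho> grows
    by at most 3/4 of its distance to 1.\<close>
  define \<eta> where "\<eta> = (1 - \<rho>) / 4"
  have \<eta>: "0 < \<eta>" "\<eta> \<le> 1/4" using \<rho> by (auto simp: \<eta>_def)
  have \<theta>0: "(1 + \<eta>)\<^sup>2 * \<rho> < 1"
  proof -
    have "\<eta>\<^sup>2 \<le> \<eta> * (1/4)" unfolding power2_eq_square using \<eta> by (intro mult_left_mono) auto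
    then have "(1 + \<eta>)\<^sup>2 \<le> 1 + 3 * \<eta>" using \<eta> by (simp add: power2_eq_square algebra_simps)
    then have "(1 + \<eta>)\<^sup>2 * \<rho> \<le> (1 + 3 * \<eta>) * \<rho>" using \<rho> by (intro mult_right_mono) auto
    also have "\<dots> = \<rho> + 3/4 * ((1 - \<rho>) * \<rho>)" by (simp add: \<eta>_def algebra_simps)
    also have "(1 - \<rho>) * \<rho> \<le> (1 - \<rho>) * 1" using \<rho> by (intro mult_left_mono) auto
    also have "\<rho> + 3/4 * ((1 - \<rho>) * 1) < 1" using \<rho> by (simp add: field_simps)
    finally show ?thesis by simp
  qed
  define \<delta> where "\<delta> = (1 - (1 + \<eta>)\<^sup>2 * \<rho>) / 2"
  have \<delta>: "0 < \<delta>" using \<theta>0 by (simp add: \<delta>_def)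
  define A where "A = (1 + 1/\<eta>) * ((1 + \<eta>) * g\<^sup>2)"
  have A: "0 \<le> A" using \<eta> by (simp add: A_def)
  \<comment> \<open>Half of the remaining room, \<delta>, is reserved for the \<mu>^2 term
    \<open>A * \<mu>\<^sup>2\<close>; the bound \<open>\<mu>0 \<le> 1\<close> allows replacing
    \<mu>^2 by \<mu>.\<close>
  define \<mu>0 where "\<mu>0 = min 1 (\<delta> / (A + 1))"
  have \<mu>0: "0 < \<mu>0" "\<mu>0 \<le> 1" using \<delta> A by (auto simp: \<mu>0_def)
  define K where "K = ((1 + \<eta>) / (\<alpha> 0)\<^sup>2 + (1 + 1/\<eta>)) * ((1 + 1/\<eta>) * Cq\<^sup>2)"
  have K: "0 \<le> K" using \<eta> by (simp add: K_def)
  have "path_sq T 0 \<phi> \<le> ennreal (K / \<delta>) * control_sq \<psi>"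
    if \<mu>: "0 < \<mu>" "\<mu> \<le> \<mu>0" and wp: "wave_path \<mu> T \<phi> \<psi>" for \<mu> T \<phi> \<psi>
  proof -
    obtain n where n: "path_sq T 0 \<phi> = ennreal n" "0 \<le> n"
      using finite_phi_0[OF wp \<mu>(1)] by (metis ennreal_cases infinity_ennreal_def less_irrefl)
    obtain r where r: "control_sq \<psi> = ennreal r" "0 \<le> r"
      using finite_psi[OF wp \<mu>(1)] by (metis ennreal_cases infinity_ennreal_def less_irrefl)
    define a where "a = (1 + \<eta>) / (\<alpha> 0)\<^sup>2 + (1 + 1/\<eta>) * \<mu>\<^sup>2"
    have a: "0 \<le> a" using \<eta> by (simp add: a_def)
    have "ennreal n \<le> ennreal a * (ennreal ((1 + \<eta>) * g\<^sup>2) * ennreal n + ennreal ((1 + 1/\<eta>) * Cq\<^sup>2) * ennreal r)"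
      unfolding n(1)[symmetric] r(1)[symmetric] a_def
      by (rule order_trans[OF wave_L2_contraction[OF wp \<mu>(1) \<eta>(1)]])
        (intro mult_left_mono nn_integral_forcing_0[OF wp \<mu>(1) \<eta>(1) Cq g(1) gB] zero_le)
    also have "\<dots> = ennreal (a * ((1 + \<eta>) * g\<^sup>2 * n + (1 + 1/\<eta>) * Cq\<^sup>2 * r))"
    proof -
      have nn: "0 \<le> (1 + \<eta>) * g\<^sup>2" "0 \<le> (1 + 1/\<eta>) * Cq\<^sup>2" using \<eta> by auto
      show ?thesis
        by (simp only: ennreal_mult[OF nn(1) n(2), symmetric] ennreal_mult[OF nn(2) r(2), symmetric]
            ennreal_plus[OF mult_nonneg_nonneg[OF nn(1) n(2)] mult_nonneg_nonneg[OF nn(2) r(2)], symmetric] ennreal_mult'[OF a, symmetric])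
    qed
    finally have "n \<le> a * ((1 + \<eta>) * g\<^sup>2 * n + (1 + 1/\<eta>) * Cq\<^sup>2 * r)"
      using a n r \<eta> by (subst (asm) ennreal_le_iff) auto
    then have 1: "n \<le> (a * ((1 + \<eta>) * g\<^sup>2)) * n + (a * ((1 + 1/\<eta>) * Cq\<^sup>2)) * r" by (simp add: algebra_simps)
    have \<mu>2: "\<mu>\<^sup>2 \<le> \<mu>0" "\<mu>\<^sup>2 \<le> 1"
    proof -
      have "\<mu>\<^sup>2 \<le> \<mu> * 1" unfolding power2_eq_square using \<mu> \<mu>0 by (intro mult_left_mono) auto
      then show "\<mu>\<^sup>2 \<le> \<mu>0" "\<mu>\<^sup>2 \<le> 1" using \<mu> \<mu>0 by auto
    qed
    have "A * \<mu>\<^sup>2 \<le> (A + 1) * (\<delta> / (A + 1))"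
      using \<mu>2 A by (intro mult_mono) (auto simp: \<mu>0_def)
    also have "(A + 1) * (\<delta> / (A + 1)) = \<delta>" using A by simp
    finally have A\<mu>: "A * \<mu>\<^sup>2 \<le> \<delta>" .
    have "a * ((1 + \<eta>) * g\<^sup>2) = (1 + \<eta>)\<^sup>2 * \<rho> + A * \<mu>\<^sup>2"
      by (simp add: a_def A_def \<rho>_def power2_eq_square algebra_simps add_divide_distrib)
    also have "\<dots> \<le> 1 - \<delta>" using A\<mu> by (simp add: \<delta>_def field_simps)
    finally have "(a * ((1 + \<eta>) * g\<^sup>2)) * n \<le> (1 - \<delta>) * n" using n by (intro mult_right_mono)
    moreover have "a \<le> (1 + \<eta>) / (\<alpha> 0)\<^sup>2 + (1 + 1/\<eta>)"
      using mult_left_mono[OF \<mu>2(2), of "1 + 1/\<eta>"] \<eta> by (simp add: a_def)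
    then have "(a * ((1 + 1/\<eta>) * Cq\<^sup>2)) * r \<le> K * r"
      unfolding K_def using \<eta> r by (intro mult_right_mono) auto
    ultimately have "\<delta> * n \<le> K * r" using 1 by (simp add: algebra_simps)
    then have "n \<le> K / \<delta> * r" using \<delta> by (simp add: field_simps)
    then show ?thesis unfolding n r using K \<delta> r by (simp add: ennreal_leI flip: ennreal_mult)
  qed
  then show ?thesis
    using \<mu>0 K \<delta> by (intro exI[of _ \<mu>0] conjI exI[of _ "K / \<delta>"]) auto
qed

text \<open>Each application of \<open>nn_integral_forcing\<close> and \<open>wave_smoothing\<close> gains one derivative.\<close>

lemma wave_bounds:
  obtains \<mu>0 C where "0 < \<mu>0" "0 \<le> C"
    "\<And>\<mu> T \<phi> \<psi>. 0 < \<mu> \<Longrightarrow> \<mu> \<le> \<mu>0 \<Longrightarrow> wave_path \<mu> T \<phi> \<psi> \<Longrightarrow>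
       path_sq T (2*\<beta>) (forcing \<phi> \<psi>) \<le> ennreal C * control_sq \<psi>"
    "\<And>\<mu> T \<phi> \<psi>. 0 < \<mu> \<Longrightarrow> \<mu> \<le> \<mu>0 \<Longrightarrow> wave_path \<mu> T \<phi> \<psi> \<Longrightarrow>
       path_sq T (1 + 2*\<beta>) \<phi> \<le> ennreal C * control_sq \<psi>"
proof -
  obtain \<mu>0 C0 where \<mu>0: "0 < \<mu>0" "\<mu>0 \<le> 1" and C0: "C0 \<ge> 0"
    "\<And>\<mu> T \<phi> \<psi>. 0 < \<mu> \<Longrightarrow> \<mu> \<le> \<mu>0 \<Longrightarrow> wave_path \<mu> T \<phi> \<psi> \<Longrightarrow>
     path_sq T 0 \<phi> \<le> ennreal C0 * control_sq \<psi>"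
    using wave_L2_bound by blast
  define good where "good = (\<lambda>\<delta>. \<exists>C\<ge>0. \<forall>\<mu> T \<phi> \<psi>. 0 < \<mu> \<longrightarrow> \<mu> \<le> \<mu>0 \<longrightarrow> wave_path \<mu> T \<phi> \<psi> \<longrightarrow>
     path_sq T \<delta> \<phi> \<le> ennreal C * control_sq \<psi>)"
  have force: "\<exists>C\<ge>0. \<forall>\<mu> T \<phi> \<psi>. 0 < \<mu> \<longrightarrow> \<mu> \<le> \<mu>0 \<longrightarrow> wave_path \<mu> T \<phi> \<psi> \<longrightarrow>
     path_sq T \<tau> (forcing \<phi> \<psi>) \<le> ennreal C * control_sq \<psi>"
    if \<tau>: "\<tau> \<le> 2*\<beta>" and "good (max \<tau> 0)" for \<tau>
  proof -
    obtain C where C: "C \<ge> 0" "\<And>\<mu> T \<phi> \<psi>. 0 < \<mu> \<Longrightarrow> \<mu> \<le> \<mu>0 \<Longrightarrow> wave_path \<mu> T \<phi> \<psi> \<Longrightarrow>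
       path_sq T (max \<tau> 0) \<phi> \<le> ennreal C * control_sq \<psi>"
      using \<open>good (max \<tau> 0)\<close> unfolding good_def by blast
    define a b where "a = 2 * (c\<^sup>2 * \<alpha> 0 powr (\<tau> - 2*\<beta>))" and "b = 2 * \<alpha> 0 powr (\<tau> - max \<tau> 0) * (\<alpha> 0)\<^sup>2"
    have ab: "0 \<le> a" "0 \<le> b" by (auto simp: a_def b_def)
    have "path_sq T \<tau> (forcing \<phi> \<psi>) \<le> ennreal (a + b * C) * control_sq \<psi>"
      if \<mu>: "0 < \<mu>" "\<mu> \<le> \<mu>0" and wp: "wave_path \<mu> T \<phi> \<psi>" for \<mu> T \<phi> \<psi>
    proof -
      have "path_sq T \<tau> (forcing \<phi> \<psi>) \<le>
          ennreal a * control_sq \<psi> + ennreal b * path_sq T (max \<tau> 0) \<phi>"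
        unfolding a_def b_def by (rule nn_integral_forcing[OF wp \<mu>(1) \<tau>])
      also have "\<dots> \<le> ennreal a * control_sq \<psi> + ennreal b * (ennreal C * control_sq \<psi>)"
        by (intro add_left_mono mult_left_mono C(2)[OF \<mu> wp] zero_le)
      also have "\<dots> = ennreal (a + b * C) * control_sq \<psi>"
        using ab C(1) by (simp add: ennreal_mult distrib_right[where 'a=ennreal] mult.assoc)
      finally show ?thesis .
    qed
    then show ?thesis using ab C(1) by (intro exI[of _ "a + b * C"]) auto
  qed
  \<comment> \<open>Induction over unit steps that also reaches the non-integer top index: the index
    \<open>\<delta>\<close> needs a bound at \<open>max (\<delta> - 1) 0\<close>, which is at most
    \<open>n\<close> and still in the admissible range.\<close>
  have "\<forall>\<delta>\<in>{0..1 + 2*\<beta>}. \<delta> \<le> real n \<longrightarrow> good \<delta>" for n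
  proof (induction n)
    case 0
    have "good 0" unfolding good_def using C0 by blast
    then show ?case by auto
  next
    case (Suc n)
    show ?case
    proof (intro ballI impI)
      fix \<delta> assume \<delta>: "\<delta> \<in> {0..1 + 2*\<beta>}" "\<delta> \<le> real (Suc n)"
      show "good \<delta>"
      proof (cases "\<delta> \<le> real n")
        case True
        then show ?thesis using Suc.IH \<delta> by blast
      next
        case False
        define \<tau> where "\<tau> = \<delta> - 1"
        have \<tau>: "\<tau> \<le> 2*\<beta>" using \<delta> by (simp add: \<tau>_def)
        have "good (max \<tau> 0)" using Suc.IH \<delta> \<tau> \<beta> by (auto simp: \<tau>_def)
        from force[OF \<tau> this] obtain C where C: "C \<ge> 0"
          "\<And>\<mu> T \<phi> \<psi>. 0 < \<mu> \<Longrightarrow> \<mu> \<le> \<mu>0 \<Longrightarrow> wave_path \<mu> T \<phi> \<psi> \<Longrightarrow>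
            path_sq T \<tau> (forcing \<phi> \<psi>) \<le> ennreal C * control_sq \<psi>"
          by blast
        have "path_sq T \<delta> \<phi> \<le> ennreal ((1 / \<alpha> 0 + 5/2) * C) * control_sq \<psi>"
          if \<mu>: "0 < \<mu>" "\<mu> \<le> \<mu>0" and wp: "wave_path \<mu> T \<phi> \<psi>" for \<mu> T \<phi> \<psi>
        proof -
          have "path_sq T \<delta> \<phi> \<le>
              ennreal (1 / \<alpha> 0 + 5 * \<mu> / 2) * path_sq T \<tau> (forcing \<phi> \<psi>)"
            using wave_smoothing[OF wp \<mu>(1), of \<tau>] by (simp add: \<tau>_def)
          also have "\<dots> \<le> ennreal (1 / \<alpha> 0 + 5/2) * (ennreal C * control_sq \<psi>)"
            using \<mu> \<mu>0 by (intro mult_mono C(2)[OF \<mu> wp] ennreal_leI) auto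
          also have "\<dots> = ennreal ((1 / \<alpha> 0 + 5/2) * C) * control_sq \<psi>"
            using C(1) \<alpha>_0 by (subst ennreal_mult) (auto simp: mult.assoc)
          finally show ?thesis .
        qed
        then show ?thesis using C(1) unfolding good_def
          by (intro exI[of _ "(1 / \<alpha> 0 + 5/2) * C"]) auto
      qed
    qed
  qed
  then have good: "good \<delta>" if "\<delta> \<in> {0..1 + 2*\<beta>}" for \<delta>
    using real_arch_simple[of \<delta>] that by blast
  obtain C1 where C1: "C1 \<ge> 0" "\<And>\<mu> T \<phi> \<psi>. 0 < \<mu> \<Longrightarrow> \<mu> \<le> \<mu>0 \<Longrightarrow> wave_path \<mu> T \<phi> \<psi> \<Longrightarrow>
      path_sq T (2*\<beta>) (forcing \<phi> \<psi>) \<le> ennreal C1 * control_sq \<psi>"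
    using force[OF order_refl good] \<beta> by auto
  obtain C2 where C2: "C2 \<ge> 0" "\<And>\<mu> T \<phi> \<psi>. 0 < \<mu> \<Longrightarrow> \<mu> \<le> \<mu>0 \<Longrightarrow> wave_path \<mu> T \<phi> \<psi> \<Longrightarrow>
      path_sq T (1 + 2*\<beta>) \<phi> \<le> ennreal C2 * control_sq \<psi>"
    using good[of "1 + 2*\<beta>"] \<beta> unfolding good_def by auto
  show ?thesis
  proof (rule that[of \<mu>0 "max C1 C2"])
    fix \<mu> T \<phi> \<psi> assume h: "0 < \<mu>" "\<mu> \<le> \<mu>0" "wave_path \<mu> T \<phi> \<psi>"
    show "path_sq T (2*\<beta>) (forcing \<phi> \<psi>) \<le> ennreal (max C1 C2) * control_sq \<psi>"
      by (rule order_trans[OF C1(2)[OF h]]) (intro mult_right_mono ennreal_leI, auto)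
    show "path_sq T (1 + 2*\<beta>) \<phi> \<le> ennreal (max C1 C2) * control_sq \<psi>"
      by (rule order_trans[OF C2(2)[OF h]]) (intro mult_right_mono ennreal_leI, auto)
  qed (use \<mu>0 C1 in auto)
qed

section \<open>Heat paths with prescribed endpoint\<close>

lemma lam_neq_0 [simp]: "lam k \<noteq> 0"
  using lam_pos[of k] by linarith

text \<open>For \<open>k < K\<close> the coefficient is the endpoint error of the heat response, for
  \<open>k \<ge> K\<close> it is the coefficient of \<open>x\<close>, because the path followed so
  far has none.\<close>

definition endpoint_gap :: "'h \<Rightarrow> nat \<Rightarrow> real \<Rightarrow> (real \<Rightarrow> 'h) \<Rightarrow> (real \<Rightarrow> 'h) \<Rightarrow> 'h" where
  "endpoint_gap x K T \<phi> \<psi> = x - (\<Sum>k<K. heat_response T \<phi> \<psi> k T *\<^sub>R e k)"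

text \<open>The factor t/T makes the correction vanish at 0 and equal the gap at T. Running the
  semigroup backwards from T concentrates mode \<open>k\<close> near the endpoint, so that the cost
  does not grow with T.\<close>

definition heat_path :: "'h \<Rightarrow> nat \<Rightarrow> real \<Rightarrow> (real \<Rightarrow> 'h) \<Rightarrow> (real \<Rightarrow> 'h) \<Rightarrow> real \<Rightarrow> 'h" where
  "heat_path x K T \<phi> \<psi> t = (\<Sum>k<K. heat_response T \<phi> \<psi> k t *\<^sub>R e k) +
     (clamp_to T t / T) *\<^sub>R E (T - clamp_to T t) (endpoint_gap x K T \<phi> \<psi>)"

text \<open>\<open>ramp T k = \<kappa>' + \<alpha> k * \<kappa>\<close> for the coefficient \<open>\<kappa> t = t / T * exp (- \<alpha> k * (T - t))\<close> of the correction.\<close>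

definition ramp :: "real \<Rightarrow> nat \<Rightarrow> real \<Rightarrow> real" where
  "ramp T k s = exp (- \<alpha> k * (T - s)) * (2 * \<alpha> k * s / T + 1 / T)"

text \<open>Obtained by solving the mode equation of \<open>heat_path\<close> for the control. The
  path is driven by the old forcing in low modes and by the ramp; the nonlinearity along the new
  path is subtracted, and division by \<open>lam k\<close> inverts \<open>Q\<close>.\<close>

definition heat_control :: "'h \<Rightarrow> nat \<Rightarrow> real \<Rightarrow> (real \<Rightarrow> 'h) \<Rightarrow> (real \<Rightarrow> 'h) \<Rightarrow> nat \<Rightarrow> real \<Rightarrow> real" where
  "heat_control x K T \<phi> \<psi> k s = indicator {0..T} s *
     ((if k < K then \<psi> s \<bullet> e k else 0) +
      ((if k < K then B (\<phi> s) \<bullet> e k else 0) - B (heat_path x K T \<phi> \<psi> s) \<bullet> e k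
        + (endpoint_gap x K T \<phi> \<psi> \<bullet> e k) * ramp T k s) / lam k)"

text \<open>The energy needs differences of \<open>B\<close> in H^(2\<beta>), whose index may be
  negative, while the Lipschitz bounds are for nonnegative indices. H^\<sigma> embeds into
  H^(2\<beta>) and admits the Lipschitz bound.\<close>

abbreviation \<sigma> :: real where "\<sigma> \<equiv> max (2*\<beta>) 0"

definition tail :: "'h \<Rightarrow> nat \<Rightarrow> ennreal" where
  "tail x K = (\<Sum>k. if k < K then 0 else ennreal (\<alpha> k powr (1 + 2*\<beta>)) * ennreal ((x \<bullet> e k)\<^sup>2))"

context
  fixes \<mu> T :: real and \<phi> \<psi> :: "real \<Rightarrow> 'h" and x :: 'h and K :: nat
  assumes wp: "wave_path \<mu> T \<phi> \<psi>" and \<mu>: "0 < \<mu>"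
begin

private abbreviation "d \<equiv> endpoint_gap x K T \<phi> \<psi>"
private abbreviation "y \<equiv> heat_response T \<phi> \<psi>"
private abbreviation "\<phi>' \<equiv> heat_path x K T \<phi> \<psi>"
private abbreviation "f \<equiv> forcing \<phi> \<psi>"

private lemma T: "1 \<le> T" "0 < T" "0 \<le> T"
  using wave_T[OF wp \<mu>] by auto

lemma endpoint_gap_coeff: "d \<bullet> e k = x \<bullet> e k - (if k < K then y k T else 0)"
  by (simp add: endpoint_gap_def inner_diff_left inner_sum_basis)

lemma heat_path_coeff:
  assumes "t \<in> {0..T}"
  shows "\<phi>' t \<bullet> e k = (if k < K then y k t else 0) + (d \<bullet> e k) * (t / T * exp (- \<alpha> k * (T - t)))"
  using assms by (simp add: heat_path_def inner_add_left inner_sum_basis E_coeff)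

lemma continuous_heat_path: "continuous_on A \<phi>'"
proof -
  have "continuous_on {0..T} (\<lambda>t. E (T - t) d)"
    by (rule continuous_on_compose2[OF E.continuous_orbit]) (auto intro!: continuous_intros)
  then have "continuous_on A (\<lambda>t. E (T - clamp_to T t) d)"
    by (rule continuous_on_clamp_to) (rule T)
  moreover have "continuous_on A (clamp_to T)"
    using continuous_on_clamp_to[OF continuous_on_id T(3)] by simp
  ultimately show ?thesis
    unfolding heat_path_def using T
    by (intro continuous_intros continuous_heat_response[OF wp \<mu>]) auto
qed

lemma measurable_heat_path: "\<phi>' \<in> borel_measurable borel"
  by (rule borel_measurable_continuous_onI[OF continuous_heat_path])

lemma heat_path_0: "\<phi>' 0 = 0"
proof -
  have "y k 0 = 0" for k
    using T unfolding heat_response_def set_lebesgue_integral_def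
    by (subst integral_discrete_difference[where X="{0}" and g="\<lambda>_. 0"]) auto
  then show ?thesis using T by (simp add: heat_path_def)
qed

lemma heat_path_T: "\<phi>' T = x"
  using T by (simp add: heat_path_def endpoint_gap_def)

lemma measurable_heat_control: "heat_control x K T \<phi> \<psi> k \<in> borel_measurable borel"
proof -
  note [measurable] = measurable_heat_path wave_phi(2)[OF wp \<mu>] wave_psi(1)[OF wp \<mu>]
  show ?thesis unfolding heat_control_def[abs_def] ramp_def by measurable
qed

text \<open>Inserting the control cancels the nonlinearity along the new path. What remains are the
  low modes of the old forcing, whose Duhamel integral is \<open>heat_response\<close>, and the
  ramp, treated by \<open>duhamel_ramp\<close>.\<close>

lemma heat_path_mild:
  assumes t: "t \<in> {0..T}"
  shows "\<phi>' t \<bullet> e k = (LINT s:{0..t}|lborel. exp (- \<alpha> k * (t - s)) * (B (\<phi>' s) \<bullet> e k + lam k * heat_control x K T \<phi> \<psi> k s))"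
proof -
  let ?f = "\<lambda>s. if k < K then f s \<bullet> e k else 0"
  let ?x = "\<lambda>s. exp (- \<alpha> k * (t - s))"
  have "(LINT s:{0..t}|lborel. ?x s * (B (\<phi>' s) \<bullet> e k + lam k * heat_control x K T \<phi> \<psi> k s)) =
     (LINT s:{0..t}|lborel. ?x s * ?f s + (d \<bullet> e k) * (?x s * ramp T k s))"
    by (rule set_lebesgue_integral_cong)
      (use t in \<open>auto simp: heat_control_def forcing_def inner_add_left Q_coeff field_simps\<close>)
  also have "\<dots> = (LINT s:{0..t}|lborel. ?x s * ?f s) + (LINT s:{0..t}|lborel. (d \<bullet> e k) * (?x s * ramp T k s))"
  proof (rule set_integral_add(2))
    have "set_integrable lborel {0..t} (\<lambda>s. f s \<bullet> e k)"
      by (rule set_integrable_subset[OF forcing_coeff_integrable(1)[OF wp \<mu>]]) (use t in auto)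
    then have "set_integrable lborel {0..t} (\<lambda>s. (f s \<bullet> e k) * ?x s)"
      by (intro set_integrable_times_continuous continuous_intros)
    then show "set_integrable lborel {0..t} (\<lambda>s. ?x s * ?f s)" by (cases "k < K") (auto simp: mult.commute set_integrable_def)
    show "set_integrable lborel {0..t} (\<lambda>s. (d \<bullet> e k) * (?x s * ramp T k s))"
      unfolding ramp_def using T by (intro borel_integrable_atLeastAtMost' continuous_intros) auto
  qed
  also have "(LINT s:{0..t}|lborel. ?x s * ?f s) = (if k < K then y k t else 0)"
    using t by (simp add: heat_response_def set_lebesgue_integral_def)
  also have "(LINT s:{0..t}|lborel. (d \<bullet> e k) * (?x s * ramp T k s)) = (d \<bullet> e k) * (t / T * exp (- \<alpha> k * (T - t)))"
    using duhamel_ramp[OF T(2), of t "\<alpha> k"] t by (simp add: ramp_def)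
  finally show ?thesis by (simp add: heat_path_coeff[OF t])
qed

text \<open>For T \<ge> 1 the bracket in \<open>ramp\<close> is at most 2 \<alpha> k + 1, and the
  squared exponential integrates to at most 1 / (2 \<alpha> k). The cost is linear in
  \<open>\<alpha> k\<close>, uniformly in T.\<close>

lemma sq_int_ramp: "sq_int T (ramp T k) \<le> ennreal ((2 + 1 / \<alpha> 0)\<^sup>2 / 2 * \<alpha> k)"
proof -
  \<comment> \<open>The summand 1 is absorbed by
    \<open>1 \<le> \<alpha> k / \<alpha> 0\<close>.\<close>
  define A where "A = (2 + 1 / \<alpha> 0) * \<alpha> k"
  have "1 \<le> 1 / \<alpha> 0 * \<alpha> k" using \<alpha>_ge[of k] \<alpha>_0 by (simp add: field_simps)
  then have A: "2 * \<alpha> k + 1 \<le> A" by (simp add: A_def algebra_simps)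
  have "(ramp T k s)\<^sup>2 \<le> (A * exp (- \<alpha> k * (T - s)))\<^sup>2" if "s \<in> {0..T}" for s
  proof (rule power_mono)
    have "\<alpha> k * s \<le> \<alpha> k * T" using that by (intro mult_left_mono) auto
    then have "2 * \<alpha> k * s / T + 1 / T \<le> 2 * \<alpha> k + 1"
      using T by (intro add_mono) (auto simp: field_simps)
    then have "2 * \<alpha> k * s / T + 1 / T \<le> A" using A by linarith
    then show "ramp T k s \<le> A * exp (- \<alpha> k * (T - s))"
      unfolding ramp_def by (simp add: mult.commute mult_right_mono)
    show "0 \<le> ramp T k s" unfolding ramp_def using that T by (intro mult_nonneg_nonneg add_nonneg_nonneg divide_nonneg_nonneg) auto
  qed
  then have "sq_int T (ramp T k) \<le> sq_int T (\<lambda>s. A * exp (- \<alpha> k * (T - s)))" by (rule sq_int_mono)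
  also have "\<dots> = ennreal (A\<^sup>2) * sq_int T (\<lambda>s. exp (- \<alpha> k * (T - s)))" by (rule sq_int_scale) measurable
  also have "\<dots> \<le> ennreal (A\<^sup>2) * ennreal (1 / (2 * \<alpha> k))"
    by (intro mult_left_mono sq_int_exp_le T \<alpha>_pos zero_le)
  also have "\<dots> = ennreal (A\<^sup>2 * (1 / (2 * \<alpha> k)))" by (rule ennreal_mult[symmetric]) auto
  also have "A\<^sup>2 * (1 / (2 * \<alpha> k)) = (2 + 1 / \<alpha> 0)\<^sup>2 / 2 * \<alpha> k"
    by (simp add: A_def power2_eq_square)
  finally show ?thesis .
qed

text \<open>In low modes the gap is \<open>x - \<phi> T\<close>, converted from H to the strong norm
  at the price of a power of \<open>\<alpha> K\<close>, plus the endpoint error of the heat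
  response. High modes contribute the tail of \<open>x\<close>.\<close>

lemma endpoint_gap_bound:
  "hn (1 + 2*\<beta>) d \<le> ennreal (2 * \<alpha> K powr (1 + 2*\<beta>)) * hn 0 (x - \<phi> T)
     + ennreal (2 * ((\<alpha> K)\<^sup>2 * \<mu>\<^sup>2 + \<alpha> K * \<mu>)) * path_sq T (2*\<beta>) f + tail x K"
  unfolding nn_integral_hn[OF measurable_forcing[OF wp \<mu>]] hn_def[of _ d] hn_def[of _ "x - \<phi> T"] tail_def ennreal_suminf_cmult[symmetric]
    suminf_add[OF summableI summableI]
proof (intro ennreal_suminf_mono)
  fix k
  let ?F = "sq_int T (\<lambda>s. f s \<bullet> e k)"
  show "ennreal (\<alpha> k powr (1 + 2*\<beta>)) * ennreal ((d \<bullet> e k)\<^sup>2) \<le>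
      ennreal (2 * \<alpha> K powr (1 + 2*\<beta>)) * (ennreal (\<alpha> k powr 0) * ennreal (((x - \<phi> T) \<bullet> e k)\<^sup>2)) +
      ennreal (2 * ((\<alpha> K)\<^sup>2 * \<mu>\<^sup>2 + \<alpha> K * \<mu>)) * (ennreal (\<alpha> k powr (2*\<beta>)) * ?F) +
      (if k < K then 0 else ennreal (\<alpha> k powr (1 + 2*\<beta>)) * ennreal ((x \<bullet> e k)\<^sup>2))"
  proof (cases "k < K")
    case False
    then show ?thesis by (simp add: endpoint_gap_coeff)
  next
    case True
    have \<alpha>K: "\<alpha> k \<le> \<alpha> K" using True by (intro \<alpha>_mono) auto
    let ?p = "(x - \<phi> T) \<bullet> e k" and ?q = "\<phi> T \<bullet> e k - y k T"
    have "(d \<bullet> e k)\<^sup>2 = (?p + ?q)\<^sup>2" using True by (simp add: endpoint_gap_coeff inner_diff_left)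
    also have "\<dots> \<le> 2 * ?p\<^sup>2 + 2 * ?q\<^sup>2" using sq_add_le[of 1 ?p ?q] by simp
    finally have "\<alpha> k powr (1 + 2*\<beta>) * (d \<bullet> e k)\<^sup>2 \<le> \<alpha> k powr (1 + 2*\<beta>) * (2 * ?p\<^sup>2 + 2 * ?q\<^sup>2)"
      by (intro mult_left_mono) auto
    also have "\<dots> = \<alpha> k powr (1 + 2*\<beta>) * (2 * ?p\<^sup>2) + \<alpha> k powr (1 + 2*\<beta>) * (2 * ?q\<^sup>2)"
      by (rule distrib_left)
    also have "\<alpha> k powr (1 + 2*\<beta>) * (2 * ?p\<^sup>2) \<le> \<alpha> K powr (1 + 2*\<beta>) * (2 * ?p\<^sup>2)"
      using \<alpha>K \<beta> by (intro mult_right_mono powr_mono2) auto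
    finally have "\<alpha> k powr (1 + 2*\<beta>) * (d \<bullet> e k)\<^sup>2 \<le> 2 * \<alpha> K powr (1 + 2*\<beta>) * ?p\<^sup>2 + 2 * \<alpha> k powr (1 + 2*\<beta>) * ?q\<^sup>2"
      by simp
    from ennreal_leI[OF this]
    have "ennreal (\<alpha> k powr (1 + 2*\<beta>)) * ennreal ((d \<bullet> e k)\<^sup>2) \<le>
        ennreal (2 * \<alpha> K powr (1 + 2*\<beta>)) * ennreal (?p\<^sup>2) + ennreal (2 * \<alpha> k powr (1 + 2*\<beta>)) * ennreal (?q\<^sup>2)"
      by (subst ennreal_linear) (simp_all add: ennreal_mult[symmetric] del: ennreal_plus)
    also have "ennreal (2 * \<alpha> k powr (1 + 2*\<beta>)) * ennreal (?q\<^sup>2) \<le>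
        ennreal (2 * \<alpha> k powr (1 + 2*\<beta>)) * (ennreal (\<alpha> k * \<mu>\<^sup>2 + \<mu>) * ?F)"
      by (intro mult_left_mono wave_mode_estimates[OF wp \<mu>] zero_le)
    also have "\<dots> = ennreal (2 * \<alpha> k powr (1 + 2*\<beta>) * (\<alpha> k * \<mu>\<^sup>2 + \<mu>)) * ?F"
      using \<mu> by (subst ennreal_mult) (auto simp: mult.assoc)
    also have "2 * \<alpha> k powr (1 + 2*\<beta>) * (\<alpha> k * \<mu>\<^sup>2 + \<mu>) = 2 * ((\<alpha> k)\<^sup>2 * \<mu>\<^sup>2 + \<alpha> k * \<mu>) * \<alpha> k powr (2*\<beta>)"
      by (simp add: powr_add power2_eq_square algebra_simps)
    also have "ennreal (2 * ((\<alpha> k)\<^sup>2 * \<mu>\<^sup>2 + \<alpha> k * \<mu>) * \<alpha> k powr (2*\<beta>)) * ?F \<le>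
        ennreal (2 * ((\<alpha> K)\<^sup>2 * \<mu>\<^sup>2 + \<alpha> K * \<mu>) * \<alpha> k powr (2*\<beta>)) * ?F"
      using \<alpha>K \<mu> by (intro mult_right_mono ennreal_leI mult_left_mono add_mono power_mono) auto
    also have "\<dots> = ennreal (2 * ((\<alpha> K)\<^sup>2 * \<mu>\<^sup>2 + \<alpha> K * \<mu>)) * (ennreal (\<alpha> k powr (2*\<beta>)) * ?F)"
      using \<mu> by (subst ennreal_mult) (auto simp: mult.assoc)
    finally show ?thesis using True by (simp add: add_mono)
  qed
qed

text \<open>The three terms are the distance of wave and heat response in low modes, the dropped
  high modes of the wave path, and the correction. In the second, the index is raised from \<sigma>
  to 1 + 2\<beta> against a negative power of \<open>\<alpha> K\<close>; in the third, time
  integration gains one derivative.\<close>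

lemma heat_path_close:
  "path_sq T \<sigma> (\<lambda>s. \<phi> s - \<phi>' s) \<le>
     ennreal (2 * (\<alpha> K powr (\<sigma> - 2*\<beta>) * \<mu>\<^sup>2)) * path_sq T (2*\<beta>) f
     + ennreal (2 * \<alpha> K powr (\<sigma> - (1 + 2*\<beta>))) * path_sq T (1 + 2*\<beta>) \<phi>
     + ennreal (\<alpha> 0 powr (\<sigma> - 1 - (1 + 2*\<beta>))) * hn (1 + 2*\<beta>) d"
proof -
  note [measurable] = measurable_heat_path wave_phi(2)[OF wp \<mu>] measurable_heat_response[OF wp \<mu>]
  have m: "(\<lambda>s. \<phi> s - \<phi>' s) \<in> borel_measurable borel" by measurable
  show ?thesis
    unfolding nn_integral_hn[OF m] nn_integral_hn[OF measurable_forcing[OF wp \<mu>]] nn_integral_hn[OF wave_phi(2)[OF wp \<mu>]]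
      hn_def[of _ d] ennreal_suminf_cmult[symmetric] suminf_add[OF summableI summableI]
  proof (intro ennreal_suminf_mono)
    fix k
    let ?F = "sq_int T (\<lambda>s. f s \<bullet> e k)" and ?U = "sq_int T (\<lambda>s. \<phi> s \<bullet> e k)"
    define p where "p = (\<lambda>s. \<phi> s \<bullet> e k - (if k < K then y k s else 0))"
    define r where "r = (\<lambda>s. (- (d \<bullet> e k)) * (s / T * exp (- \<alpha> k * (T - s))))"
    have [measurable]: "p \<in> borel_measurable borel" "r \<in> borel_measurable borel"
      unfolding p_def r_def by (cases "k < K"; simp) measurable
    have pm: "ennreal (\<alpha> k powr \<sigma>) * sq_int T p \<le>
        ennreal (\<alpha> K powr (\<sigma> - 2*\<beta>) * \<mu>\<^sup>2) * (ennreal (\<alpha> k powr (2*\<beta>)) * ?F)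
        + ennreal (\<alpha> K powr (\<sigma> - (1 + 2*\<beta>))) * (ennreal (\<alpha> k powr (1 + 2*\<beta>)) * ?U)"
    proof (cases "k < K")
      case True
      have \<alpha>K: "\<alpha> k \<le> \<alpha> K" using True by (intro \<alpha>_mono) auto
      have "ennreal (\<alpha> k powr \<sigma>) * sq_int T p \<le> ennreal (\<alpha> k powr \<sigma>) * (ennreal (\<mu>\<^sup>2) * ?F)"
        unfolding p_def using True wave_mode_estimates(4)[OF wp \<mu>, of k] by (simp add: mult_left_mono)
      also have "\<dots> = ennreal (\<alpha> k powr \<sigma> * \<mu>\<^sup>2) * ?F" by (simp add: ennreal_mult mult.assoc)
      also have "ennreal (\<alpha> k powr \<sigma> * \<mu>\<^sup>2) * ?F = ennreal (\<alpha> k powr (\<sigma> - 2*\<beta>) * \<alpha> k powr (2*\<beta>) * \<mu>\<^sup>2) * ?F"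
        by (simp flip: powr_add)
      also have "\<dots> \<le>
          ennreal (\<alpha> K powr (\<sigma> - 2*\<beta>) * \<alpha> k powr (2*\<beta>) * \<mu>\<^sup>2) * ?F"
        using \<alpha>K by (intro mult_right_mono ennreal_leI powr_mono2) auto
      also have "\<dots> = ennreal (\<alpha> K powr (\<sigma> - 2*\<beta>) * \<mu>\<^sup>2) * (ennreal (\<alpha> k powr (2*\<beta>)) * ?F)"
        by (simp add: ennreal_mult mult_ac)
      finally show ?thesis by (rule order_trans) simp
    next
      case False
      have "\<alpha> k powr \<sigma> = \<alpha> k powr (\<sigma> - (1 + 2*\<beta>)) * \<alpha> k powr (1 + 2*\<beta>)" by (simp flip: powr_add)
      also have "\<dots> \<le> \<alpha> K powr (\<sigma> - (1 + 2*\<beta>)) * \<alpha> k powr (1 + 2*\<beta>)"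
        using False \<beta> by (intro mult_right_mono powr_mono2' \<alpha>_mono) auto
      finally have "ennreal (\<alpha> k powr \<sigma>) * ?U \<le> ennreal (\<alpha> K powr (\<sigma> - (1 + 2*\<beta>)) * \<alpha> k powr (1 + 2*\<beta>)) * ?U"
        by (intro mult_right_mono ennreal_leI) auto
      also have "\<dots> = ennreal (\<alpha> K powr (\<sigma> - (1 + 2*\<beta>))) * (ennreal (\<alpha> k powr (1 + 2*\<beta>)) * ?U)"
        by (simp add: ennreal_mult mult.assoc)
      finally show ?thesis unfolding p_def using False by (intro order_trans[OF _ add_increasing[OF zero_le order_refl]]) simp
    qed
    have "sq_int T r \<le> sq_int T (\<lambda>s. (- (d \<bullet> e k)) * exp (- \<alpha> k * (T - s)))"
    proof (rule sq_int_mono)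
      fix s assume s: "s \<in> {0..T}"
      have "\<bar>s / T * exp (- \<alpha> k * (T - s))\<bar> \<le> 1 * exp (- \<alpha> k * (T - s))"
        unfolding abs_mult using s T by (intro mult_mono) auto
      then have "\<bar>d \<bullet> e k\<bar> * \<bar>s / T * exp (- \<alpha> k * (T - s))\<bar> \<le> \<bar>d \<bullet> e k\<bar> * exp (- \<alpha> k * (T - s))"
        by (intro mult_left_mono) auto
      then show "(r s)\<^sup>2 \<le> ((- (d \<bullet> e k)) * exp (- \<alpha> k * (T - s)))\<^sup>2"
        unfolding abs_le_square_iff[symmetric] r_def abs_mult by simp
    qed
    also have "\<dots> = ennreal ((- (d \<bullet> e k))\<^sup>2) * sq_int T (\<lambda>s. exp (- \<alpha> k * (T - s)))" by (rule sq_int_scale) measurable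
    also have "\<dots> \<le> ennreal ((d \<bullet> e k)\<^sup>2) * ennreal (1 / (2 * \<alpha> k))"
      unfolding power2_minus by (intro mult_left_mono sq_int_exp_le T \<alpha>_pos zero_le)
    finally have "ennreal (\<alpha> k powr \<sigma>) * (2 * sq_int T r) \<le> ennreal (\<alpha> k powr \<sigma>) * (2 * (ennreal ((d \<bullet> e k)\<^sup>2) * ennreal (1 / (2 * \<alpha> k))))"
      by (intro mult_left_mono) auto
    also have "\<dots> = ennreal (\<alpha> k powr (\<sigma> - 1) * (d \<bullet> e k)\<^sup>2)"
      by (simp add: powr_diff flip: ennreal_mult ennreal_numeral)
    also have "\<dots> \<le> ennreal (\<alpha> 0 powr (\<sigma> - 1 - (1 + 2*\<beta>)) * \<alpha> k powr (1 + 2*\<beta>) * (d \<bullet> e k)\<^sup>2)"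
      using \<beta> by (intro ennreal_leI mult_right_mono powr_le) auto
    finally have rm: "ennreal (\<alpha> k powr \<sigma>) * (2 * sq_int T r) \<le>
        ennreal (\<alpha> 0 powr (\<sigma> - 1 - (1 + 2*\<beta>))) * (ennreal (\<alpha> k powr (1 + 2*\<beta>)) * ennreal ((d \<bullet> e k)\<^sup>2))"
      by (simp add: ennreal_mult mult.assoc)
    have "sq_int T (\<lambda>s. (\<phi> s - \<phi>' s) \<bullet> e k) = sq_int T (\<lambda>s. p s + r s)"
      by (rule sq_int_cong) (simp add: inner_diff_left heat_path_coeff p_def r_def)
    also have "\<dots> \<le> 2 * sq_int T p + 2 * sq_int T r"
      using sq_int_add_le[of p r 1 T] by simp
    finally have "sq_int T (\<lambda>s. (\<phi> s - \<phi>' s) \<bullet> e k) \<le> 2 * sq_int T p + 2 * sq_int T r" .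
    from mult_left_mono[OF this zero_le[of "ennreal (\<alpha> k powr \<sigma>)"]]
    have "ennreal (\<alpha> k powr \<sigma>) * sq_int T (\<lambda>s. (\<phi> s - \<phi>' s) \<bullet> e k) \<le>
        2 * (ennreal (\<alpha> k powr \<sigma>) * sq_int T p) + ennreal (\<alpha> k powr \<sigma>) * (2 * sq_int T r)"
      by (simp only: distrib_left mult.left_commute)
    also have "\<dots> \<le> 2 * (ennreal (\<alpha> K powr (\<sigma> - 2*\<beta>) * \<mu>\<^sup>2) * (ennreal (\<alpha> k powr (2*\<beta>)) * ?F)
        + ennreal (\<alpha> K powr (\<sigma> - (1 + 2*\<beta>))) * (ennreal (\<alpha> k powr (1 + 2*\<beta>)) * ?U))
        + ennreal (\<alpha> 0 powr (\<sigma> - 1 - (1 + 2*\<beta>))) * (ennreal (\<alpha> k powr (1 + 2*\<beta>)) * ennreal ((d \<bullet> e k)\<^sup>2))"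
      by (intro add_mono mult_left_mono pm rm zero_le)
    finally show "ennreal (\<alpha> k powr \<sigma>) * sq_int T (\<lambda>s. (\<phi> s - \<phi>' s) \<bullet> e k) \<le>
        ennreal (2 * (\<alpha> K powr (\<sigma> - 2*\<beta>) * \<mu>\<^sup>2)) * (ennreal (\<alpha> k powr (2*\<beta>)) * ?F)
        + ennreal (2 * \<alpha> K powr (\<sigma> - (1 + 2*\<beta>))) * (ennreal (\<alpha> k powr (1 + 2*\<beta>)) * ?U)
        + ennreal (\<alpha> 0 powr (\<sigma> - 1 - (1 + 2*\<beta>))) * (ennreal (\<alpha> k powr (1 + 2*\<beta>)) * ennreal ((d \<bullet> e k)\<^sup>2))"
      by (simp add: ennreal_mult[of 2] distrib_left mult.assoc)
  qed
qed

end

section \<open>Energy of the heat control and the comparison with the wave path\<close>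

context
  fixes \<mu> T :: real and \<phi> \<psi> :: "real \<Rightarrow> 'h" and x :: 'h and K :: nat
  assumes wp: "wave_path \<mu> T \<phi> \<psi>" and \<mu>: "0 < \<mu>"
begin

private abbreviation "gap \<equiv> endpoint_gap x K T \<phi> \<psi>"
private abbreviation "\<omega> \<equiv> heat_path x K T \<phi> \<psi>"
private abbreviation "a \<equiv> heat_control x K T \<phi> \<psi>"
private abbreviation "frc \<equiv> forcing \<phi> \<psi>"

text \<open>The given control is separated with a factor near 1, everything else carries 1 / lam,
  whose square is at most \<open>c\<^sup>2 * \<alpha> k powr (2*\<beta>)\<close>. The 3 comes from
  squaring a sum of three terms.\<close>

lemma heat_control_sq_le:
  assumes \<epsilon>: "\<epsilon> > 0"
  shows "(a k s)\<^sup>2 \<le> (1 + \<epsilon>) * (\<psi> s \<bullet> e k)\<^sup>2 + indicator {0..T} s * ((1 + 1/\<epsilon>) * (3 * c\<^sup>2) *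
     (\<alpha> k powr (2*\<beta>) * ((B (\<phi> s) - B (\<omega> s)) \<bullet> e k)\<^sup>2
      + 1 / \<alpha> K * (\<alpha> k powr (1 + 2*\<beta>) * (B (\<phi> s) \<bullet> e k)\<^sup>2)
      + \<alpha> k powr (2*\<beta>) * (gap \<bullet> e k)\<^sup>2 * (ramp T k s)\<^sup>2))"
proof (cases "s \<in> {0..T}")
  case False
  then show ?thesis using \<epsilon> by (simp add: heat_control_def)
next
  case True
  \<comment> \<open>In dropped modes the control has to cancel the new nonlinearity entirely.
    Writing it as the old one minus a difference gives a small \<open>p\<close>, and a
    \<open>q\<close> that lives on \<open>k \<ge> K\<close>, where one power of
    \<open>\<alpha>\<close> is worth a factor \<open>1 / \<alpha> K\<close>.\<close>
  define p q r where "p = (B (\<phi> s) - B (\<omega> s)) \<bullet> e k" and "q = (if k < K then 0 else - (B (\<phi> s) \<bullet> e k))"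
    and "r = (gap \<bullet> e k) * ramp T k s"
  have "a k s = (if k < K then \<psi> s \<bullet> e k else 0) + (p + q + r) / lam k"
    using True by (simp add: heat_control_def p_def q_def r_def inner_diff_left)
  then have "(a k s)\<^sup>2 \<le> (1 + \<epsilon>) * (if k < K then \<psi> s \<bullet> e k else 0)\<^sup>2 + (1 + 1/\<epsilon>) * ((p + q + r) / lam k)\<^sup>2"
    using sq_add_le[OF \<epsilon>] by simp
  also have "(1 + \<epsilon>) * (if k < K then \<psi> s \<bullet> e k else 0)\<^sup>2 \<le> (1 + \<epsilon>) * (\<psi> s \<bullet> e k)\<^sup>2"
    using \<epsilon> by (intro mult_left_mono) auto
  also have "((p + q + r) / lam k)\<^sup>2 = 1 / (lam k)\<^sup>2 * (p + q + r)\<^sup>2" by (simp add: power_divide)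
  also have "\<dots> \<le> (c\<^sup>2 * \<alpha> k powr (2*\<beta>)) * (3 * (p\<^sup>2 + q\<^sup>2 + r\<^sup>2))"
    by (intro mult_mono inverse_lam_sq_le sq_add3_le) auto
  also have "\<dots> = 3 * c\<^sup>2 * (\<alpha> k powr (2*\<beta>) * p\<^sup>2 + \<alpha> k powr (2*\<beta>) * q\<^sup>2 + \<alpha> k powr (2*\<beta>) * r\<^sup>2)"
    by (simp add: algebra_simps)
  also have "\<alpha> k powr (2*\<beta>) * q\<^sup>2 \<le> 1 / \<alpha> K * (\<alpha> k powr (1 + 2*\<beta>) * (B (\<phi> s) \<bullet> e k)\<^sup>2)"
  proof (cases "k < K")
    case False
    then have "\<alpha> K \<le> \<alpha> k" by (intro \<alpha>_mono) auto
    then have "\<alpha> k powr (2*\<beta>) * \<alpha> K \<le> \<alpha> k powr (2*\<beta>) * \<alpha> k" by (intro mult_left_mono) auto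
    also have "\<dots> = \<alpha> k powr (1 + 2*\<beta>)" by (simp add: powr_add)
    finally have "\<alpha> k powr (2*\<beta>) \<le> 1 / \<alpha> K * \<alpha> k powr (1 + 2*\<beta>)" by (simp add: field_simps)
    then have "\<alpha> k powr (2*\<beta>) * (B (\<phi> s) \<bullet> e k)\<^sup>2 \<le> 1 / \<alpha> K * \<alpha> k powr (1 + 2*\<beta>) * (B (\<phi> s) \<bullet> e k)\<^sup>2"
      by (rule mult_right_mono) simp
    then show ?thesis using False by (simp add: q_def)
  qed (simp add: q_def)
  finally have "(a k s)\<^sup>2 \<le> (1 + \<epsilon>) * (\<psi> s \<bullet> e k)\<^sup>2 + (1 + 1/\<epsilon>) * (3 * c\<^sup>2 *
      (\<alpha> k powr (2*\<beta>) * p\<^sup>2 + 1 / \<alpha> K * (\<alpha> k powr (1 + 2*\<beta>) * (B (\<phi> s) \<bullet> e k)\<^sup>2) + \<alpha> k powr (2*\<beta>) * r\<^sup>2))"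
    using \<epsilon> by (simp add: mult_left_mono)
  then show ?thesis using True by (simp add: p_def r_def power_mult_distrib mult.assoc)
qed

lemma heat_control_energy:
  assumes \<epsilon>: "\<epsilon> > 0"
  shows "(\<integral>\<^sup>+s. (\<Sum>k. ennreal ((a k s)\<^sup>2)) \<partial>lborel) \<le>
    ennreal (1 + \<epsilon>) * control_sq \<psi> +
    ennreal ((1 + 1/\<epsilon>) * (3 * c\<^sup>2)) * ((path_sq T (2*\<beta>) (\<lambda>s. B (\<phi> s) - B (\<omega> s)))
      + ennreal (1 / \<alpha> K) * path_sq T (1 + 2*\<beta>) (\<lambda>s. B (\<phi> s))
      + ennreal ((2 + 1 / \<alpha> 0)\<^sup>2 / 2) * hn (1 + 2*\<beta>) gap)"
proof -
  note [measurable] = measurable_heat_path[OF wp \<mu>] wave_phi(2)[OF wp \<mu>] wave_psi(1)[OF wp \<mu>]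
  have [measurable]: "ramp T k \<in> borel_measurable borel" for k unfolding ramp_def[abs_def] by measurable
  let ?A = "ennreal ((1 + 1/\<epsilon>) * (3 * c\<^sup>2))"
  define g where "g = (\<lambda>s k. ennreal (\<alpha> k powr (2*\<beta>) * (gap \<bullet> e k)\<^sup>2) * ennreal ((ramp T k s)\<^sup>2))"
  define h1 h2 where "h1 = (\<lambda>s. hn (2*\<beta>) (B (\<phi> s) - B (\<omega> s)))" and "h2 = (\<lambda>s. hn (1 + 2*\<beta>) (B (\<phi> s)))"
  have [measurable]: "h1 \<in> borel_measurable borel" "h2 \<in> borel_measurable borel" "(\<lambda>s. \<Sum>k. g s k) \<in> borel_measurable borel"
    unfolding h1_def h2_def g_def by measurable
  have pt: "(\<Sum>k. ennreal ((a k s)\<^sup>2)) \<le> ennreal (1 + \<epsilon>) * ennreal ((norm (\<psi> s))\<^sup>2) +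
      ?A * ((h1 s + ennreal (1 / \<alpha> K) * h2 s + (\<Sum>k. g s k)) * indicator {0..T} s)" for s
  proof -
    have "(\<Sum>k. ennreal ((a k s)\<^sup>2)) \<le> (\<Sum>k. ennreal (1 + \<epsilon>) * (ennreal (\<alpha> k powr 0) * ennreal ((\<psi> s \<bullet> e k)\<^sup>2)) +
        ?A * ((ennreal (\<alpha> k powr (2*\<beta>)) * ennreal (((B (\<phi> s) - B (\<omega> s)) \<bullet> e k)\<^sup>2)
      + ennreal (1 / \<alpha> K) * (ennreal (\<alpha> k powr (1 + 2*\<beta>)) * ennreal ((B (\<phi> s) \<bullet> e k)\<^sup>2))
      + g s k) * indicator {0..T} s))"
    proof (intro ennreal_suminf_mono)
      fix k
      define u v w where "u = \<alpha> k powr (2*\<beta>) * ((B (\<phi> s) - B (\<omega> s)) \<bullet> e k)\<^sup>2"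
        and "v = 1 / \<alpha> K * (\<alpha> k powr (1 + 2*\<beta>) * (B (\<phi> s) \<bullet> e k)\<^sup>2)"
        and "w = \<alpha> k powr (2*\<beta>) * (gap \<bullet> e k)\<^sup>2 * (ramp T k s)\<^sup>2"
      have nn: "0 \<le> u" "0 \<le> v" "0 \<le> w" by (auto simp: u_def v_def w_def)
      have "ennreal ((a k s)\<^sup>2) \<le> ennreal ((1 + \<epsilon>) * (\<psi> s \<bullet> e k)\<^sup>2 + ((1 + 1/\<epsilon>) * (3 * c\<^sup>2)) * ((u + v + w) * indicator {0..T} s))"
        using heat_control_sq_le[OF \<epsilon>, of k s] by (intro ennreal_leI) (simp add: u_def v_def w_def mult_ac)
      also have "\<dots> = ennreal (1 + \<epsilon>) * ennreal ((\<psi> s \<bullet> e k)\<^sup>2) + ?A * ennreal ((u + v + w) * indicator {0..T} s)"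
        using \<epsilon> nn by (intro ennreal_linear[symmetric]) auto
      also have "ennreal ((u + v + w) * indicator {0..T} s) = (ennreal u + ennreal v + ennreal w) * indicator {0..T} s"
        using nn by (simp add: indicator_def)
      finally show "ennreal ((a k s)\<^sup>2) \<le> ennreal (1 + \<epsilon>) * (ennreal (\<alpha> k powr 0) * ennreal ((\<psi> s \<bullet> e k)\<^sup>2)) +
        ?A * ((ennreal (\<alpha> k powr (2*\<beta>)) * ennreal (((B (\<phi> s) - B (\<omega> s)) \<bullet> e k)\<^sup>2)
      + ennreal (1 / \<alpha> K) * (ennreal (\<alpha> k powr (1 + 2*\<beta>)) * ennreal ((B (\<phi> s) \<bullet> e k)\<^sup>2))
      + g s k) * indicator {0..T} s)"
        unfolding u_def v_def w_def g_def by (simp only: ennreal_mult powr_ge_zero zero_le_power2 mult_nonneg_nonneg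
            divide_nonneg_nonneg zero_le_one \<alpha>_nonneg powr_zero_eq_one \<alpha>_neq_0 if_False ennreal_1 mult_1_left)
    qed
    also have "\<dots> = ennreal (1 + \<epsilon>) * hn 0 (\<psi> s) + ?A * ((h1 s + ennreal (1 / \<alpha> K) * h2 s + (\<Sum>k. g s k)) * indicator {0..T} s)"
      unfolding h1_def h2_def hn_def ennreal_suminf_cmult[symmetric] ennreal_suminf_multc[symmetric] suminf_add[OF summableI summableI] ..
    finally show ?thesis by (simp add: hn_0)
  qed
  \<comment> \<open>The linear cost of the ramp raises the weight from index 2\<beta> to 1 +
    2\<beta>: this is why the gap has to be small in that norm.\<close>
  have "(\<integral>\<^sup>+s. (\<Sum>k. g s k) * indicator {0..T} s \<partial>lborel) =
      (\<integral>\<^sup>+s. (\<Sum>k. ennreal (\<alpha> k powr (2*\<beta>) * (gap \<bullet> e k)\<^sup>2) * (ennreal ((ramp T k s)\<^sup>2) * indicator {0..T} s)) \<partial>lborel)"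
    unfolding ennreal_suminf_multc[symmetric] g_def by (simp add: mult.assoc)
  also have "\<dots> = (\<Sum>k. ennreal (\<alpha> k powr (2*\<beta>) * (gap \<bullet> e k)\<^sup>2) * sq_int T (ramp T k))"
    unfolding sq_int_def by (subst nn_integral_suminf) (auto simp: nn_integral_cmult)
  also have "\<dots> \<le> (\<Sum>k. ennreal ((2 + 1 / \<alpha> 0)\<^sup>2 / 2) * (ennreal (\<alpha> k powr (1 + 2*\<beta>)) * ennreal ((gap \<bullet> e k)\<^sup>2)))"
  proof (intro ennreal_suminf_mono)
    fix k
    have "ennreal (\<alpha> k powr (2*\<beta>) * (gap \<bullet> e k)\<^sup>2) * sq_int T (ramp T k) \<le>
        ennreal (\<alpha> k powr (2*\<beta>) * (gap \<bullet> e k)\<^sup>2) * ennreal ((2 + 1 / \<alpha> 0)\<^sup>2 / 2 * \<alpha> k)"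
      by (intro mult_left_mono sq_int_ramp[OF wp \<mu>] zero_le)
    also have "\<dots> = ennreal (\<alpha> k powr (2*\<beta>) * (gap \<bullet> e k)\<^sup>2 * ((2 + 1 / \<alpha> 0)\<^sup>2 / 2 * \<alpha> k))"
      by (rule ennreal_mult[symmetric]) auto
    also have "\<alpha> k powr (2*\<beta>) * (gap \<bullet> e k)\<^sup>2 * ((2 + 1 / \<alpha> 0)\<^sup>2 / 2 * \<alpha> k) =
        (2 + 1 / \<alpha> 0)\<^sup>2 / 2 * (\<alpha> k powr (1 + 2*\<beta>) * (gap \<bullet> e k)\<^sup>2)"
      by (simp add: powr_add)
    also have "ennreal \<dots> = ennreal ((2 + 1 / \<alpha> 0)\<^sup>2 / 2) * (ennreal (\<alpha> k powr (1 + 2*\<beta>)) * ennreal ((gap \<bullet> e k)\<^sup>2))"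
      by (subst ennreal_mult, simp, simp, subst ennreal_mult) auto
    finally show "ennreal (\<alpha> k powr (2*\<beta>) * (gap \<bullet> e k)\<^sup>2) * sq_int T (ramp T k) \<le>
        ennreal ((2 + 1 / \<alpha> 0)\<^sup>2 / 2) * (ennreal (\<alpha> k powr (1 + 2*\<beta>)) * ennreal ((gap \<bullet> e k)\<^sup>2))" .
  qed
  also have "\<dots> = ennreal ((2 + 1 / \<alpha> 0)\<^sup>2 / 2) * hn (1 + 2*\<beta>) gap" by (simp only: hn_def ennreal_suminf_cmult)
  finally have gi: "(\<integral>\<^sup>+s. (\<Sum>k. g s k) * indicator {0..T} s \<partial>lborel) \<le> ennreal ((2 + 1 / \<alpha> 0)\<^sup>2 / 2) * hn (1 + 2*\<beta>) gap" .
  have "(\<integral>\<^sup>+s. (\<Sum>k. ennreal ((a k s)\<^sup>2)) \<partial>lborel) \<le> (\<integral>\<^sup>+s. ennreal (1 + \<epsilon>) * ennreal ((norm (\<psi> s))\<^sup>2) +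
      ?A * ((h1 s + ennreal (1 / \<alpha> K) * h2 s + (\<Sum>k. g s k)) * indicator {0..T} s) \<partial>lborel)"
    by (intro nn_integral_mono pt)
  also have "\<dots> = ennreal (1 + \<epsilon>) * control_sq \<psi> +
     ?A * (\<integral>\<^sup>+s. h1 s * indicator {0..T} s + ennreal (1 / \<alpha> K) * (h2 s * indicator {0..T} s) + (\<Sum>k. g s k) * indicator {0..T} s \<partial>lborel)"
    by (subst nn_integral_add) (simp_all add: nn_integral_cmult distrib_right mult.assoc)
  also have "(\<integral>\<^sup>+s. h1 s * indicator {0..T} s + ennreal (1 / \<alpha> K) * (h2 s * indicator {0..T} s) + (\<Sum>k. g s k) * indicator {0..T} s \<partial>lborel)
     = (\<integral>\<^sup>+s\<in>{0..T}. h1 s \<partial>lborel) + ennreal (1 / \<alpha> K) * (\<integral>\<^sup>+s\<in>{0..T}. h2 s \<partial>lborel) + (\<integral>\<^sup>+s. (\<Sum>k. g s k) * indicator {0..T} s \<partial>lborel)"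
    by (simp add: nn_integral_add nn_integral_cmult)
  also have "ennreal (1 + \<epsilon>) * control_sq \<psi> + ?A * \<dots> \<le>
      ennreal (1 + \<epsilon>) * control_sq \<psi> + ?A * ((\<integral>\<^sup>+s\<in>{0..T}. h1 s \<partial>lborel)
       + ennreal (1 / \<alpha> K) * (\<integral>\<^sup>+s\<in>{0..T}. h2 s \<partial>lborel) + ennreal ((2 + 1 / \<alpha> 0)\<^sup>2 / 2) * hn (1 + 2*\<beta>) gap)"
    by (intro add_left_mono mult_left_mono gi zero_le)
  finally show ?thesis unfolding h1_def h2_def .
qed

text \<open>The Lipschitz bound needs the wave path in H^\<sigma>. Finiteness of its path norm
  guarantees this for almost every time, which is enough under the integral.\<close>

lemma nn_integral_B_diff:
  assumes fin: "(path_sq T (1 + 2*\<beta>) \<phi>) \<noteq> \<infinity>"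
  shows "path_sq T (2*\<beta>) (\<lambda>s. B (\<phi> s) - B (\<omega> s)) \<le>
    ennreal (\<alpha> 0 powr (2*\<beta> - \<sigma>) * (\<alpha> 0)\<^sup>2) * path_sq T \<sigma> (\<lambda>s. \<phi> s - \<omega> s)"
proof -
  note [measurable] = measurable_heat_path[OF wp \<mu>] wave_phi(2)[OF wp \<mu>]
  have "AE s in lborel. hn (1 + 2*\<beta>) (\<phi> s) * indicator {0..T} s \<noteq> \<infinity>"
    by (rule nn_integral_PInf_AE[OF _ fin]) measurable
  then have "AE s in lborel. hn (2*\<beta>) (B (\<phi> s) - B (\<omega> s)) * indicator {0..T} s \<le>
     ennreal (\<alpha> 0 powr (2*\<beta> - \<sigma>) * (\<alpha> 0)\<^sup>2) * (hn \<sigma> (\<phi> s - \<omega> s) * indicator {0..T} s)"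
  proof eventually_elim
    case (elim s)
    show ?case
    proof (cases "s \<in> {0..T}")
      case True
      have "hn \<sigma> (\<phi> s) \<le> ennreal (\<alpha> 0 powr (\<sigma> - (1 + 2*\<beta>))) * hn (1 + 2*\<beta>) (\<phi> s)"
        by (rule hn_mono) (use \<beta> in auto)
      also have "\<dots> < \<infinity>" using elim True by (simp add: ennreal_mult_less_top less_top)
      finally have fin: "hn \<sigma> (\<phi> s) \<noteq> \<infinity>" by simp
      have "hn (2*\<beta>) (B (\<phi> s) - B (\<omega> s)) \<le> ennreal (\<alpha> 0 powr (2*\<beta> - \<sigma>)) * hn \<sigma> (B (\<phi> s) - B (\<omega> s))"
        by (rule hn_mono) simp
      also have "\<dots> \<le> ennreal (\<alpha> 0 powr (2*\<beta> - \<sigma>)) * (ennreal ((\<alpha> 0)\<^sup>2) * hn \<sigma> (\<phi> s - \<omega> s))"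
        by (intro mult_left_mono hn_B_diff fin) (use \<beta> in auto)
      finally show ?thesis using True by (simp add: ennreal_mult mult.assoc)
    qed simp
  qed
  then have "path_sq T (2*\<beta>) (\<lambda>s. B (\<phi> s) - B (\<omega> s)) \<le>
     (\<integral>\<^sup>+s. ennreal (\<alpha> 0 powr (2*\<beta> - \<sigma>) * (\<alpha> 0)\<^sup>2) * (hn \<sigma> (\<phi> s - \<omega> s) * indicator {0..T} s) \<partial>lborel)"
    by (rule nn_integral_mono_AE)
  also have "\<dots> = ennreal (\<alpha> 0 powr (2*\<beta> - \<sigma>) * (\<alpha> 0)\<^sup>2) * path_sq T \<sigma> (\<lambda>s. \<phi> s - \<omega> s)"
    by (rule nn_integral_cmult) measurable
  finally show ?thesis .
qed

text \<open>\<open>G\<close> collects all error sizes, \<open>M\<close> their fixed weights. The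
  three main summands of \<open>M\<close> stem from the change of the nonlinearity, its dropped
  modes, and the ramp; \<open>3 * c\<^sup>2\<close> comes from \<open>heat_control_sq_le\<close>.
  Neither depends on the horizon.\<close>

lemma V_le_wave:
  fixes C r \<epsilon> \<tau> :: real
  assumes r: "0 \<le> r" "control_sq \<psi> \<le> ennreal r"
    and W: "path_sq T (2*\<beta>) frc \<le> ennreal C"
    and N: "path_sq T (1 + 2*\<beta>) \<phi> \<le> ennreal C"
    and C: "0 \<le> C" and \<epsilon>: "0 < \<epsilon>" and \<tau>: "0 \<le> \<tau>" "tail x K \<le> ennreal \<tau>"
  defines "G \<equiv> (\<mu>\<^sup>2 * \<alpha> K powr (\<sigma> - 2*\<beta>) + \<alpha> K powr (\<sigma> - (1 + 2*\<beta>)) + 1 / \<alpha> K + (\<alpha> K)\<^sup>2 * \<mu>\<^sup>2 + \<alpha> K * \<mu>) * C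
      + \<alpha> K powr (1 + 2*\<beta>) * (norm (x - \<phi> T))\<^sup>2 + \<tau>"
  defines "M \<equiv> 3 * c\<^sup>2 * (\<alpha> 0 powr (2*\<beta> - \<sigma>) * (\<alpha> 0)\<^sup>2 * (2 + 2 * \<alpha> 0 powr (\<sigma> - 1 - (1 + 2*\<beta>))) + (\<alpha> 0)\<^sup>2 + (2 + 1 / \<alpha> 0)\<^sup>2)"
  shows "V E B Q x \<le> ereal (((1 + \<epsilon>) * r + (1 + 1/\<epsilon>) * M * G) / 2)"
proof -
  define g1 g2 g3 g4 g5 where "g1 = \<mu>\<^sup>2 * \<alpha> K powr (\<sigma> - 2*\<beta>) * C" and "g2 = \<alpha> K powr (\<sigma> - (1 + 2*\<beta>)) * C"
    and "g3 = 1 / \<alpha> K * C" and "g4 = ((\<alpha> K)\<^sup>2 * \<mu>\<^sup>2 + \<alpha> K * \<mu>) * C" and "g5 = \<alpha> K powr (1 + 2*\<beta>) * (norm (x - \<phi> T))\<^sup>2"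
  have g: "0 \<le> g1" "0 \<le> g2" "0 \<le> g3" "0 \<le> g4" "0 \<le> g5" using C \<mu> by (auto simp: g1_def g2_def g3_def g4_def g5_def)
  have G: "G = g1 + g2 + g3 + g4 + g5 + \<tau>"
    by (simp add: G_def g1_def g2_def g3_def g4_def g5_def algebra_simps)
  have G0: "0 \<le> G" using g \<tau> by (simp add: G)
  have "hn (1 + 2*\<beta>) gap \<le> ennreal (2 * \<alpha> K powr (1 + 2*\<beta>)) * hn 0 (x - \<phi> T)
     + ennreal (2 * ((\<alpha> K)\<^sup>2 * \<mu>\<^sup>2 + \<alpha> K * \<mu>)) * path_sq T (2*\<beta>) frc + tail x K"
    by (rule endpoint_gap_bound[OF wp \<mu>])
  also have "\<dots> \<le> ennreal (2 * \<alpha> K powr (1 + 2*\<beta>)) * ennreal ((norm (x - \<phi> T))\<^sup>2)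
     + ennreal (2 * ((\<alpha> K)\<^sup>2 * \<mu>\<^sup>2 + \<alpha> K * \<mu>)) * ennreal C + ennreal \<tau>"
    by (intro add_mono mult_left_mono W \<tau> zero_le) (simp add: hn_0)
  also have "\<dots> = ennreal (2 * \<alpha> K powr (1 + 2*\<beta>) * (norm (x - \<phi> T))\<^sup>2 + 2 * ((\<alpha> K)\<^sup>2 * \<mu>\<^sup>2 + \<alpha> K * \<mu>) * C) + ennreal \<tau>"
    using \<mu> C by (subst ennreal_linear) auto
  also have "\<dots> = ennreal (2 * g5 + 2 * g4 + \<tau>)"
  proof -
    have eq: "2 * \<alpha> K powr (1 + 2*\<beta>) * (norm (x - \<phi> T))\<^sup>2 + 2 * ((\<alpha> K)\<^sup>2 * \<mu>\<^sup>2 + \<alpha> K * \<mu>) * C = 2 * g5 + 2 * g4"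
      by (simp add: g4_def g5_def algebra_simps)
    show ?thesis unfolding eq using \<tau> g by (intro ennreal_plus[symmetric]) auto
  qed
  also have "\<dots> \<le> ennreal (2 * G)" using g \<tau> by (intro ennreal_leI) (simp add: G)
  finally have D: "hn (1 + 2*\<beta>) gap \<le> ennreal (2 * G)" .
  let ?q = "\<alpha> 0 powr (\<sigma> - 1 - (1 + 2*\<beta>))"
  have "path_sq T \<sigma> (\<lambda>s. \<phi> s - \<omega> s) \<le>
     ennreal (2 * (\<alpha> K powr (\<sigma> - 2*\<beta>) * \<mu>\<^sup>2)) * path_sq T (2*\<beta>) frc
     + ennreal (2 * \<alpha> K powr (\<sigma> - (1 + 2*\<beta>))) * path_sq T (1 + 2*\<beta>) \<phi>
     + ennreal ?q * hn (1 + 2*\<beta>) gap"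
    by (rule heat_path_close[OF wp \<mu>])
  also have "\<dots> \<le> ennreal (2 * (\<alpha> K powr (\<sigma> - 2*\<beta>) * \<mu>\<^sup>2)) * ennreal C
     + ennreal (2 * \<alpha> K powr (\<sigma> - (1 + 2*\<beta>))) * ennreal C + ennreal ?q * ennreal (2 * G)"
    by (intro add_mono mult_left_mono W N D zero_le)
  also have "\<dots> = ennreal (2 * (\<alpha> K powr (\<sigma> - 2*\<beta>) * \<mu>\<^sup>2) * C + 2 * \<alpha> K powr (\<sigma> - (1 + 2*\<beta>)) * C) + ennreal (?q * (2 * G))"
    using C G0 by (subst ennreal_linear) (simp_all add: ennreal_mult)
  also have "\<dots> = ennreal (2 * g1 + 2 * g2 + ?q * (2 * G))"
  proof -
    have eq: "2 * (\<alpha> K powr (\<sigma> - 2*\<beta>) * \<mu>\<^sup>2) * C + 2 * \<alpha> K powr (\<sigma> - (1 + 2*\<beta>)) * C = 2 * g1 + 2 * g2"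
      by (simp add: g1_def g2_def algebra_simps)
    show ?thesis unfolding eq using g G0 by (intro ennreal_plus[symmetric]) auto
  qed
  also have "\<dots> \<le> ennreal ((2 + 2 * ?q) * G)"
  proof (intro ennreal_leI)
    have "2 * g1 + 2 * g2 \<le> 2 * G" using g \<tau> by (simp add: G)
    then show "2 * g1 + 2 * g2 + ?q * (2 * G) \<le> (2 + 2 * ?q) * G" by (simp add: distrib_right)
  qed
  finally have close: "path_sq T \<sigma> (\<lambda>s. \<phi> s - \<omega> s) \<le> ennreal ((2 + 2 * ?q) * G)" .
  let ?p = "\<alpha> 0 powr (2*\<beta> - \<sigma>) * (\<alpha> 0)\<^sup>2"
  have "path_sq T (2*\<beta>) (\<lambda>s. B (\<phi> s) - B (\<omega> s)) \<le> ennreal ?p * ennreal ((2 + 2 * ?q) * G)"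
    by (rule order_trans[OF nn_integral_B_diff mult_left_mono[OF close zero_le]]) (use N in \<open>auto simp: top_unique\<close>)
  then have T1: "path_sq T (2*\<beta>) (\<lambda>s. B (\<phi> s) - B (\<omega> s)) \<le> ennreal (?p * ((2 + 2 * ?q) * G))"
    using G0 by (simp add: ennreal_mult)
  have "path_sq T (1 + 2*\<beta>) (\<lambda>s. B (\<phi> s)) \<le> (\<integral>\<^sup>+s. ennreal ((\<alpha> 0)\<^sup>2) * (hn (1 + 2*\<beta>) (\<phi> s) * indicator {0..T} s) \<partial>lborel)"
    using \<beta> by (intro nn_integral_mono) (auto simp: indicator_def intro!: hn_B)
  also have "\<dots> = ennreal ((\<alpha> 0)\<^sup>2) * path_sq T (1 + 2*\<beta>) \<phi>"
  proof -
    note [measurable] = wave_phi(2)[OF wp \<mu>]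
    show ?thesis by (rule nn_integral_cmult) measurable
  qed
  also have "\<dots> \<le> ennreal ((\<alpha> 0)\<^sup>2) * ennreal C" by (intro mult_left_mono N zero_le)
  finally have "ennreal (1 / \<alpha> K) * path_sq T (1 + 2*\<beta>) (\<lambda>s. B (\<phi> s)) \<le> ennreal (1 / \<alpha> K) * (ennreal ((\<alpha> 0)\<^sup>2) * ennreal C)"
    by (rule mult_left_mono) simp
  also have "\<dots> = ennreal ((\<alpha> 0)\<^sup>2 * g3)"
    using C by (simp add: g3_def flip: ennreal_mult)
  also have "\<dots> \<le> ennreal ((\<alpha> 0)\<^sup>2 * G)" using g \<tau> by (intro ennreal_leI mult_left_mono) (auto simp: G)
  finally have T2: "ennreal (1 / \<alpha> K) * path_sq T (1 + 2*\<beta>) (\<lambda>s. B (\<phi> s)) \<le> ennreal ((\<alpha> 0)\<^sup>2 * G)" .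
  have "ennreal ((2 + 1 / \<alpha> 0)\<^sup>2 / 2) * hn (1 + 2*\<beta>) gap \<le> ennreal ((2 + 1 / \<alpha> 0)\<^sup>2 / 2) * ennreal (2 * G)"
    by (intro mult_left_mono D zero_le)
  also have "\<dots> = ennreal ((2 + 1 / \<alpha> 0)\<^sup>2 / 2 * (2 * G))" using G0 by (intro ennreal_mult[symmetric]) auto
  also have "(2 + 1 / \<alpha> 0)\<^sup>2 / 2 * (2 * G) = (2 + 1 / \<alpha> 0)\<^sup>2 * G" by simp
  finally have T3: "ennreal ((2 + 1 / \<alpha> 0)\<^sup>2 / 2) * hn (1 + 2*\<beta>) gap \<le> ennreal ((2 + 1 / \<alpha> 0)\<^sup>2 * G)" .
  have nn: "0 \<le> ?p * ((2 + 2 * ?q) * G)" "0 \<le> (\<alpha> 0)\<^sup>2 * G" "0 \<le> (2 + 1 / \<alpha> 0)\<^sup>2 * G" using G0 by auto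
  have "(\<integral>\<^sup>+s. (\<Sum>k. ennreal ((a k s)\<^sup>2)) \<partial>lborel) \<le> ennreal (1 + \<epsilon>) * ennreal r +
      ennreal ((1 + 1/\<epsilon>) * (3 * c\<^sup>2)) * (ennreal (?p * ((2 + 2 * ?q) * G)) + ennreal ((\<alpha> 0)\<^sup>2 * G) + ennreal ((2 + 1 / \<alpha> 0)\<^sup>2 * G))"
    by (rule order_trans[OF heat_control_energy[OF \<epsilon>]]) (intro add_mono mult_left_mono r T1 T2 T3 zero_le)
  also have "ennreal (?p * ((2 + 2 * ?q) * G)) + ennreal ((\<alpha> 0)\<^sup>2 * G) + ennreal ((2 + 1 / \<alpha> 0)\<^sup>2 * G) =
      ennreal (?p * ((2 + 2 * ?q) * G) + (\<alpha> 0)\<^sup>2 * G + (2 + 1 / \<alpha> 0)\<^sup>2 * G)"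
    using nn by (simp only: ennreal_plus add_nonneg_nonneg)
  also have "ennreal (1 + \<epsilon>) * ennreal r + ennreal ((1 + 1/\<epsilon>) * (3 * c\<^sup>2)) * \<dots> =
      ennreal ((1 + \<epsilon>) * r + (1 + 1/\<epsilon>) * (3 * c\<^sup>2) * (?p * ((2 + 2 * ?q) * G) + (\<alpha> 0)\<^sup>2 * G + (2 + 1 / \<alpha> 0)\<^sup>2 * G))"
    using \<epsilon> r(1) nn by (intro ennreal_linear) auto
  also have "(1 + 1/\<epsilon>) * (3 * c\<^sup>2) * (?p * ((2 + 2 * ?q) * G) + (\<alpha> 0)\<^sup>2 * G + (2 + 1 / \<alpha> 0)\<^sup>2 * G) = (1 + 1/\<epsilon>) * M * G"
    unfolding M_def by (simp only: distrib_right mult.assoc distrib_left)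
  finally have en: "(\<integral>\<^sup>+s. (\<Sum>k. ennreal ((a k s)\<^sup>2)) \<partial>lborel) \<le> ennreal ((1 + \<epsilon>) * r + (1 + 1/\<epsilon>) * M * G)" .
  have M0: "0 \<le> M" unfolding M_def by (intro mult_nonneg_nonneg add_nonneg_nonneg) auto
  have "V E B Q (\<omega> T) \<le> ereal (((1 + \<epsilon>) * r + (1 + 1/\<epsilon>) * M * G) / 2)"
  proof (rule V_le_of_coeff[where \<phi>=\<omega> and a=a, OF _ _ heat_path_0[OF wp \<mu>] _ en])
    show "0 \<le> T" using wave_T[OF wp \<mu>] by simp
    show "continuous_on {0..T} \<omega>" by (rule continuous_heat_path[OF wp \<mu>])
    show "a k \<in> borel_measurable borel" for k by (rule measurable_heat_control[OF wp \<mu>])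
    show "0 \<le> (1 + \<epsilon>) * r + (1 + 1/\<epsilon>) * M * G"
      using \<epsilon> r(1) M0 G0 by (intro add_nonneg_nonneg mult_nonneg_nonneg) auto
  qed (rule heat_path_mild[OF wp \<mu>])
  then show ?thesis by (simp add: heat_path_T[OF wp \<mu>])
qed

end

section \<open>Compactness and the limit\<close>

lemma hn_le_iff: "hn \<delta> x \<le> ennreal M \<longleftrightarrow> (\<forall>n. (\<Sum>k<n. \<alpha> k powr \<delta> * (x \<bullet> e k)\<^sup>2) \<le> M)" if "M \<ge> 0"
proof -
  have "hn \<delta> x = (SUP n. ennreal (\<Sum>k<n. \<alpha> k powr \<delta> * (x \<bullet> e k)\<^sup>2))"
    unfolding hn_alt suminf_eq_SUP by (subst sum_ennreal) auto
  then show ?thesis using that by (simp add: SUP_le_iff ennreal_le_iff)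
qed

lemma closed_hn_ball: "closed {x. hn \<delta> x \<le> ennreal M}" if "M \<ge> 0"
proof -
  have "{x. hn \<delta> x \<le> ennreal M} = (\<Inter>n. {x. (\<Sum>k<n. \<alpha> k powr \<delta> * (x \<bullet> e k)\<^sup>2) \<le> M})"
    using hn_le_iff[OF that] by auto
  then show ?thesis by (auto intro!: closed_INT closed_Collect_le continuous_intros)
qed

text \<open>A box of coefficients is a Minkowski sum of compact segments, added one at a
  time.\<close>

lemma compact_finite_box:
  "\<exists>C. compact C \<and> (\<forall>a. (\<forall>k<n. \<bar>a k\<bar> \<le> R) \<longrightarrow> (\<Sum>k<n. a k *\<^sub>R e k) \<in> C)"
proof (induction n)
  case 0
  show ?case by (intro exI[of _ "{0}"]) auto
next
  case (Suc n)
  then obtain C where C: "compact C" "\<And>a. (\<forall>k<n. \<bar>a k\<bar> \<le> R) \<Longrightarrow> (\<Sum>k<n. a k *\<^sub>R e k) \<in> C" by blast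
  let ?D = "(\<lambda>t. t *\<^sub>R e n) ` {-R..R}"
  have "compact ?D" by (intro compact_continuous_image continuous_intros compact_Icc)
  from compact_sums[OF C(1) this] have "compact {u + v |u v. u \<in> C \<and> v \<in> ?D}" .
  moreover have "(\<Sum>k<Suc n. a k *\<^sub>R e k) \<in> {u + v |u v. u \<in> C \<and> v \<in> ?D}" if a: "\<forall>k<Suc n. \<bar>a k\<bar> \<le> R" for a
  proof -
    have "(\<Sum>k<n. a k *\<^sub>R e k) \<in> C" using a by (intro C(2)) auto
    moreover have "a n *\<^sub>R e n \<in> ?D" using a[rule_format, of n] by (intro imageI) auto
    ultimately show ?thesis by auto
  qed
  ultimately show ?case by blast
qed

text \<open>The compact embedding into H. Coefficients below \<open>n\<close> stay in a compact box,
  and the remainder has squared norm at most \<open>M * \<alpha> n powr (- \<delta>)\<close>, which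
  tends to 0 because the eigenvalues diverge.\<close>

lemma compact_hn_ball:
  assumes \<delta>: "\<delta> > 0" and M: "M \<ge> 0"
  shows "compact {x. hn \<delta> x \<le> ennreal M}"
  unfolding compact_eq_totally_bounded
proof (intro conjI allI impI)
  show "complete {x. hn \<delta> x \<le> ennreal M}" using closed_hn_ball[OF M] by (simp add: complete_eq_closed)
  fix r :: real assume r: "0 < r"
  have "((\<lambda>n. M * \<alpha> n powr (- \<delta>)) \<longlonglongrightarrow> M * 0)"
    by (intro tendsto_mult tendsto_const tendsto_neg_powr \<alpha>_lim) (use \<delta> in simp)
  then have "eventually (\<lambda>n. M * \<alpha> n powr (- \<delta>) < (r/2)\<^sup>2) sequentially"
    using r by (intro order_tendstoD(2)) auto
  then obtain n where n: "M * \<alpha> n powr (- \<delta>) < (r/2)\<^sup>2" by (auto simp: eventually_sequentially)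
  define R where "R = sqrt (\<alpha> 0 powr (- \<delta>) * M)"
  have R0: "0 \<le> \<alpha> 0 powr (- \<delta>) * M" using M by simp
  obtain C where C: "compact C" "\<And>a. (\<forall>k<n. \<bar>a k\<bar> \<le> R) \<Longrightarrow> (\<Sum>k<n. a k *\<^sub>R e k) \<in> C"
    using compact_finite_box by metis
  obtain F where F: "finite F" "C \<subseteq> (\<Union>x\<in>F. ball x (r/2))"
    using C(1) r unfolding compact_eq_totally_bounded by (meson half_gt_zero)
  have "x \<in> (\<Union>x\<in>F. ball x r)" if x: "hn \<delta> x \<le> ennreal M" for x
  proof -
    let ?P = "\<Sum>k<n. (x \<bullet> e k) *\<^sub>R e k"
    have "hn 0 x \<le> ennreal (\<alpha> 0 powr (0 - \<delta>)) * hn \<delta> x" by (rule hn_mono) (use \<delta> in simp)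
    also have "\<dots> \<le> ennreal (\<alpha> 0 powr (0 - \<delta>)) * ennreal M" by (intro mult_left_mono x zero_le)
    finally have "(norm x)\<^sup>2 \<le> \<alpha> 0 powr (- \<delta>) * M"
      using R0 M by (simp add: hn_0 flip: ennreal_mult)
    then have "norm x \<le> R" unfolding R_def by (rule real_le_rsqrt)
    then have "?P \<in> C" using coeff_le_norm[of x] by (intro C(2)) (meson order_trans)
    then obtain z where z: "z \<in> F" "dist z ?P < r/2" using F(2) by auto
    have "hn 0 (x - ?P) \<le> (\<Sum>k. ennreal (\<alpha> n powr (- \<delta>)) * (ennreal (\<alpha> k powr \<delta>) * ennreal ((x \<bullet> e k)\<^sup>2)))"
      unfolding hn_def
    proof (intro ennreal_suminf_mono)
      fix k
      show "ennreal (\<alpha> k powr 0) * ennreal (((x - ?P) \<bullet> e k)\<^sup>2) \<le>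
          ennreal (\<alpha> n powr (- \<delta>)) * (ennreal (\<alpha> k powr \<delta>) * ennreal ((x \<bullet> e k)\<^sup>2))"
      proof (cases "k < n")
        case False
        have "1 = \<alpha> k powr (- \<delta>) * \<alpha> k powr \<delta>" by (simp flip: powr_add)
        also have "\<dots> \<le> \<alpha> n powr (- \<delta>) * \<alpha> k powr \<delta>"
          using False \<delta> by (intro mult_right_mono powr_mono2' \<alpha>_mono) auto
        finally have "1 * (x \<bullet> e k)\<^sup>2 \<le> \<alpha> n powr (- \<delta>) * \<alpha> k powr \<delta> * (x \<bullet> e k)\<^sup>2" by (rule mult_right_mono) simp
        then show ?thesis using False
          by (simp add: inner_diff_left inner_sum_basis ennreal_leI mult.assoc flip: ennreal_mult)
      qed (simp add: inner_diff_left inner_sum_basis)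
    qed
    also have "\<dots> = ennreal (\<alpha> n powr (- \<delta>)) * hn \<delta> x" unfolding hn_def ennreal_suminf_cmult ..
    also have "\<dots> \<le> ennreal (\<alpha> n powr (- \<delta>)) * ennreal M" by (intro mult_left_mono x zero_le)
    finally have "(norm (x - ?P))\<^sup>2 \<le> M * \<alpha> n powr (- \<delta>)"
      using M by (simp add: hn_0 mult.commute flip: ennreal_mult)
    then have "(norm (x - ?P))\<^sup>2 < (r/2)\<^sup>2" using n by simp
    then have "norm (x - ?P) < r/2" by (rule power2_less_imp_less) (use r in simp)
    then have "dist z x < r" using z(2) dist_triangle[of z x ?P] by (simp add: dist_norm norm_minus_commute)
    then show ?thesis using z(1) by auto
  qed
  then show "\<exists>k. finite k \<and> {x. hn \<delta> x \<le> ennreal M} \<subseteq> (\<Union>x\<in>k. ball x r)" using F(1) by blast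
qed

lemma tail_real:
  assumes "hn (1 + 2*\<beta>) x < \<infinity>"
  obtains \<tau> :: "nat \<Rightarrow> real" where "\<And>K. 0 \<le> \<tau> K" "\<And>K. tail x K = ennreal (\<tau> K)" "\<tau> \<longlonglongrightarrow> 0"
proof -
  define h where "h = (\<lambda>k. \<alpha> k powr (1 + 2*\<beta>) * (x \<bullet> e k)\<^sup>2)"
  have h: "summable h" using assms Hspace_iff[of x "1 + 2*\<beta>"] by (simp add: Hspace_def h_def)
  define \<tau> where "\<tau> = (\<lambda>K. suminf h - sum h {..<K})"
  have s: "(\<lambda>k. if k < K then 0 else h k) sums \<tau> K" for K
  proof -
    have "(\<lambda>k. h k - (if k \<in> {..<K} then h k else 0)) sums (suminf h - sum h {..<K})"
      by (intro sums_diff summable_sums h sums_If_finite_set) auto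
    then show ?thesis unfolding \<tau>_def by (rule back_subst[where P="\<lambda>f. f sums _"]) auto
  qed
  have nn: "0 \<le> (if k < K then 0 else h k)" for k K by (simp add: h_def)
  show ?thesis
  proof (rule that[of \<tau>])
    show "0 \<le> \<tau> K" for K using sums_le[OF nn sums_zero s] .
    show "tail x K = ennreal (\<tau> K)" for K
    proof -
      have "tail x K = (\<Sum>k. ennreal (if k < K then 0 else h k))"
        unfolding tail_def by (intro arg_cong[where f=suminf] ext) (simp add: h_def ennreal_mult)
      also have "\<dots> = ennreal (\<Sum>k. if k < K then 0 else h k)"
        by (rule suminf_ennreal2[OF nn sums_summable[OF s]])
      finally show ?thesis using sums_unique[OF s[of K]] by simp
    qed
    have "(\<lambda>K. suminf h - sum h {..<K}) \<longlonglongrightarrow> suminf h - suminf h"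
      by (intro tendsto_intros summable_LIMSEQ h)
    then show "\<tau> \<longlonglongrightarrow> 0" by (simp add: \<tau>_def)
  qed
qed

text \<open>Three limits in forced order: along the sequence with \<open>K\<close> fixed, removing
  every term with \<mu> or the endpoint distance; then \<open>K\<close> to infinity, removing the
  negative powers of \<open>\<alpha> K\<close> and the tail; finally \<epsilon> to 0, whose
  reciprocal multiplied the errors.\<close>

lemma V_le_of_wave_limit:
  fixes C r :: real and \<mu> T :: "nat \<Rightarrow> real" and \<phi> \<psi> :: "nat \<Rightarrow> real \<Rightarrow> 'h"
  assumes wp: "\<And>n. wave_path (\<mu> n) (T n) (\<phi> n) (\<psi> n)" and \<mu>: "\<And>n. 0 < \<mu> n" "\<mu> \<longlonglongrightarrow> 0"
    and r: "0 \<le> r" "\<And>n. control_sq (\<psi> n) \<le> ennreal r"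
    and W: "\<And>n. path_sq (T n) (2*\<beta>) (forcing (\<phi> n) (\<psi> n)) \<le> ennreal C"
    and N: "\<And>n. path_sq (T n) (1 + 2*\<beta>) (\<phi> n) \<le> ennreal C"
    and C: "0 \<le> C" and x: "hn (1 + 2*\<beta>) x < \<infinity>" "(\<lambda>n. \<phi> n (T n)) \<longlonglongrightarrow> x"
  shows "V E B Q x \<le> ereal (r / 2)"
proof -
  obtain \<tau> where \<tau>: "\<And>K. 0 \<le> \<tau> K" "\<And>K. tail x K = ennreal (\<tau> K)" "\<tau> \<longlonglongrightarrow> 0"
    using tail_real[OF x(1)] by blast
  define M where "M = 3 * c\<^sup>2 * (\<alpha> 0 powr (2*\<beta> - \<sigma>) * (\<alpha> 0)\<^sup>2 * (2 + 2 * \<alpha> 0 powr (\<sigma> - 1 - (1 + 2*\<beta>))) + (\<alpha> 0)\<^sup>2 + (2 + 1 / \<alpha> 0)\<^sup>2)"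
  \<comment> \<open>The bound of \<open>V_le_wave\<close> as a function of \<epsilon>,
    \<open>K\<close>, the small parameter \<open>m\<close> and the endpoint distance
    \<open>\<nu>\<close>; it is continuous in the last two, so they may be set to 0.\<close>
  define bd where "bd = (\<lambda>\<epsilon> K m \<nu>. ((1 + \<epsilon>) * r + (1 + 1/\<epsilon>) * M *
      ((m\<^sup>2 * \<alpha> K powr (\<sigma> - 2*\<beta>) + \<alpha> K powr (\<sigma> - (1 + 2*\<beta>)) + 1 / \<alpha> K + (\<alpha> K)\<^sup>2 * m\<^sup>2 + \<alpha> K * m) * C
        + \<alpha> K powr (1 + 2*\<beta>) * \<nu>\<^sup>2 + \<tau> K)) / 2)"
  have 1: "V E B Q x \<le> ereal (bd \<epsilon> K 0 0)" if \<epsilon>: "\<epsilon> > 0" for \<epsilon> K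
  proof (rule LIMSEQ_le_const)
    have "(\<lambda>n. bd \<epsilon> K (\<mu> n) (norm (x - \<phi> n (T n)))) \<longlonglongrightarrow> bd \<epsilon> K 0 (norm (x - x))"
      unfolding bd_def by (intro tendsto_intros \<mu> x) auto
    then show "(\<lambda>n. ereal (bd \<epsilon> K (\<mu> n) (norm (x - \<phi> n (T n))))) \<longlonglongrightarrow> ereal (bd \<epsilon> K 0 0)"
      by (intro tendsto_ereal) simp
    show "\<exists>N. \<forall>n\<ge>N. V E B Q x \<le> ereal (bd \<epsilon> K (\<mu> n) (norm (x - \<phi> n (T n))))"
      unfolding M_def bd_def
      by (intro exI allI impI V_le_wave[OF wp \<mu>(1) r W N C \<epsilon> \<tau>(1)]) (simp add: \<tau>(2))
  qed
  have 2: "V E B Q x \<le> ereal ((1 + \<epsilon>) * r / 2)" if \<epsilon>: "\<epsilon> > 0" for \<epsilon>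
  proof (rule LIMSEQ_le_const)
    have inv: "(\<lambda>K. 1 / \<alpha> K) \<longlonglongrightarrow> 0"
      by (rule tendsto_divide_0[OF tendsto_const filterlim_at_top_imp_at_infinity[OF \<alpha>_lim]])
    have pw: "(\<lambda>K. \<alpha> K powr (\<sigma> - (1 + 2*\<beta>))) \<longlonglongrightarrow> 0"
      by (rule tendsto_neg_powr[OF _ \<alpha>_lim]) (use \<beta> in auto)
    have "(\<lambda>K. ((1 + \<epsilon>) * r + (1 + 1/\<epsilon>) * M * ((\<alpha> K powr (\<sigma> - (1 + 2*\<beta>)) + 1 / \<alpha> K) * C + \<tau> K)) / 2) \<longlonglongrightarrow>
       ((1 + \<epsilon>) * r + (1 + 1/\<epsilon>) * M * ((0 + 0) * C + 0)) / 2"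
      by (intro tendsto_divide tendsto_add tendsto_mult tendsto_const inv pw \<tau>(3)) auto
    then show "(\<lambda>K. ereal (bd \<epsilon> K 0 0)) \<longlonglongrightarrow> ereal ((1 + \<epsilon>) * r / 2)"
      unfolding bd_def by (intro tendsto_ereal) simp
  qed (use 1[OF \<epsilon>] in blast)
  show ?thesis
  proof (rule LIMSEQ_le_const)
    have "(\<lambda>n. (1 + inverse (real (Suc n))) * r / 2) \<longlonglongrightarrow> (1 + 0) * r / 2"
      by (intro tendsto_intros LIMSEQ_inverse_real_of_nat) auto
    then show "(\<lambda>n. ereal ((1 + inverse (real (Suc n))) * r / 2)) \<longlonglongrightarrow> ereal (r / 2)"
      by (intro tendsto_ereal) simp
    show "\<exists>N. \<forall>n\<ge>N. V E B Q x \<le> ereal ((1 + inverse (real (Suc n))) * r / 2)"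
      by (intro exI allI impI 2) simp
  qed
qed

text \<open>A violated inequality leaves room for a finite level \<open>L\<close>, and then wave
  paths with action below \<open>L\<close> end in \<open>N\<close> for arbitrarily small \<mu>.
  Compactness and closedness of \<open>N\<close> give a limit endpoint \<open>x \<in> N\<close> with
  \<open>V\<close> at most \<open>L\<close>, against the choice of \<open>L\<close>.\<close>

lemma quasi_potential_liminf:
  fixes S :: "real \<Rightarrow> real \<Rightarrow> 'h \<times> 'v \<Rightarrow> 'h \<times> 'v"
  assumes S: "\<And>\<mu>. \<mu> > 0 \<Longrightarrow> C0_semigroup (S \<mu>)"
    and gen: "\<And>\<mu>. \<mu> > 0 \<Longrightarrow> generator (S \<mu>) = A_mu e \<alpha> \<iota> \<mu>"
    and N: "closed N"
  shows "(INF x\<in>N. V E B Q x) \<le> Liminf (at_right 0) (\<lambda>\<mu>. INF x\<in>N. V_mu S \<iota> B Q \<mu> x)"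
proof (rule ccontr)
  let ?f = "\<lambda>\<mu>. INF x\<in>N. V_mu S \<iota> B Q \<mu> x"
  assume "\<not> ?thesis"
  then obtain L where L: "Liminf (at_right 0) ?f < ereal L" "ereal L < (INF x\<in>N. V E B Q x)"
    using ereal_dense2[of "Liminf (at_right 0) ?f" "INF x\<in>N. V E B Q x"] by (auto simp: not_le)
  obtain \<mu>0 C where \<mu>0: "0 < \<mu>0" and C: "0 \<le> C"
    and W: "\<And>\<mu> T \<phi> \<psi>. 0 < \<mu> \<Longrightarrow> \<mu> \<le> \<mu>0 \<Longrightarrow> wave_path \<mu> T \<phi> \<psi> \<Longrightarrow>
       path_sq T (2*\<beta>) (forcing \<phi> \<psi>) \<le> ennreal C * control_sq \<psi>"
    and Nb: "\<And>\<mu> T \<phi> \<psi>. 0 < \<mu> \<Longrightarrow> \<mu> \<le> \<mu>0 \<Longrightarrow> wave_path \<mu> T \<phi> \<psi> \<Longrightarrow>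
       path_sq T (1 + 2*\<beta>) \<phi> \<le> ennreal C * control_sq \<psi>"
    by (rule wave_bounds) blast
  have "\<exists>\<mu> T \<phi> \<psi>. 0 < \<mu> \<and> \<mu> \<le> \<mu>0 \<and> \<mu> \<le> inverse (real (Suc n)) \<and> wave_path \<mu> T \<phi> \<psi> \<and> \<phi> T \<in> N \<and>
      (\<integral>s. (norm (\<psi> s))\<^sup>2 \<partial>lborel) < 2 * L" for n
  proof -
    have "\<not> eventually (\<lambda>\<mu>. ereal L \<le> ?f \<mu>) (at_right 0)"
      using L(1) Liminf_bounded[of "ereal L" ?f "at_right 0"] by (auto simp: not_le[symmetric])
    moreover have "0 < min \<mu>0 (inverse (real (Suc n)))" using \<mu>0 by simp
    ultimately obtain \<mu> where \<mu>: "0 < \<mu>" "\<mu> < min \<mu>0 (inverse (real (Suc n)))" "?f \<mu> < ereal L"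
      unfolding eventually_at_right_field by (meson not_le)
    then obtain x where x: "x \<in> N" "V_mu S \<iota> B Q \<mu> x < ereal L" by (auto simp: INF_less_iff)
    obtain T \<phi> \<psi> where "wave_path \<mu> T \<phi> \<psi>" "\<phi> T = x" "(\<integral>s. (norm (\<psi> s))\<^sup>2 \<partial>lborel) < 2 * L"
      by (rule V_mu_lessE[OF S[OF \<mu>(1)] gen[OF \<mu>(1)] \<mu>(1) x(2)])
    then show ?thesis using \<mu> x(1) by (intro exI[of _ \<mu>] exI[of _ T] exI[of _ \<phi>] exI[of _ \<psi>]) auto
  qed
  then obtain \<mu> T \<phi> \<psi> where h: "\<And>n :: nat. 0 < \<mu> n" "\<And>n. \<mu> n \<le> \<mu>0" "\<And>n. \<mu> n \<le> inverse (real (Suc n))"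
    "\<And>n. wave_path (\<mu> n) (T n) (\<phi> n) (\<psi> n)" "\<And>n. \<phi> n (T n) \<in> N"
    "\<And>n. (\<integral>s. (norm (\<psi> n s))\<^sup>2 \<partial>lborel) < 2 * L"
    by metis
  have \<mu>lim: "\<mu> \<longlonglongrightarrow> 0"
    by (rule tendsto_sandwich[OF _ _ tendsto_const LIMSEQ_inverse_real_of_nat])
      (use h(1,3) in \<open>auto intro: always_eventually less_imp_le\<close>)
  have en: "control_sq (\<psi> n) \<le> ennreal (2 * L)" for n
    using nn_integral_eq_integral[OF wave_psi(2)[OF h(4) h(1)]] h(6)[of n] by (simp add: ennreal_leI less_imp_le)
  have L0: "0 \<le> L"
  proof -
    have "0 \<le> (\<integral>s. (norm (\<psi> 0 s))\<^sup>2 \<partial>lborel)" by (rule Bochner_Integration.integral_nonneg) simp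
    then show ?thesis using h(6)[of 0] by linarith
  qed
  have CL: "ennreal C * control_sq (\<psi> n) \<le> ennreal (C * (2 * L))" for n
    using mult_left_mono[OF en zero_le, of "ennreal C" n] C L0 by (simp add: ennreal_mult)
  note W' = order_trans[OF W[OF h(1,2,4)] CL] and N' = order_trans[OF Nb[OF h(1,2,4)] CL]
  have CL0: "0 \<le> C * (2 * L)" using C L0 by simp
  \<comment> \<open>The endpoint bound at \<tau> = 2\<beta> lands in H^(1+2\<beta>), a space with
    positive index, hence in a compact subset of H.\<close>
  have end_bd: "\<phi> n (T n) \<in> {x. hn (1 + 2*\<beta>) x \<le> ennreal (C * (2 * L))}" for n
    using order_trans[OF wave_endpoint[OF h(4) h(1), where \<tau>="2*\<beta>"] W'] by (simp add: add.commute)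
  have "compact {x. hn (1 + 2*\<beta>) x \<le> ennreal (C * (2 * L))}"
    by (rule compact_hn_ball) (use \<beta> CL0 in auto)
  from this[THEN compact_imp_seq_compact, THEN seq_compactE, of "\<lambda>n. \<phi> n (T n)"] end_bd
  obtain x \<rho> where x: "x \<in> {x. hn (1 + 2*\<beta>) x \<le> ennreal (C * (2 * L))}" "strict_mono \<rho>"
    "((\<lambda>n. \<phi> n (T n)) \<circ> \<rho>) \<longlonglongrightarrow> x"
    by metis
  have "x \<in> N" using closed_sequentially[OF N _ x(3)] h(5) by simp
  moreover have "V E B Q x \<le> ereal (2 * L / 2)"
  proof (rule V_le_of_wave_limit[where \<mu>="\<mu> \<circ> \<rho>" and T="T \<circ> \<rho>" and \<phi>="\<phi> \<circ> \<rho>" and \<psi>="\<psi> \<circ> \<rho>" and C="C * (2 * L)"])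
    show "(\<mu> \<circ> \<rho>) \<longlonglongrightarrow> 0" using \<mu>lim x(2) by (rule LIMSEQ_subseq_LIMSEQ)
    show "hn (1 + 2*\<beta>) x < \<infinity>" using x(1) by (auto intro: le_less_trans)
  qed (use h en W' N' CL0 L0 x(3) in \<open>auto simp: comp_def\<close>)
  ultimately have "(INF x\<in>N. V E B Q x) \<le> ereal L" by (intro INF_lower2) auto
  with L(2) show False by simp
qed

end

section \<open>The theorem\<close>

theorem theorem8p2:
  fixes D :: "(real ^ 'd) set"
    and rep :: "'h::{real_inner,banach,second_countable_topology} \<Rightarrow> real ^ 'd \<Rightarrow> real"
    and e :: "nat \<Rightarrow> 'h"
    and \<alpha> lam :: "nat \<Rightarrow> real"
    and \<iota> :: "'h \<Rightarrow> 'v::{real_inner,banach,second_countable_topology}"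
    and Q B :: "'h \<Rightarrow> 'h"
    and DB :: "'h \<Rightarrow> 'h \<Rightarrow> 'h"
    and \<beta> c :: real
    and \<gamma> :: "real \<Rightarrow> real"
    and E :: "real \<Rightarrow> 'h \<Rightarrow> 'h"
    and S :: "real \<Rightarrow> real \<Rightarrow> 'h \<times> 'v \<Rightarrow> 'h \<times> 'v"
    and N :: "'h set"
  assumes "open D" and "bounded D"
    and "is_L2_space D rep"
    and "complete_orthonormal e"
    and "\<And>k. (e k, - \<alpha> k *\<^sub>R e k) \<in> dirichlet_laplacian D rep"
    and "0 < \<alpha> 0" and "\<And>k. \<alpha> k \<le> \<alpha> (Suc k)"
    and "\<alpha> \<in> \<Theta>(\<lambda>k. real k powr (2 / real CARD('d)))"
    and "is_negative_Hspace e \<alpha> (-1) \<iota>"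
    and "bounded_linear Q" and "\<And>k. Q (e k) = lam k *\<^sub>R e k"
    and "c > 0" and "\<beta> > (real CARD('d) - 2) / 4"
    and "\<And>k. (1/c) * \<alpha> k powr (-\<beta>) \<le> lam k" and "\<And>k. lam k \<le> c * \<alpha> k powr (-\<beta>)"
    and "\<And>\<delta>. \<delta> \<in> {0..1 + 2*\<beta>} \<Longrightarrow> Hlipschitz e \<alpha> \<delta> (\<gamma> \<delta>) B"
    and "\<And>\<delta>. \<delta> \<in> {0..1 + 2*\<beta>} \<Longrightarrow> \<gamma> \<delta> < \<alpha> 0"
    and "B 0 = 0"
    and "\<And>x. x \<in> Hspace e \<alpha> (2*\<beta>) \<Longrightarrow> Hhas_derivative e \<alpha> (2*\<beta>) B (DB x) x"
    and "(SUP x\<in>Hspace e \<alpha> (2*\<beta>). Honorm e \<alpha> (2*\<beta>) (DB x)) = ereal (\<gamma> (2*\<beta>))"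
    and "C0_semigroup E" and "generator E = dirichlet_laplacian D rep"
    and "\<And>\<mu>. \<mu> > 0 \<Longrightarrow> C0_semigroup (S \<mu>)"
    and "\<And>\<mu>. \<mu> > 0 \<Longrightarrow> generator (S \<mu>) = A_mu e \<alpha> \<iota> \<mu>"
    and "closed N"
  shows "(INF x\<in>N. V E B Q x) \<le> Liminf (at_right 0) (\<lambda>\<mu>. INF x\<in>N. V_mu S \<iota> B Q \<mu> x)"
proof -
  \<comment> \<open>The dimension is a positive cardinality, so the worst case is d = 1.\<close>
  have "-1/4 \<le> (real m - 2) / 4" if "0 < m" for m :: nat
    using that by simp
  from le_less_trans[OF this[OF zero_less_card_finite] assms(13)] have \<beta>: "\<beta> > -1/4" .
  have \<alpha>_pos: "0 < \<alpha> k" for k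
    using lift_Suc_mono_le[of \<alpha> 0 k] assms(6,7) by (meson le0 less_le_trans)
  have lim: "filterlim \<alpha> at_top sequentially"
  proof -
    let ?g = "\<lambda>k. real k powr (2 / real CARD('d))"
    \<comment> \<open>The lower half of the two-sided asymptotics forces divergence of the
      eigenvalues.\<close>
    have "?g \<in> O(\<alpha>)" using \<open>\<alpha> \<in> \<Theta>(?g)\<close> by (simp add: bigtheta_sym bigthetaD1)
    then obtain C where C: "C > 0" "eventually (\<lambda>k. norm (?g k) \<le> C * norm (\<alpha> k)) sequentially"
      by (elim landau_o.bigE) auto
    have "filterlim (\<lambda>k. (1/C) * exp (2 / real CARD('d) * ln (real k))) at_top sequentially"
      using C(1) by (intro filterlim_tendsto_pos_mult_at_top[OF tendsto_const]
          filterlim_compose[OF exp_at_top] filterlim_compose[OF ln_at_top filterlim_real_sequentially]) auto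
    moreover have "eventually (\<lambda>k. (1/C) * exp (2 / real CARD('d) * ln (real k)) = (1/C) * ?g k) sequentially"
      using eventually_gt_at_top[of 0] by eventually_elim (simp add: powr_def)
    ultimately have "filterlim (\<lambda>k. (1/C) * ?g k) at_top sequentially"
      by (subst (asm) filterlim_cong[OF refl refl])
    moreover have "eventually (\<lambda>k. (1/C) * ?g k \<le> \<alpha> k) sequentially"
      using C(2) by eventually_elim (use C(1) \<alpha>_pos in \<open>simp add: field_simps abs_of_pos\<close>)
    ultimately show ?thesis by (rule filterlim_at_top_mono)
  qed
  have gen: "(e k, - \<alpha> k *\<^sub>R e k) \<in> generator E" for k
    unfolding \<open>generator E = dirichlet_laplacian D rep\<close> by (rule assms(5))
  interpret smoluchowski e \<alpha> lam \<iota> Q B \<beta> c \<gamma> E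
    by (intro smoluchowski.intro complete_orthonormal_seq.intro smoluchowski_axioms.intro)
      (fact assms lim \<beta> gen)+
  show ?thesis by (rule quasi_potential_liminf) (fact assms)+
qed

end
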